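(* Let $d\ge1$ and $r\ge1$. (1) If $f:M_d^r\to M_d$ is a multilinear trace polynomial in $r$ variables with $f(X_1,\dots,X_r)\ge0$ whenever $X_1,\dots,X_r\ge0$, then there is $\alpha\in\mathbb{C}S_{r+1}$ such that $f(X_1,\dots,X_r)=\operatorname{tr}_{1\dots r}\big[\hat T(\alpha)(X_1\otimes\cdots\otimes X_r\otimes\mathbb{1})\big]$ for all $X_i\in M_d$, and $\hat T(\alpha)$ is a hermitian block-positive operator on $(\mathbb{C}^d)^{\otimes(r+1)}$ satisfying $U^{\otimes(r+1)}\hat T(\alpha)(U^\dagger)^{\otimes(r+1)}=\hat T(\alpha)$ for all unitaries $U\in M_d$. (2) Conversely, if $\mathcal{B}$ is a block-positive operator on $(\mathbb{C}^d)^{\otimes(r+1)}$ with $U^{\otimes(r+1)}\mathcal{B}(U^\dagger)^{\otimes(r+1)}=\mathcal{B}$ for all unitaries $U$, then $f_{\mathcal{B}}(X_1,\dots,X_r)=\operatorname{tr}_{1\dots r}[\mathcal{B}(X_1\otimes\cdots\otimes X_r\otimes\mathbb{1})]$ is a multilinear trace polynomial with $f_{\mathcal{B}}(X_1,\dots,X_r)\ge0$ whenever $X_1,\dots,X_r\ge0$. (3) For such a unitary-invariant operator $\mathcal{W}$, $f_{\mathcal{W}}$ is an optimal trace polynomial inequality on the positive cone if and only if $\mathcal{W}$ is an optimal $U^{\otimes(r+1)}$-invariant (Werner state) entanglement witness.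
   Context: $M_d$ is the set of complex $d\times d$ matrices; $A\ge0$ means $A$ is positive semidefinite. A trace polynomial in variables $X_1,\dots,X_r$ is a complex linear combination of terms $X_{\alpha_1}\cdots X_{\alpha_s}\prod_j\operatorname{tr}(X_{\beta^{(j)}_1}\cdots X_{\beta^{(j)}_{t_j}})$ (a term with no untraced monomial means the scalar times $\mathbb{1}$); it is multilinear if it is linear in each variable. $S_{r+1}$ acts on $(\mathbb{C}^d)^{\otimes(r+1)}$ by $T(\pi)|v_1\rangle\otimes\cdots\otimes|v_{r+1}\rangle=|v_{\pi^{-1}(1)}\rangle\otimes\cdots\otimes|v_{\pi^{-1}(r+1)}\rangle$, and $\hat T(\sum_\pi a_\pi\pi)=\sum_\pi a_\pi T(\pi)$ for elements of the group algebra $\mathbb{C}S_{r+1}$. $\operatorname{tr}_{1\dots r}$ is the partial trace over the first $r$ tensor factors. An operator $\mathcal{B}$ on $(\mathbb{C}^d)^{\otimes(r+1)}$ is block-positive if $\operatorname{tr}[\mathcal{B}\rho]\ge0$ for all separable states $\rho$ (convex combinations of product states $\rho_1\otimes\cdots\otimes\rho_{r+1}$, where states are positive semidefinite matrices of trace one). An entanglement witness is a block-positive $\mathcal{W}$ with $\operatorname{tr}[\mathcal{W}\sigma]<0$ for some (entangled) state $\sigma$; it is optimal if moreover $\operatorname{tr}[\mathcal{W}\tilde\rho]=0$ for some separable state $\tilde\rho$. A trace polynomial $f$ that is positive semidefinite on all tuples of positive semidefinite matrices is an optimal trace polynomial inequality on the positive cone if additionally the smallest eigenvalue of $f(\tilde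 X_1,\dots,\tilde X_r)$ is $0$ for some nonzero positive semidefinite $\tilde X_1,\dots,\tilde X_r$.
   Formalization: Part (3) is proved for invariant W assumed to be an entanglement witness; for merely block-positive W it fails: with d=2, r=1, W=(1−SWAP)/2, f_W is optimal, but W is positive semidefinite and so not a witness. *)

theory Defs
  imports "Jordan_Normal_Form.Char_Poly" "HOL-Combinatorics.Permutations"
begin

definition mtrace :: "complex mat \<Rightarrow> complex" where
  "mtrace A = (\<Sum>i<dim_row A. A $$ (i, i))"

definition nonneg_c :: "complex \<Rightarrow> bool" where
  "nonneg_c z \<longleftrightarrow> Im z = 0 \<and> 0 \<le> Re z"

definition neg_c :: "complex \<Rightarrow> bool" where
  "neg_c z \<longleftrightarrow> Im z = 0 \<and> Re z < 0"

definition psd :: "nat \<Rightarrow> complex mat \<Rightarrow> bool" where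
  "psd d A \<longleftrightarrow> A \<in> carrier_mat d d \<and>
     (\<forall>v :: nat \<Rightarrow> complex. nonneg_c (\<Sum>i<d. \<Sum>j<d. cnj (v i) * A $$ (i, j) * v j))"

definition adj :: "complex mat \<Rightarrow> complex mat" where
  "adj U = mat (dim_col U) (dim_row U) (\<lambda>(i, j). cnj (U $$ (j, i)))"

definition unitary_d :: "nat \<Rightarrow> complex mat \<Rightarrow> bool" where
  "unitary_d d U \<longleftrightarrow> U \<in> carrier_mat d d \<and> U * adj U = 1\<^sub>m d"

definition smallest_eig_zero :: "complex mat \<Rightarrow> bool" where
  "smallest_eig_zero A \<longleftrightarrow> eigenvalue A 0 \<and>
     (\<forall>k. eigenvalue A k \<longrightarrow> Im k = 0 \<and> 0 \<le> Re k)"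

text \<open>A term: (coefficient, untraced word, list of traced words); variables are 0..r-1.
  The empty untraced word means the identity. A trace polynomial is a list of terms.\<close>
type_synonym tpoly = "(complex \<times> nat list \<times> nat list list) list"

definition word_eval :: "nat \<Rightarrow> complex mat list \<Rightarrow> nat list \<Rightarrow> complex mat" where
  "word_eval d Xs w = foldr (\<lambda>i M. Xs ! i * M) w (1\<^sub>m d)"

definition tp_eval :: "nat \<Rightarrow> complex mat list \<Rightarrow> tpoly \<Rightarrow> complex mat" where
  "tp_eval d Xs p = foldr (\<lambda>(c, u, ts) M.
      (c * prod_list (map (\<lambda>w. mtrace (word_eval d Xs w)) ts)) \<cdot>\<^sub>m word_eval d Xs u + M)
      p (0\<^sub>m d d)"

definition tp_multilinear :: "nat \<Rightarrow> tpoly \<Rightarrow> bool" where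
  "tp_multilinear r p \<longleftrightarrow> (\<forall>(c, u, ts) \<in> set p. mset (u @ concat ts) = mset [0..<r])"

definition valid_args :: "nat \<Rightarrow> nat \<Rightarrow> complex mat list \<Rightarrow> bool" where
  "valid_args d r Xs \<longleftrightarrow> length Xs = r \<and> (\<forall>X\<in>set Xs. X \<in> carrier_mat d d)"

definition is_multilinear_tp :: "nat \<Rightarrow> nat \<Rightarrow> (complex mat list \<Rightarrow> complex mat) \<Rightarrow> bool" where
  "is_multilinear_tp d r f \<longleftrightarrow>
     (\<exists>p. tp_multilinear r p \<and> (\<forall>Xs. valid_args d r Xs \<longrightarrow> f Xs = tp_eval d Xs p))"

definition positive_on_cone :: "nat \<Rightarrow> nat \<Rightarrow> (complex mat list \<Rightarrow> complex mat) \<Rightarrow> bool" where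
  "positive_on_cone d r f \<longleftrightarrow>
     (\<forall>Xs. length Xs = r \<and> (\<forall>X\<in>set Xs. psd d X) \<longrightarrow> psd d (f Xs))"

definition optimal_tp_ineq :: "nat \<Rightarrow> nat \<Rightarrow> (complex mat list \<Rightarrow> complex mat) \<Rightarrow> bool" where
  "optimal_tp_ineq d r f \<longleftrightarrow> positive_on_cone d r f \<and>
     (\<exists>Xs. length Xs = r \<and> (\<forall>X\<in>set Xs. psd d X \<and> X \<noteq> 0\<^sub>m d d) \<and> smallest_eig_zero (f Xs))"

text \<open>Basis of the tensor power indexed by multi-indices (lists of length n, entries < d);
  an operator is given by its matrix entries (only values on idx d n matter).\<close>
type_synonym op = "nat list \<Rightarrow> nat list \<Rightarrow> complex"

definition idx :: "nat \<Rightarrow> nat \<Rightarrow> nat list set" where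
  "idx d n = {I. length I = n \<and> (\<forall>i\<in>set I. i < d)}"

definition op_eq :: "nat \<Rightarrow> nat \<Rightarrow> op \<Rightarrow> op \<Rightarrow> bool" where
  "op_eq d n A B \<longleftrightarrow> (\<forall>I\<in>idx d n. \<forall>J\<in>idx d n. A I J = B I J)"

definition op_mult :: "nat \<Rightarrow> nat \<Rightarrow> op \<Rightarrow> op \<Rightarrow> op" where
  "op_mult d n A B = (\<lambda>I J. \<Sum>K\<in>idx d n. A I K * B K J)"

definition op_trace :: "nat \<Rightarrow> nat \<Rightarrow> op \<Rightarrow> complex" where
  "op_trace d n A = (\<Sum>I\<in>idx d n. A I I)"

definition tens :: "complex mat list \<Rightarrow> op" where
  "tens Ms = (\<lambda>I J. \<Prod>k<length Ms. (Ms ! k) $$ (I ! k, J ! k))"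

definition ptr :: "nat \<Rightarrow> nat \<Rightarrow> op \<Rightarrow> complex mat" where
  "ptr d r B = mat d d (\<lambda>(i, j). \<Sum>K\<in>idx d r. B (K @ [i]) (K @ [j]))"

text \<open>permutation operator T(\<pi>) (factors numbered 0..n-1):
  T(\<pi>) v_0 \<otimes> ... \<otimes> v_{n-1} = v_{\<pi>^{-1}(0)} \<otimes> ... \<otimes> v_{\<pi>^{-1}(n-1)}\<close>
definition Tperm :: "nat \<Rightarrow> (nat \<Rightarrow> nat) \<Rightarrow> op" where
  "Tperm n \<pi> = (\<lambda>I J. if (\<forall>k<n. I ! k = J ! (Hilbert_Choice.inv \<pi> k)) then 1 else 0)"

text \<open>an element of the group algebra C S_n is a coefficient function \<alpha> on permutations\<close>
definition That :: "nat \<Rightarrow> ((nat \<Rightarrow> nat) \<Rightarrow> complex) \<Rightarrow> op" where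
  "That n \<alpha> = (\<lambda>I J. \<Sum>\<pi>\<in>{\<pi>. \<pi> permutes {..<n}}. \<alpha> \<pi> * Tperm n \<pi> I J)"

definition op_hermitian :: "nat \<Rightarrow> nat \<Rightarrow> op \<Rightarrow> bool" where
  "op_hermitian d n B \<longleftrightarrow> (\<forall>I\<in>idx d n. \<forall>J\<in>idx d n. B I J = cnj (B J I))"

definition op_psd :: "nat \<Rightarrow> nat \<Rightarrow> op \<Rightarrow> bool" where
  "op_psd d n A \<longleftrightarrow>
     (\<forall>v :: nat list \<Rightarrow> complex. nonneg_c (\<Sum>I\<in>idx d n. \<Sum>J\<in>idx d n. cnj (v I) * A I J * v J))"

definition state_op :: "nat \<Rightarrow> nat \<Rightarrow> op \<Rightarrow> bool" where
  "state_op d n \<sigma> \<longleftrightarrow> op_psd d n \<sigma> \<and> op_trace d n \<sigma> = 1"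

definition state_mat :: "nat \<Rightarrow> complex mat \<Rightarrow> bool" where
  "state_mat d \<rho> \<longleftrightarrow> psd d \<rho> \<and> mtrace \<rho> = 1"

definition separable :: "nat \<Rightarrow> nat \<Rightarrow> op \<Rightarrow> bool" where
  "separable d n \<rho> \<longleftrightarrow> (\<exists>m (c :: nat \<Rightarrow> real) (\<rho>s :: nat \<Rightarrow> complex mat list).
     (\<forall>k<m. 0 \<le> c k) \<and> (\<Sum>k<m. c k) = 1 \<and>
     (\<forall>k<m. length (\<rho>s k) = n \<and> (\<forall>M\<in>set (\<rho>s k). state_mat d M)) \<and>
     op_eq d n \<rho> (\<lambda>I J. \<Sum>k<m. complex_of_real (c k) * tens (\<rho>s k) I J))"

definition block_positive :: "nat \<Rightarrow> nat \<Rightarrow> op \<Rightarrow> bool" where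
  "block_positive d n B \<longleftrightarrow>
     (\<forall>\<rho>. separable d n \<rho> \<longrightarrow> nonneg_c (op_trace d n (op_mult d n B \<rho>)))"

definition unitary_invariant :: "nat \<Rightarrow> nat \<Rightarrow> op \<Rightarrow> bool" where
  "unitary_invariant d n B \<longleftrightarrow> (\<forall>U. unitary_d d U \<longrightarrow>
     op_eq d n (op_mult d n (op_mult d n (tens (replicate n U)) B) (tens (replicate n (adj U)))) B)"

definition entanglement_witness :: "nat \<Rightarrow> nat \<Rightarrow> op \<Rightarrow> bool" where
  "entanglement_witness d n W \<longleftrightarrow> block_positive d n W \<and>
     (\<exists>\<sigma>. state_op d n \<sigma> \<and> neg_c (op_trace d n (op_mult d n W \<sigma>)))"

definition optimal_witness :: "nat \<Rightarrow> nat \<Rightarrow> op \<Rightarrow> bool" where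
  "optimal_witness d n W \<longleftrightarrow> entanglement_witness d n W \<and>
     (\<exists>\<rho>. separable d n \<rho> \<and> op_trace d n (op_mult d n W \<rho>) = 0)"

definition fB :: "nat \<Rightarrow> nat \<Rightarrow> op \<Rightarrow> complex mat list \<Rightarrow> complex mat" where
  "fB d r B Xs = ptr d r (op_mult d (Suc r) B (tens (Xs @ [1\<^sub>m d])))"

end

theory Submission
  imports Defs
begin

text \<open>The operator of a multilinear trace polynomial is a combination of permutation operators: reading off the cycles of a
  permutation of {0, ..., r}, the cycle through the base point r gives the untraced word and the other cycles the
  traced words. Block-positivity of B and positivity of the trace polynomial are the same condition, since
  tr[B (X_1 (x) ... (x) X_r (x) Y)] = tr[f(X_1, ..., X_r) Y] and the positive semidefinite cone is self-dual.

  What remains is that every unitarily invariant B is a combination of permutation operators.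
  Complex reflections show that B commutes with all sums Y (x) 1 (x) ... + 1 (x) Y (x) 1 (x) ... + ...; an induction
  on the number of nontrivial factors extends this to all symmetrized elementary tensors, and an explicit
  double commutant argument concludes.\<close>

section \<open>Multi-indices and tensor products\<close>

text \<open>Invariance only yields commutation with tensor powers of unitaries, which do not form a
  linear space, while the double commutant argument needs all matrices. Along reflections the tensor
  power is polynomial in one scalar, so counting roots replaces the differentiation of a group
  action, and the outcome is complex linear at once. Symmetrized elementary tensors are the target
  because those built from matrix units span the operators commuting with every permutation
  operator.

  For d <= r the permutation operators are linearly dependent, so \<alpha> is not unique and
  comparing coefficients is impossible. The coefficients are instead those of an orthogonal
  projection for the Hilbert-Schmidt inner product, and the residual is shown to vanish. For the
  same reason positivity is transferred through pairings with product states and never read off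
  \<alpha>.

  Hermiticity comes from block-positivity alone: over the complex numbers the products of positive
  matrices span all operators, so real pairings with them force self-adjointness.\<close>

lemma idx_nth: "I \<in> idx d n \<Longrightarrow> k < n \<Longrightarrow> I ! k < d"
  by (auto simp: idx_def)

lemma idx_length: "I \<in> idx d n \<Longrightarrow> length I = n"
  by (auto simp: idx_def)

lemma finite_idx [simp]: "finite (idx d n)"
proof -
  have "idx d n = {I. set I \<subseteq> {..<d} \<and> length I = n}"
    by (auto simp: idx_def)
  then show ?thesis
    by (simp add: finite_lists_length_eq)
qed

lemma map_idx: "(\<And>k. k < n \<Longrightarrow> f k < d) \<Longrightarrow> map f [0..<n] \<in> idx d n"
  by (auto simp: idx_def)

lemma idx_eqI:
  "I \<in> idx d n \<Longrightarrow> J \<in> idx d n \<Longrightarrow> (\<And>k. k < n \<Longrightarrow> I ! k = J ! k) \<Longrightarrow> I = J"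
  by (auto simp: idx_def intro: nth_equalityI)

lemma idx_append1: "I \<in> idx d n \<Longrightarrow> i < d \<Longrightarrow> I @ [i] \<in> idx d (Suc n)"
  by (auto simp: idx_def)

lemma sum_idx_0: "(\<Sum>I\<in>idx d 0. f I) = f []"
proof -
  have "idx d 0 = {[]}" by (auto simp: idx_def)
  then show ?thesis by simp
qed

lemma sum_idx_Suc: "(\<Sum>I\<in>idx d (Suc n). f I) = (\<Sum>K\<in>idx d n. \<Sum>i<d. f (K @ [i]))"
proof -
  have "(\<Sum>K\<in>idx d n. \<Sum>i<d. f (K @ [i])) = (\<Sum>(K, i)\<in>idx d n \<times> {..<d}. f (K @ [i]))"
    by (simp add: sum.cartesian_product)
  also have "\<dots> = (\<Sum>I\<in>idx d (Suc n). f I)"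
  proof (rule sum.reindex_bij_witness[where i = "\<lambda>I. (butlast I, last I)" and j = "\<lambda>(K, i). K @ [i]"])
    fix I assume I: "I \<in> idx d (Suc n)"
    then have "I \<noteq> []" by (auto simp: idx_def)
    then show "(case (butlast I, last I) of (K, i) \<Rightarrow> K @ [i]) = I" by simp
    show "(butlast I, last I) \<in> idx d n \<times> {..<d}"
      using I \<open>I \<noteq> []\<close> by (auto simp: idx_def dest: in_set_butlastD)
  qed (auto simp: idx_def)
  finally show ?thesis by simp
qed

text \<open>Distributivity: expanding the product of sums picks one index per factor, and these
  choices are the multi-indices. It makes products of elementary tensors computable factor by
  factor.\<close>

lemma sum_idx_prod:
  fixes g :: "nat \<Rightarrow> nat \<Rightarrow> complex"
  shows "(\<Sum>I\<in>idx d n. \<Prod>k<n. g k (I ! k)) = (\<Prod>k<n. \<Sum>x<d. g k x)"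
proof (induction n)
  case 0
  then show ?case by (subst sum_idx_0) simp
next
  case (Suc n)
  have "(\<Sum>I\<in>idx d (Suc n). \<Prod>k<Suc n. g k (I ! k))
      = (\<Sum>K\<in>idx d n. \<Sum>i<d. (\<Prod>k<n. g k (K ! k)) * g n i)"
    unfolding sum_idx_Suc
  proof (intro sum.cong refl)
    fix K i assume K: "K \<in> idx d n"
    have "(\<Prod>k<n. g k ((K @ [i]) ! k)) = (\<Prod>k<n. g k (K ! k))"
      by (rule prod.cong) (use K in \<open>auto simp: idx_length nth_append\<close>)
    then show "(\<Prod>k<Suc n. g k ((K @ [i]) ! k)) = (\<Prod>k<n. g k (K ! k)) * g n i"
      using idx_length[OF K] by (metis nth_append_length prod.lessThan_Suc)
  qed
  also have "\<dots> = (\<Prod>k<Suc n. \<Sum>x<d. g k x)"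
    by (simp add: sum_product Suc.IH flip: sum_product)
  finally show ?case .
qed

lemma prod_delta_idx:
  assumes "I \<in> idx d n" "J \<in> idx d n"
  shows "(\<Prod>k<n. if I ! k = J ! k then 1 else 0) = (if I = J then 1 else (0::complex))"
proof (cases "I = J")
  case False
  then obtain k where "k < n" "I ! k \<noteq> J ! k" using idx_eqI[OF assms] by blast
  then show ?thesis using False by (auto intro!: prod_zero)
qed simp

lemma tens_one:
  assumes "I \<in> idx d n" "J \<in> idx d n"
  shows "tens (replicate n (1\<^sub>m d)) I J = (if I = J then 1 else 0)"
proof -
  have "tens (replicate n (1\<^sub>m d)) I J = (\<Prod>k<n. if I ! k = J ! k then 1 else 0)"
    unfolding tens_def length_replicate
    by (rule prod.cong) (use assms in \<open>auto simp: idx_nth one_mat_def\<close>)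
  then show ?thesis using prod_delta_idx[OF assms] by simp
qed

lemma index_mult_sum:
  assumes "A \<in> carrier_mat d d" "B \<in> carrier_mat d d" "i < d" "j < d"
  shows "(A * B) $$ (i, j) = (\<Sum>x<d. A $$ (i, x) * B $$ (x, j))"
  using assms by (auto simp: times_mat_def scalar_prod_def lessThan_atLeast0)

lemma tens_mult:
  assumes "length As = n" "length Bs = n"
    and "\<And>k. k < n \<Longrightarrow> As ! k \<in> carrier_mat d d" "\<And>k. k < n \<Longrightarrow> Bs ! k \<in> carrier_mat d d"
    and I: "I \<in> idx d n" and J: "J \<in> idx d n"
  shows "op_mult d n (tens As) (tens Bs) I J = tens (map2 (*) As Bs) I J"
proof -
  have "op_mult d n (tens As) (tens Bs) I J
      = (\<Sum>K\<in>idx d n. \<Prod>k<n. As ! k $$ (I ! k, K ! k) * Bs ! k $$ (K ! k, J ! k))"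
    by (simp add: op_mult_def tens_def assms prod.distrib)
  also have "\<dots> = (\<Prod>k<n. \<Sum>x<d. As ! k $$ (I ! k, x) * Bs ! k $$ (x, J ! k))"
    by (rule sum_idx_prod)
  also have "\<dots> = tens (map2 (*) As Bs) I J"
    unfolding tens_def
  proof (rule prod.cong)
    fix k assume "k \<in> {..<length (map2 (*) As Bs)}"
    then have k: "k < n" using assms(1,2) by simp
    then show "(\<Sum>x<d. As ! k $$ (I ! k, x) * Bs ! k $$ (x, J ! k)) = (map2 (*) As Bs ! k) $$ (I ! k, J ! k)"
      using index_mult_sum[OF assms(3)[OF k] assms(4)[OF k] idx_nth[OF I k] idx_nth[OF J k]] assms(1,2)
      by simp
  qed (use assms(1,2) in simp)
  finally show ?thesis .
qed

section \<open>Operators up to equality on the index set\<close>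

text \<open>Values of an operator outside \<open>idx d n\<close> carry no meaning, so identities are
  usually taken up to \<open>op_eq\<close>. Associativity holds for arbitrary outer indices because
  products sum only over inner ones.\<close>

lemma op_mult_assoc:
  "op_mult d n (op_mult d n A B) C I J = op_mult d n A (op_mult d n B C) I J"
  unfolding op_mult_def
  by (simp add: sum_distrib_left sum_distrib_right mult.assoc) (rule sum.swap)

lemma op_mult_cong:
  assumes "op_eq d n A A'" "op_eq d n B B'"
  shows "op_eq d n (op_mult d n A B) (op_mult d n A' B')"
  using assms by (auto simp: op_eq_def op_mult_def intro!: sum.cong)

lemma op_eq_refl [simp]: "op_eq d n A A"
  by (simp add: op_eq_def)

lemma op_eq_sym: "op_eq d n A B \<Longrightarrow> op_eq d n B A"
  by (simp add: op_eq_def)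

lemma op_eq_trans [trans]: "op_eq d n A B \<Longrightarrow> op_eq d n B C \<Longrightarrow> op_eq d n A C"
  by (simp add: op_eq_def)

lemma op_mult_assoc_eq:
  "op_eq d n (op_mult d n (op_mult d n A B) C) (op_mult d n A (op_mult d n B C))"
  by (simp add: op_eq_def op_mult_assoc)

section \<open>The partial trace in coordinates\<close>

lemma fB_entry:
  assumes X: "valid_args d r Xs" and "i < d" "j < d"
  shows "fB d r B Xs $$ (i, j)
    = (\<Sum>K\<in>idx d r. \<Sum>L\<in>idx d r. B (K @ [i]) (L @ [j]) * tens Xs L K)"
proof -
  have len: "length Xs = r" using X by (simp add: valid_args_def)
  \<comment> \<open>The identity in the last slot is a Kronecker delta, so the column index j of the
    partial trace ends up in the second argument of \<open>B\<close>.\<close>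
  have t: "tens (Xs @ [1\<^sub>m d]) (L @ [m]) (K @ [j]) = tens Xs L K * (if m = j then 1 else 0)"
    if "K \<in> idx d r" "L \<in> idx d r" "m < d" for K L m
  proof -
    have "(\<Prod>k<r. ((Xs @ [1\<^sub>m d]) ! k) $$ ((L @ [m]) ! k, (K @ [j]) ! k))
        = (\<Prod>k<r. (Xs ! k) $$ (L ! k, K ! k))"
      by (rule prod.cong) (use that len in \<open>auto simp: nth_append idx_length\<close>)
    then show ?thesis
      using that len \<open>j < d\<close> by (auto simp: tens_def idx_length nth_append)
  qed
  have "fB d r B Xs $$ (i, j)
      = (\<Sum>K\<in>idx d r. \<Sum>L\<in>idx d r. \<Sum>m<d. B (K @ [i]) (L @ [m]) * tens (Xs @ [1\<^sub>m d]) (L @ [m]) (K @ [j]))"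
    using assms by (simp add: fB_def ptr_def op_mult_def sum_idx_Suc)
  also have "\<dots> = (\<Sum>K\<in>idx d r. \<Sum>L\<in>idx d r. B (K @ [i]) (L @ [j]) * tens Xs L K)"
  proof (intro sum.cong refl)
    fix K L assume KL: "K \<in> idx d r" "L \<in> idx d r"
    have "(\<Sum>m<d. B (K @ [i]) (L @ [m]) * tens (Xs @ [1\<^sub>m d]) (L @ [m]) (K @ [j]))
        = (\<Sum>m<d. if m = j then B (K @ [i]) (L @ [m]) * tens Xs L K else 0)"
      by (rule sum.cong) (use KL in \<open>auto simp: t\<close>)
    then show "(\<Sum>m<d. B (K @ [i]) (L @ [m]) * tens (Xs @ [1\<^sub>m d]) (L @ [m]) (K @ [j]))
        = B (K @ [i]) (L @ [j]) * tens Xs L K"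
      using \<open>j < d\<close> by simp
  qed
  finally show ?thesis .
qed

lemma fB_carrier [simp]: "fB d r B Xs \<in> carrier_mat d d"
  by (simp add: fB_def ptr_def)

lemma fB_cong:
  assumes "valid_args d r Xs" "op_eq d (Suc r) A B"
  shows "fB d r A Xs = fB d r B Xs"
proof (rule eq_matI)
  fix i j assume "i < dim_row (fB d r B Xs)" "j < dim_col (fB d r B Xs)"
  then have "i < d" "j < d" using fB_carrier[of d r B Xs] by (auto simp del: fB_carrier)
  then show "fB d r A Xs $$ (i, j) = fB d r B Xs $$ (i, j)"
    using assms by (auto simp: fB_entry op_eq_def idx_append1 intro!: sum.cong)
qed (use fB_carrier[of d r B Xs] fB_carrier[of d r A Xs] in \<open>auto simp del: fB_carrier\<close>)

lemma op_trace_tens_snoc: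
  assumes X: "valid_args d r Xs"
  shows "op_trace d (Suc r) (op_mult d (Suc r) B (tens (Xs @ [Y])))
    = (\<Sum>i<d. \<Sum>j<d. fB d r B Xs $$ (i, j) * Y $$ (j, i))"
proof -
  have len: "length Xs = r" using X by (simp add: valid_args_def)
  have t: "tens (Xs @ [Y]) (L @ [j]) (K @ [i]) = tens Xs L K * Y $$ (j, i)"
    if "K \<in> idx d r" "L \<in> idx d r" for K L i j
  proof -
    have "(\<Prod>k<r. ((Xs @ [Y]) ! k) $$ ((L @ [j]) ! k, (K @ [i]) ! k))
        = (\<Prod>k<r. (Xs ! k) $$ (L ! k, K ! k))"
      by (rule prod.cong) (use that len in \<open>auto simp: nth_append idx_length\<close>)
    then show ?thesis
      using that len by (auto simp: tens_def idx_length nth_append)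
  qed
  have "op_trace d (Suc r) (op_mult d (Suc r) B (tens (Xs @ [Y])))
      = (\<Sum>K\<in>idx d r. \<Sum>i<d. \<Sum>L\<in>idx d r. \<Sum>j<d. B (K @ [i]) (L @ [j]) * (tens Xs L K * Y $$ (j, i)))"
    by (simp add: op_trace_def op_mult_def sum_idx_Suc t)
  also have "\<dots> = (\<Sum>i<d. \<Sum>K\<in>idx d r. \<Sum>j<d. \<Sum>L\<in>idx d r. B (K @ [i]) (L @ [j]) * (tens Xs L K * Y $$ (j, i)))"
    by (subst sum.swap) (intro sum.cong refl sum.swap)
  also have "\<dots> = (\<Sum>i<d. \<Sum>j<d. \<Sum>K\<in>idx d r. \<Sum>L\<in>idx d r. B (K @ [i]) (L @ [j]) * (tens Xs L K * Y $$ (j, i)))"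
    by (intro sum.cong refl sum.swap)
  also have "\<dots> = (\<Sum>i<d. \<Sum>j<d. fB d r B Xs $$ (i, j) * Y $$ (j, i))"
    by (intro sum.cong refl) (simp add: fB_entry[OF X] sum_distrib_right mult.assoc)
  finally show ?thesis .
qed

section \<open>Positive semidefinite matrices\<close>

text \<open>The index set is arbitrary, not an initial segment, so that the Cholesky induction can
  remove one index at a time.\<close>

definition qform :: "nat set \<Rightarrow> (nat \<Rightarrow> nat \<Rightarrow> complex) \<Rightarrow> (nat \<Rightarrow> complex) \<Rightarrow> complex" where
  "qform S A v = (\<Sum>i\<in>S. \<Sum>j\<in>S. cnj (v i) * A i j * v j)"

lemma psd_qform:
  "psd d A \<longleftrightarrow> A \<in> carrier_mat d d \<and> (\<forall>v. nonneg_c (qform {..<d} (\<lambda>i j. A $$ (i, j)) v))"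
  by (simp add: psd_def qform_def)

lemma nonneg_c_iff: "nonneg_c z \<longleftrightarrow> (\<exists>x\<ge>0. z = complex_of_real x)"
  by (auto simp: nonneg_c_def complex_eq_iff intro!: exI[of _ "Re z"])

lemma nonneg_c_0 [simp]: "nonneg_c 0"
  by (simp add: nonneg_c_def)

lemma nonneg_c_sum: "(\<And>x. x \<in> S \<Longrightarrow> nonneg_c (f x)) \<Longrightarrow> nonneg_c (sum f S)"
  by (simp add: nonneg_c_def sum_nonneg)

lemma nonneg_c_scale: "0 \<le> t \<Longrightarrow> nonneg_c z \<Longrightarrow> nonneg_c (complex_of_real t * z)"
  by (simp add: nonneg_c_def)

lemma nonneg_c_cnj_mult [simp]: "nonneg_c (cnj z * z)" "nonneg_c (z * cnj z)"
  by (simp_all add: nonneg_c_def)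

lemma sum_nonneg_c_eq_0:
  assumes "finite S" "\<And>x. x \<in> S \<Longrightarrow> nonneg_c (f x)" "sum f S = 0" "x \<in> S"
  shows "f x = 0"
proof -
  have "(\<Sum>x\<in>S. Re (f x)) = 0" using assms(3) by (metis Re_sum zero_complex.sel(1))
  then have "Re (f x) = 0"
    using assms by (subst (asm) sum_nonneg_eq_0_iff) (auto simp: nonneg_c_def)
  then show ?thesis using assms(2)[OF assms(4)] by (simp add: nonneg_c_def complex_eq_iff)
qed

lemma qform_insert:
  assumes "finite S" "s \<notin> S"
  shows "qform (insert s S) A v = cnj (v s) * A s s * v s + cnj (v s) * (\<Sum>j\<in>S. A s j * v j)
     + (\<Sum>i\<in>S. cnj (v i) * A i s) * v s + qform S A v"
  using assms
  by (simp add: qform_def sum.distrib sum_distrib_left sum_distrib_right mult.assoc algebra_simps)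

lemma qform_cong:
  "(\<And>i. i \<in> S \<Longrightarrow> v i = w i) \<Longrightarrow> qform S A v = qform S A w"
  by (simp add: qform_def)

lemma qform_mono_zero:
  assumes "finite S" "T \<subseteq> S" "\<And>i. i \<in> S - T \<Longrightarrow> v i = 0"
  shows "qform S A v = qform T A v"
proof -
  have "(\<Sum>j\<in>S. cnj (v i) * A i j * v j) = (\<Sum>j\<in>T. cnj (v i) * A i j * v j)" for i
    using assms by (intro sum.mono_neutral_right) auto
  then have "qform S A v = (\<Sum>i\<in>S. \<Sum>j\<in>T. cnj (v i) * A i j * v j)"
    by (simp add: qform_def)
  also have "\<dots> = qform T A v"
    unfolding qform_def using assms by (intro sum.mono_neutral_right) auto
  finally show ?thesis .
qed

lemma qform_single:
  assumes "finite S" "i \<in> S"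
  shows "qform S A (\<lambda>k. if k = i then 1 else 0) = A i i"
proof -
  have "qform S A (\<lambda>k. if k = i then 1 else 0) = qform {i} A (\<lambda>k. if k = i then 1 else 0)"
    using assms by (intro qform_mono_zero) auto
  then show ?thesis by (simp add: qform_def)
qed

lemma qform_pair:
  assumes "finite S" "i \<in> S" "j \<in> S" "i \<noteq> j"
  shows "qform S A (\<lambda>k. if k = i then a else if k = j then b else 0)
    = cnj a * A i i * a + cnj a * A i j * b + cnj b * A j i * a + cnj b * A j j * b"
proof -
  have "qform S A (\<lambda>k. if k = i then a else if k = j then b else 0)
      = qform {i, j} A (\<lambda>k. if k = i then a else if k = j then b else 0)"
    using assms by (intro qform_mono_zero) auto
  then show ?thesis using \<open>i \<noteq> j\<close> by (simp add: qform_def)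
qed

text \<open>Reality of the form at e_i + e_j makes the imaginary parts of the two entries opposite,
  and reality at e_i + \<i> e_j makes the real parts equal.\<close>

lemma qform_hermitian:
  assumes "finite S" and pos: "\<And>v. nonneg_c (qform S A v)" and ij: "i \<in> S" "j \<in> S"
  shows "A i j = cnj (A j i)"
proof (cases "i = j")
  case True
  then show ?thesis
    using pos[of "\<lambda>k. if k = i then 1 else 0"] qform_single[OF assms(1) ij(1)]
    by (simp add: nonneg_c_def complex_eq_iff)
next
  case False
  have d: "Im (A i i) = 0" "Im (A j j) = 0"
    using pos[of "\<lambda>k. if k = i then 1 else 0"] qform_single[OF assms(1) ij(1)]
      pos[of "\<lambda>k. if k = j then 1 else 0"] qform_single[OF assms(1) ij(2)]
    by (simp_all add: nonneg_c_def)
  have "nonneg_c (A i i + A i j + A j i + A j j)"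
    using pos[of "\<lambda>k. if k = i then 1 else if k = j then 1 else 0"]
    by (simp add: qform_pair[OF assms(1) ij False])
  moreover have "nonneg_c (A i i + A i j * \<i> - \<i> * A j i - \<i> * A j j * \<i>)"
    using pos[of "\<lambda>k. if k = i then 1 else if k = j then \<i> else 0"]
    by (simp add: qform_pair[OF assms(1) ij False])
  ultimately show ?thesis using d by (simp add: nonneg_c_def complex_eq_iff)
qed

text \<open>With a zero pivot the form is affine along a suitable line of test vectors; a nonzero
  entry would give it a nonzero slope and drive it negative.\<close>

lemma qform_diag_zero:
  assumes "finite S" and pos: "\<And>v. nonneg_c (qform S A v)" and ij: "i \<in> S" "j \<in> S"
    and "A i i = 0"
  shows "A i j = 0"
proof (cases "i = j")
  case False
  show ?thesis
  proof (rule ccontr)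
    assume nz: "A i j \<noteq> 0"
    have h: "A j i = cnj (A i j)" using qform_hermitian[OF assms(1) pos ij(2,1)] .
    define N where "N = (cmod (A i j))\<^sup>2"
    have N: "N > 0" using nz by (simp add: N_def)
    \<comment> \<open>This t makes the real part of the form equal to -1 at the test vector.\<close>
    define t where "t = (Re (A j j) + 1) / (2 * N)"
    have "A i j * cnj (A i j) = complex_of_real N"
      by (simp add: N_def complex_norm_square flip: of_real_power)
    then have "qform S A (\<lambda>k. if k = i then - complex_of_real t * A i j else if k = j then 1 else 0)
        = A j j - of_real (2 * t * N)"
      by (simp add: qform_pair[OF assms(1) ij False] \<open>A i i = 0\<close> h algebra_simps)
    then have "0 \<le> Re (A j j) - 2 * t * N"
      using pos[of "\<lambda>k. if k = i then - complex_of_real t * A i j else if k = j then 1 else 0"]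
      by (simp add: nonneg_c_def)
    then show False using N by (simp add: t_def)
  qed
qed (use assms in simp)

text \<open>Cholesky: at a positive diagonal entry split off the rank-one matrix of its column;
  what is left, the Schur complement, is positive semidefinite on the remaining indices.\<close>

lemma psd_gram:
  assumes "finite S" "\<And>v. nonneg_c (qform S A v)"
  shows "\<exists>(m::nat) u. \<forall>i\<in>S. \<forall>j\<in>S. A i j = (\<Sum>k<m. u k i * cnj (u k j))"
  using assms
proof (induction S arbitrary: A rule: finite_induct)
  case empty
  then show ?case by simp
next
  case (insert s S)
  have fin: "finite (insert s S)" using insert by simp
  note herm = qform_hermitian[OF fin insert.prems]
  have sub: "qform (insert s S) A (\<lambda>i. if i \<in> S then v i else 0) = qform S A v" for v
  proof -
    have "qform (insert s S) A (\<lambda>i. if i \<in> S then v i else 0) = qform S A (\<lambda>i. if i \<in> S then v i else 0)"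
      using insert by (intro qform_mono_zero) auto
    also have "\<dots> = qform S A v" by (rule qform_cong) simp
    finally show ?thesis .
  qed
  show ?case
  proof (cases "A s s = 0")
    case True
    \<comment> \<open>A vanishing pivot kills its row and column, so Gram vectors for the remaining
      indices extend by 0 at s.\<close>
    have z: "A s j = 0" "A j s = 0" if "j \<in> insert s S" for j
      using qform_diag_zero[OF fin insert.prems _ that, of s] True herm[OF that, of s] by auto
    have "nonneg_c (qform S A v)" for v
      using insert.prems[of "\<lambda>i. if i \<in> S then v i else 0"] by (simp only: sub)
    then have "\<exists>(m::nat) u. \<forall>i\<in>S. \<forall>j\<in>S. A i j = (\<Sum>k<m. u k i * cnj (u k j))"
      by (rule insert.IH)
    then obtain u and m :: nat where u: "\<forall>i\<in>S. \<forall>j\<in>S. A i j = (\<Sum>k<m. u k i * cnj (u k j))"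
      by (elim exE)
    show ?thesis
      by (rule exI[of _ m], rule exI[of _ "\<lambda>k i. if i \<in> S then u k i else 0"])
        (use z u insert.hyps in auto)
  next
    case False
    obtain a where a: "A s s = complex_of_real a" "a > 0"
      using insert.prems[of "\<lambda>k. if k = s then 1 else 0"] qform_single[OF fin, of s] False
      by (auto simp: nonneg_c_iff less_eq_real_def)
    define A' where "A' i j = A i j - A i s * A s j / A s s" for i j
    have "nonneg_c (qform S A' v)" for v
    proof -
      define w where "w = (\<Sum>j\<in>S. A s j * v j)"
      have w': "(\<Sum>i\<in>S. cnj (v i) * A i s) = cnj w"
        unfolding w_def cnj_sum
      proof (rule sum.cong)
        fix i assume "i \<in> S"
        then have "A i s = cnj (A s i)" using herm by blast
        then show "cnj (v i) * A i s = cnj (A s i * v i)" by simp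
      qed simp
      \<comment> \<open>The value at s completes the square: it minimizes the form in that
        coordinate, and the minimum is the form of the Schur complement \<open>A'\<close>.\<close>
      define v' where "v' i = (if i = s then - w / A s s else v i)" for i
      have e: "(\<Sum>j\<in>S. A s j * v' j) = w" "(\<Sum>i\<in>S. cnj (v' i) * A i s) = cnj w"
        "qform S A v' = qform S A v"
        unfolding w'[symmetric] unfolding w_def
        by (intro sum.cong refl qform_cong; use insert.hyps in \<open>force simp: v'_def\<close>)+
      have "qform (insert s S) A v' = qform S A v - cnj w * w / A s s"
        unfolding qform_insert[OF insert.hyps] e using a
        by (simp add: v'_def field_simps)
      also have "cnj w * w = (\<Sum>i\<in>S. \<Sum>j\<in>S. cnj (v i) * A i s * (A s j * v j))"
        by (subst w'[symmetric], subst w_def, rule sum_product)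
      also have "qform S A v - \<dots> / A s s = qform S A' v"
        by (simp add: qform_def A'_def sum_divide_distrib sum_subtractf algebra_simps)
      finally show ?thesis using insert.prems[of v'] by simp
    qed
    then have "\<exists>(m::nat) u. \<forall>i\<in>S. \<forall>j\<in>S. A' i j = (\<Sum>k<m. u k i * cnj (u k j))"
      by (rule insert.IH)
    then obtain u and m :: nat where u: "\<forall>i\<in>S. \<forall>j\<in>S. A' i j = (\<Sum>k<m. u k i * cnj (u k j))"
      by (elim exE)
    \<comment> \<open>Earlier vectors vanish at s; vector number m is column s divided by the square
      root of the pivot and restores the rank-one matrix that was split off.\<close>
    define u' where "u' k i = (if k < m then (if i \<in> S then u k i else 0) else A i s / sqrt a)" for k i
    have last: "A i s / sqrt a * cnj (A j s / sqrt a) = A i s * A s j / A s s"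
      if "j \<in> insert s S" for i j
    proof -
      have "complex_of_real (sqrt a) * complex_of_real (sqrt a) = A s s"
        using a by (simp flip: of_real_mult)
      moreover have "cnj (A j s) = A s j" using herm[of s j] that by simp
      ultimately show ?thesis by simp
    qed
    have "A i j = (\<Sum>k<Suc m. u' k i * cnj (u' k j))" if "i \<in> insert s S" "j \<in> insert s S" for i j
    proof -
      have "(\<Sum>k<m. u' k i * cnj (u' k j)) = A' i j"
      proof (cases "i \<in> S \<and> j \<in> S")
        case True
        then show ?thesis by (simp add: u'_def u)
      next
        case ns: False
        then have "i = s \<or> j = s" using that by blast
        then have "A' i j = 0" using False by (auto simp: A'_def)
        moreover have "(\<Sum>k<m. u' k i * cnj (u' k j)) = 0"
          using ns by (intro sum.neutral) (auto simp: u'_def)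
        ultimately show ?thesis by simp
      qed
      then show ?thesis using last[OF that(2), of i] by (simp add: u'_def A'_def)
    qed
    then show ?thesis by blast
  qed
qed

lemma psd_rank_one_sum:
  assumes "psd d A"
  shows "\<exists>(m::nat) u. \<forall>i<d. \<forall>j<d. A $$ (i, j) = (\<Sum>k<m. u k i * cnj (u k j))"
  using psd_gram[of "{..<d}" "\<lambda>i j. A $$ (i, j)"] assms by (simp add: psd_qform Ball_def)

text \<open>A Gram decomposition of B turns the trace of A B into values of the form of A, so that
  positivity and vanishing of the trace can be examined vector by vector.\<close>

lemma sum_mult_rank_one:
  assumes "\<And>i j. i < d \<Longrightarrow> j < d \<Longrightarrow> B $$ (i, j) = (\<Sum>k<m. u k i * cnj (u k j))"
  shows "(\<Sum>i<d. \<Sum>j<d. A $$ (i, j) * B $$ (j, i))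
    = (\<Sum>k<(m::nat). qform {..<d} (\<lambda>i j. A $$ (i, j)) (u k))"
proof -
  have "(\<Sum>i<d. \<Sum>j<d. A $$ (i, j) * B $$ (j, i))
      = (\<Sum>i<d. \<Sum>j<d. \<Sum>k<m. cnj (u k i) * A $$ (i, j) * u k j)"
    by (intro sum.cong refl) (simp add: assms sum_distrib_left mult_ac)
  also have "\<dots> = (\<Sum>i<d. \<Sum>k<m. \<Sum>j<d. cnj (u k i) * A $$ (i, j) * u k j)"
    by (intro sum.cong refl sum.swap)
  also have "\<dots> = (\<Sum>k<m. \<Sum>i<d. \<Sum>j<d. cnj (u k i) * A $$ (i, j) * u k j)"
    by (rule sum.swap)
  finally show ?thesis by (simp add: qform_def)
qed

lemma psd_trace_mult_nonneg:
  assumes "psd d A" "psd d B"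
  shows "nonneg_c (\<Sum>i<d. \<Sum>j<d. A $$ (i, j) * B $$ (j, i))"
proof -
  obtain u and m :: nat where "\<forall>i<d. \<forall>j<d. B $$ (i, j) = (\<Sum>k<m. u k i * cnj (u k j))"
    using psd_rank_one_sum[OF assms(2)] by (elim exE)
  then have u: "\<And>i j. i < d \<Longrightarrow> j < d \<Longrightarrow> B $$ (i, j) = (\<Sum>k<m. u k i * cnj (u k j))"
    by blast
  have "(\<Sum>i<d. \<Sum>j<d. A $$ (i, j) * B $$ (j, i)) = (\<Sum>k<m. qform {..<d} (\<lambda>i j. A $$ (i, j)) (u k))"
    by (rule sum_mult_rank_one) (rule u)
  then show ?thesis
    using assms(1) by (auto simp: psd_qform intro: nonneg_c_sum)
qed

text \<open>For A = U U^H the form at v is the squared norm of U^H v, called \<open>w\<close> in the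
  proof; if it vanishes, so does A v.\<close>

lemma psd_qform_zero:
  assumes "psd d A" "qform {..<d} (\<lambda>i j. A $$ (i, j)) v = 0" "i < d"
  shows "(\<Sum>j<d. A $$ (i, j) * v j) = 0"
proof -
  obtain u and m :: nat where "\<forall>i<d. \<forall>j<d. A $$ (i, j) = (\<Sum>k<m. u k i * cnj (u k j))"
    using psd_rank_one_sum[OF assms(1)] by (elim exE)
  then have u: "\<And>i j. i < d \<Longrightarrow> j < d \<Longrightarrow> A $$ (i, j) = (\<Sum>k<m. u k i * cnj (u k j))"
    by blast
  define w where "w k = (\<Sum>j<d. cnj (u k j) * v j)" for k
  have Av: "(\<Sum>j<d. A $$ (i, j) * v j) = (\<Sum>k<m. u k i * w k)" if "i < d" for i
    unfolding w_def sum_distrib_left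
    by (subst sum.swap) (simp add: u that sum_distrib_right mult.assoc)
  have "qform {..<d} (\<lambda>i j. A $$ (i, j)) v = (\<Sum>i<d. cnj (v i) * (\<Sum>j<d. A $$ (i, j) * v j))"
    by (simp add: qform_def sum_distrib_left mult.assoc)
  also have "\<dots> = (\<Sum>i<d. \<Sum>k<m. cnj (v i) * u k i * w k)"
    by (rule sum.cong) (simp_all add: Av sum_distrib_left mult.assoc)
  also have "\<dots> = (\<Sum>k<m. (\<Sum>i<d. cnj (v i) * u k i) * w k)"
    by (subst sum.swap) (simp add: sum_distrib_right)
  also have "\<dots> = (\<Sum>k<m. cnj (w k) * w k)"
    by (simp add: w_def mult.commute)
  finally have *: "(\<Sum>k<m. cnj (w k) * w k) = 0" using assms(2) by simp
  have "w k = 0" if "k < m" for k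
  proof -
    have "cnj (w k) * w k = 0"
      by (rule sum_nonneg_c_eq_0[OF finite_lessThan _ *]) (use that in simp_all)
    then show ?thesis by (metis complex_cnj_zero_iff mult_eq_0_iff)
  qed
  then show ?thesis using assms(3) by (simp add: Av)
qed

lemma rank_one_psd:
  "psd d (mat d d (\<lambda>(i, j). v i * cnj (v j)))"
proof -
  have "nonneg_c (qform {..<d} (\<lambda>i j. mat d d (\<lambda>(i, j). v i * cnj (v j)) $$ (i, j)) w)" for w
  proof -
    have "qform {..<d} (\<lambda>i j. mat d d (\<lambda>(i, j). v i * cnj (v j)) $$ (i, j)) w
        = (\<Sum>i<d. cnj (w i) * v i) * (\<Sum>j<d. cnj (v j) * w j)"
      by (simp add: qform_def sum_product mult.assoc)
    also have "\<dots> = (\<Sum>i<d. cnj (w i) * v i) * cnj (\<Sum>i<d. cnj (w i) * v i)"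
      by (simp add: mult.commute)
    finally show ?thesis by (simp only: nonneg_c_cnj_mult)
  qed
  then show ?thesis by (simp add: psd_qform)
qed

lemma mtrace_carrier: "A \<in> carrier_mat d d \<Longrightarrow> mtrace A = (\<Sum>i<d. A $$ (i, i))"
  by (auto simp: mtrace_def)

lemma psd_trace_nonneg:
  assumes "psd d X"
  shows "nonneg_c (mtrace X)"
proof -
  have "X \<in> carrier_mat d d" using assms by (simp add: psd_def)
  moreover have "nonneg_c (X $$ (i, i))" if "i < d" for i
    using assms qform_single[of "{..<d}" i] that unfolding psd_qform
    by (metis (full_types) finite_lessThan lessThan_iff)
  ultimately show ?thesis by (auto simp: mtrace_carrier intro: nonneg_c_sum)
qed

text \<open>Nonnegative diagonal entries with sum 0 all vanish, and a zero diagonal entry kills its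
  row.\<close>

lemma psd_trace_zero:
  assumes "psd d X" "mtrace X = 0"
  shows "X = 0\<^sub>m d d"
proof -
  have X: "X \<in> carrier_mat d d" using assms by (simp add: psd_def)
  have pos: "\<And>v. nonneg_c (qform {..<d} (\<lambda>i j. X $$ (i, j)) v)" using assms by (simp add: psd_qform)
  have "nonneg_c (X $$ (i, i))" if "i < d" for i
    using pos qform_single[of "{..<d}" i] that by (metis (full_types) finite_lessThan lessThan_iff)
  then have "X $$ (i, i) = 0" if "i < d" for i
    using sum_nonneg_c_eq_0[of "{..<d}" "\<lambda>i. X $$ (i, i)"] assms(2) that
    by (simp add: mtrace_carrier[OF X])
  then have "X $$ (i, j) = 0" if "i < d" "j < d" for i j
    using qform_diag_zero[OF _ pos, of i j] that by simp
  then show ?thesis using X by (intro eq_matI) auto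
qed

section \<open>Normalizing positive semidefinite matrices to states\<close>

lemma psd_smult:
  assumes "psd d X" "0 \<le> t"
  shows "psd d (complex_of_real t \<cdot>\<^sub>m X)"
proof -
  have X: "X \<in> carrier_mat d d" using assms by (simp add: psd_def)
  have "qform {..<d} (\<lambda>i j. (complex_of_real t \<cdot>\<^sub>m X) $$ (i, j)) v
      = complex_of_real t * qform {..<d} (\<lambda>i j. X $$ (i, j)) v" for v
    using X by (simp add: qform_def sum_distrib_left mult_ac)
  then show ?thesis using assms by (simp add: psd_qform nonneg_c_scale)
qed

lemma mtrace_smult: "mtrace (c \<cdot>\<^sub>m A) = c * mtrace A" if "A \<in> carrier_mat d d"
  using that by (auto simp: mtrace_def sum_distrib_left)

text \<open>The zero matrix cannot be normalized; it is written as 0 times an arbitrary state, and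
  for d = 0 there would be none.\<close>

lemma state_mat_exists:
  assumes "1 \<le> d"
  obtains \<rho> where "state_mat d \<rho>"
proof -
  define \<rho> where "\<rho> = mat d d (\<lambda>(i, j). (if i = 0 then 1 else 0) * cnj (if j = 0 then 1 else 0))"
  have "psd d \<rho>" unfolding \<rho>_def by (rule rank_one_psd)
  moreover have "mtrace \<rho> = 1"
  proof -
    have "mtrace \<rho> = (\<Sum>i<d. if i = 0 then 1 else 0)"
      by (simp add: \<rho>_def mtrace_def if_distrib cong: if_cong)
    then show ?thesis using assms by simp
  qed
  ultimately show ?thesis using that by (simp add: state_mat_def)
qed

lemma psd_scaled_state:
  assumes "1 \<le> d" "psd d X"
  obtains t \<rho> where "0 \<le> t" "state_mat d \<rho>" "X = complex_of_real t \<cdot>\<^sub>m \<rho>" "X \<noteq> 0\<^sub>m d d \<Longrightarrow> 0 < t"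
proof -
  have X: "X \<in> carrier_mat d d" using assms by (simp add: psd_def)
  obtain t where t: "0 \<le> t" "mtrace X = complex_of_real t"
    using psd_trace_nonneg[OF assms(2)] by (auto simp: nonneg_c_iff)
  show ?thesis
  proof (cases "t = 0")
    case True
    then have "X = 0\<^sub>m d d" using psd_trace_zero assms t by simp
    moreover obtain \<rho> where \<rho>: "state_mat d \<rho>" using state_mat_exists assms(1) by blast
    then have "complex_of_real 0 \<cdot>\<^sub>m \<rho> = 0\<^sub>m d d"
      by (intro eq_matI) (auto simp: state_mat_def psd_def)
    ultimately show ?thesis using that[of 0 \<rho>] \<rho> by simp
  next
    case False
    define \<rho> where "\<rho> = complex_of_real (1 / t) \<cdot>\<^sub>m X"
    have "psd d \<rho>" unfolding \<rho>_def using assms t by (intro psd_smult) simp_all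
    moreover have "mtrace \<rho> = 1"
      using mtrace_smult[OF X, of "complex_of_real (1 / t)"] t(2) False by (simp add: \<rho>_def)
    moreover have "complex_of_real t \<cdot>\<^sub>m \<rho> = X"
      unfolding \<rho>_def using False by (intro eq_matI) auto
    ultimately show ?thesis using that[of t \<rho>] t False by (simp add: state_mat_def)
  qed
qed

section \<open>Block-positivity\<close>

abbreviation pairing :: "nat \<Rightarrow> nat \<Rightarrow> op \<Rightarrow> complex mat list \<Rightarrow> complex" where
  "pairing d n B Xs \<equiv> op_trace d n (op_mult d n B (tens Xs))"

lemma op_trace_mult_cong:
  "op_eq d n A A' \<Longrightarrow> op_eq d n B B' \<Longrightarrow> op_trace d n (op_mult d n A B) = op_trace d n (op_mult d n A' B')"
  by (auto simp: op_trace_def op_mult_def op_eq_def intro!: sum.cong)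

lemma op_trace_mult_sum:
  "op_trace d n (op_mult d n B (\<lambda>I J. \<Sum>k<(m::nat). c k * T k I J))
    = (\<Sum>k<m. c k * op_trace d n (op_mult d n B (T k)))"
proof -
  have "op_trace d n (op_mult d n B (\<lambda>I J. \<Sum>k<m. c k * T k I J))
      = (\<Sum>I\<in>idx d n. \<Sum>K\<in>idx d n. \<Sum>k<m. c k * (B I K * T k K I))"
    by (simp add: op_trace_def op_mult_def sum_distrib_left mult_ac)
  also have "\<dots> = (\<Sum>I\<in>idx d n. \<Sum>k<m. \<Sum>K\<in>idx d n. c k * (B I K * T k K I))"
    by (intro sum.cong refl sum.swap)
  also have "\<dots> = (\<Sum>k<m. \<Sum>I\<in>idx d n. \<Sum>K\<in>idx d n. c k * (B I K * T k K I))"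
    by (rule sum.swap)
  finally show ?thesis by (simp add: op_trace_def op_mult_def sum_distrib_left)
qed

lemma separable_tens:
  assumes "length \<rho>s = n" "\<forall>M\<in>set \<rho>s. state_mat d M"
  shows "separable d n (tens \<rho>s)"
  unfolding separable_def
  by (rule exI[of _ 1], rule exI[of _ "\<lambda>_. 1"], rule exI[of _ "\<lambda>_. \<rho>s"]) (use assms in simp)

text \<open>The pairing is linear in its second operator, so a convex combination of product states
  inherits nonnegativity from its terms.\<close>

lemma block_positive_iff_states:
  "block_positive d n B \<longleftrightarrow>
    (\<forall>\<rho>s. length \<rho>s = n \<and> (\<forall>M\<in>set \<rho>s. state_mat d M) \<longrightarrow> nonneg_c (pairing d n B \<rho>s))"
proof (intro iffI allI impI)
  fix \<rho>s assume "block_positive d n B" "length \<rho>s = n \<and> (\<forall>M\<in>set \<rho>s. state_mat d M)"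
  then show "nonneg_c (pairing d n B \<rho>s)"
    using separable_tens by (auto simp: block_positive_def)
next
  assume pos: "\<forall>\<rho>s. length \<rho>s = n \<and> (\<forall>M\<in>set \<rho>s. state_mat d M) \<longrightarrow> nonneg_c (pairing d n B \<rho>s)"
  show "block_positive d n B"
    unfolding block_positive_def
  proof (intro allI impI)
    fix \<rho> assume "separable d n \<rho>"
    then obtain m c \<rho>s where c: "\<forall>k<m. 0 \<le> c k"
      and s: "\<forall>k<m. length (\<rho>s k) = n \<and> (\<forall>M\<in>set (\<rho>s k). state_mat d M)"
      and eq: "op_eq d n \<rho> (\<lambda>I J. \<Sum>k<(m::nat). complex_of_real (c k) * tens (\<rho>s k) I J)"
      unfolding separable_def by blast
    have "op_trace d n (op_mult d n B \<rho>) = (\<Sum>k<m. complex_of_real (c k) * pairing d n B (\<rho>s k))"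
      unfolding op_trace_mult_cong[OF op_eq_refl eq] by (rule op_trace_mult_sum)
    then show "nonneg_c (op_trace d n (op_mult d n B \<rho>))"
      using c s pos by (auto intro!: nonneg_c_sum nonneg_c_scale)
  qed
qed

lemma pairing_smult:
  assumes "length Xs = n" "length \<rho>s = n" "\<And>k. k < n \<Longrightarrow> \<rho>s ! k \<in> carrier_mat d d"
    and "\<And>k. k < n \<Longrightarrow> Xs ! k = c k \<cdot>\<^sub>m (\<rho>s ! k)"
  shows "pairing d n B Xs = (\<Prod>k<n. c k) * pairing d n B \<rho>s"
proof -
  have "tens Xs I J = (\<Prod>k<n. c k) * tens \<rho>s I J" if "I \<in> idx d n" "J \<in> idx d n" for I J
  proof -
    have "tens Xs I J = (\<Prod>k<n. c k * \<rho>s ! k $$ (I ! k, J ! k))"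
      unfolding tens_def assms(1)
    proof (rule prod.cong)
      fix k assume "k \<in> {..<n}"
      then have k: "k < n" by simp
      then show "Xs ! k $$ (I ! k, J ! k) = c k * \<rho>s ! k $$ (I ! k, J ! k)"
        using assms(3)[OF k] assms(4)[OF k] idx_nth[OF that(1) k] idx_nth[OF that(2) k] by simp
    qed simp
    then show ?thesis by (simp add: tens_def assms prod.distrib)
  qed
  then show ?thesis
    by (simp add: op_trace_def op_mult_def sum_distrib_left mult_ac)
qed

text \<open>The factors t come from the arguments alone and serve every operator \<open>B\<close>.
  Their strict positivity at nonzero arguments lets a vanishing pairing be carried over to
  normalized states.\<close>

lemma psd_list_scaled_states:
  assumes "1 \<le> d" "length Xs = n" "\<forall>X\<in>set Xs. psd d X"
  obtains t \<rho>s where "length \<rho>s = n" "\<forall>M\<in>set \<rho>s. state_mat d M"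
    "\<And>k. k < n \<Longrightarrow> 0 \<le> t k" "\<And>k. k < n \<Longrightarrow> Xs ! k \<noteq> 0\<^sub>m d d \<Longrightarrow> 0 < t k"
    "\<And>B. pairing d n B Xs = complex_of_real (\<Prod>k<n. t k) * pairing d n B \<rho>s"
proof -
  have "\<exists>t \<rho>. 0 \<le> t \<and> state_mat d \<rho> \<and> Xs ! k = complex_of_real t \<cdot>\<^sub>m \<rho> \<and> (Xs ! k \<noteq> 0\<^sub>m d d \<longrightarrow> 0 < t)"
    if "k < n" for k
    using psd_scaled_state[OF assms(1), of "Xs ! k"] assms(2,3) that by (metis nth_mem)
  then obtain t \<rho> where t: "\<And>k. k < n \<Longrightarrow> 0 \<le> t k \<and> state_mat d (\<rho> k) \<and>
      Xs ! k = complex_of_real (t k) \<cdot>\<^sub>m \<rho> k \<and> (Xs ! k \<noteq> 0\<^sub>m d d \<longrightarrow> 0 < t k)"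
    by metis
  have "pairing d n B Xs = complex_of_real (\<Prod>k<n. t k) * pairing d n B (map \<rho> [0..<n])" for B
    using pairing_smult[of Xs n "map \<rho> [0..<n]" d "\<lambda>k. complex_of_real (t k)" B] assms(2) t
    by (simp add: state_mat_def psd_def)
  then show ?thesis using that[of "map \<rho> [0..<n]" t] t by auto
qed

lemma block_positive_psd:
  assumes "1 \<le> d" "block_positive d n B" "length Xs = n" "\<forall>X\<in>set Xs. psd d X"
  shows "nonneg_c (pairing d n B Xs)"
proof -
  obtain t \<rho>s where "length \<rho>s = n" "\<forall>M\<in>set \<rho>s. state_mat d M" "\<And>k. k < n \<Longrightarrow> 0 \<le> t k"
    "pairing d n B Xs = complex_of_real (\<Prod>k<n. t k) * pairing d n B \<rho>s"
    using psd_list_scaled_states[OF assms(1,3,4)] by metis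
  then show ?thesis
    using assms(2)
    by (auto simp: block_positive_iff_states simp del: of_real_prod intro!: nonneg_c_scale prod_nonneg)
qed

section \<open>The commutant of the unitary group\<close>

definition commutes :: "nat \<Rightarrow> nat \<Rightarrow> op \<Rightarrow> op \<Rightarrow> bool" where
  "commutes d n B A \<longleftrightarrow> op_eq d n (op_mult d n B A) (op_mult d n A B)"

lemma commutes_sym: "commutes d n B A \<Longrightarrow> commutes d n A B"
  by (simp add: commutes_def op_eq_def)

lemma commutes_cong: "op_eq d n A A' \<Longrightarrow> commutes d n B A \<longleftrightarrow> commutes d n B A'"
  unfolding commutes_def
  by (meson op_eq_refl op_eq_sym op_eq_trans op_mult_cong)

lemma commutes_sum:
  assumes "\<And>x. x \<in> S \<Longrightarrow> commutes d n B (A x)"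
  shows "commutes d n B (\<lambda>I J. \<Sum>x\<in>S. c x * A x I J)"
  unfolding commutes_def op_eq_def
proof (intro ballI)
  fix I J assume I: "I \<in> idx d n" and J: "J \<in> idx d n"
  have "op_mult d n B (\<lambda>I J. \<Sum>x\<in>S. c x * A x I J) I J
      = (\<Sum>K\<in>idx d n. \<Sum>x\<in>S. c x * (B I K * A x K J))"
    by (simp add: op_mult_def sum_distrib_left mult_ac)
  also have "\<dots> = (\<Sum>x\<in>S. c x * op_mult d n B (A x) I J)"
    by (subst sum.swap) (simp add: op_mult_def sum_distrib_left)
  also have "\<dots> = (\<Sum>x\<in>S. c x * op_mult d n (A x) B I J)"
    using assms I J by (intro sum.cong) (auto simp: commutes_def op_eq_def)
  also have "\<dots> = (\<Sum>K\<in>idx d n. \<Sum>x\<in>S. c x * (A x I K * B K J))"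
    by (subst sum.swap) (simp add: op_mult_def sum_distrib_left)
  also have "\<dots> = op_mult d n (\<lambda>I J. \<Sum>x\<in>S. c x * A x I J) B I J"
    by (simp add: op_mult_def sum_distrib_right mult.assoc)
  finally show "op_mult d n B (\<lambda>I J. \<Sum>x\<in>S. c x * A x I J) I J
      = op_mult d n (\<lambda>I J. \<Sum>x\<in>S. c x * A x I J) B I J" .
qed

lemma commutes_diff:
  assumes "commutes d n B A" "commutes d n B A'"
  shows "commutes d n B (\<lambda>I J. A I J - A' I J)"
  using assms
  by (simp add: commutes_def op_eq_def op_mult_def ring_distribs sum_subtractf)

lemma commutes_mult:
  assumes "commutes d n B A" "commutes d n B A'"
  shows "commutes d n B (op_mult d n A A')"
  unfolding commutes_def
proof -
  let ?m = "op_mult d n"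
  have "op_eq d n (?m B (?m A A')) (?m (?m B A) A')"
    by (rule op_eq_sym, rule op_mult_assoc_eq)
  also have "op_eq d n \<dots> (?m (?m A B) A')"
    using assms(1) by (auto intro: op_mult_cong simp: commutes_def)
  also have "op_eq d n \<dots> (?m A (?m B A'))"
    by (rule op_mult_assoc_eq)
  also have "op_eq d n \<dots> (?m A (?m A' B))"
    using assms(2) by (auto intro: op_mult_cong simp: commutes_def)
  also have "op_eq d n \<dots> (?m (?m A A') B)"
    by (rule op_eq_sym, rule op_mult_assoc_eq)
  finally show "op_eq d n (?m B (?m A A')) (?m (?m A A') B)" .
qed

lemma tens_replicate_mult:
  assumes "A \<in> carrier_mat d d" "B \<in> carrier_mat d d"
  shows "op_eq d n (op_mult d n (tens (replicate n A)) (tens (replicate n B))) (tens (replicate n (A * B)))"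
  using tens_mult[of "replicate n A" n "replicate n B" d] assms
  by (simp add: op_eq_def zip_replicate)

lemma op_mult_one_right: "op_eq d n (op_mult d n B (tens (replicate n (1\<^sub>m d)))) B"
  by (simp add: op_eq_def op_mult_def tens_one if_distrib[of "(*) _"] cong: if_cong)

lemma adj_carrier: "U \<in> carrier_mat d d \<Longrightarrow> adj U \<in> carrier_mat d d"
  by (auto simp: adj_def)

text \<open>Commutation, unlike invariance under conjugation, survives linear combinations of the
  tensor powers of U.\<close>

lemma unitary_invariant_iff_commutes:
  "unitary_invariant d n B \<longleftrightarrow> (\<forall>U. unitary_d d U \<longrightarrow> commutes d n B (tens (replicate n U)))"
proof -
  have "op_eq d n (op_mult d n (op_mult d n (tens (replicate n U)) B) (tens (replicate n (adj U)))) B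
      \<longleftrightarrow> commutes d n B (tens (replicate n U))" if U: "unitary_d d U" for U
  proof -
    let ?m = "op_mult d n" and ?U = "tens (replicate n U)" and ?V = "tens (replicate n (adj U))"
    let ?E = "tens (replicate n (1\<^sub>m d))"
    have c: "U \<in> carrier_mat d d" "adj U \<in> carrier_mat d d" and uu: "U * adj U = 1\<^sub>m d"
      using U adj_carrier by (auto simp: unitary_d_def)
    \<comment> \<open>\<open>unitary_d\<close> provides a right inverse; for square matrices it is
      also a left inverse, and the two directions below cancel from different sides.\<close>
    then have "adj U * U = 1\<^sub>m d" using mat_mult_left_right_inverse by blast
    then have VU: "op_eq d n (?m ?V ?U) ?E" and UV: "op_eq d n (?m ?U ?V) ?E"
      using tens_replicate_mult[OF c(2,1)] tens_replicate_mult[OF c] uu by simp_all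
    show ?thesis
    proof
      assume inv: "op_eq d n (?m (?m ?U B) ?V) B"
      have "op_eq d n (?m B ?U) (?m (?m (?m ?U B) ?V) ?U)"
        using inv by (intro op_mult_cong) (simp_all add: op_eq_sym)
      also have "op_eq d n \<dots> (?m (?m ?U B) (?m ?V ?U))" by (rule op_mult_assoc_eq)
      also have "op_eq d n \<dots> (?m (?m ?U B) ?E)" using VU by (intro op_mult_cong) simp_all
      also have "op_eq d n \<dots> (?m ?U B)" by (rule op_mult_one_right)
      finally show "commutes d n B ?U" by (simp add: commutes_def)
    next
      assume "commutes d n B ?U"
      then have "op_eq d n (?m ?U B) (?m B ?U)" by (simp add: commutes_def op_eq_sym)
      then have "op_eq d n (?m (?m ?U B) ?V) (?m (?m B ?U) ?V)"
        by (rule op_mult_cong) simp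
      also have "op_eq d n \<dots> (?m B (?m ?U ?V))" by (rule op_mult_assoc_eq)
      also have "op_eq d n \<dots> (?m B ?E)" using UV by (intro op_mult_cong) simp_all
      also have "op_eq d n \<dots> B" by (rule op_mult_one_right)
      finally show "op_eq d n (?m (?m ?U B) ?V) B" .
    qed
  qed
  then show ?thesis by (auto simp: unitary_invariant_def)
qed

text \<open>The differential at the identity of the map from U to its n-th tensor power, that is,
  the action of the Lie algebra gl(d).\<close>

definition derivation :: "nat \<Rightarrow> nat \<Rightarrow> complex mat \<Rightarrow> op" where
  "derivation d n Y = (\<lambda>I J. \<Sum>a<n. tens ((replicate n (1\<^sub>m d))[a := Y]) I J)"

lemma tens_update:
  assumes "length Ms = n" "a < n"
  shows "tens (Ms[a := Y]) I J = Y $$ (I ! a, J ! a) * (\<Prod>k\<in>{..<n} - {a}. Ms ! k $$ (I ! k, J ! k))"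
proof -
  have "(\<Prod>k\<in>{..<n} - {a}. Ms[a := Y] ! k $$ (I ! k, J ! k)) = (\<Prod>k\<in>{..<n} - {a}. Ms ! k $$ (I ! k, J ! k))"
    by (rule prod.cong) auto
  then show ?thesis using assms by (simp add: tens_def prod.remove[of "{..<n}" a])
qed

text \<open>Infinitely many zeros are needed to force a polynomial to be 0. The real parts of the
  circle cover [0, 1].\<close>

lemma infinite_unit_circle: "infinite {z::complex. z * cnj z = 1}"
proof
  assume fin: "finite {z::complex. z * cnj z = 1}"
  have "{0..1::real} \<subseteq> Re ` {z::complex. z * cnj z = 1}"
  proof
    fix x :: real assume "x \<in> {0..1}"
    then have "x\<^sup>2 \<le> 1" by (simp add: power_le_one)
    then have "Complex x (sqrt (1 - x\<^sup>2)) \<in> {z. z * cnj z = 1}"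
      by (simp add: complex_eq_iff power2_eq_square)
    then show "x \<in> Re ` {z. z * cnj z = 1}" by (force intro: image_eqI)
  qed
  then have "finite {0..1::real}" using fin finite_surj by blast
  then show False using infinite_Icc[of 0 "1::real"] by simp
qed

text \<open>The matrix is 1 + (z - 1) P with P the orthogonal projection onto the line of v: it
  multiplies v by z and fixes the orthogonal complement.\<close>

lemma complex_reflection_unitary:
  assumes z: "z * cnj z = 1" and N: "N = (\<Sum>i<d. v i * cnj (v i))" "N \<noteq> 0"
  shows "unitary_d d (mat d d (\<lambda>(i, j). (if i = j then 1 else 0) + (z - 1) / N * (v i * cnj (v j))))"
    (is "unitary_d d ?U")
  unfolding unitary_d_def
proof (intro conjI eq_matI)
  have cN: "cnj N = N" unfolding N by (simp add: mult.commute)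
  fix i j assume "i < dim_row (1\<^sub>m d :: complex mat)" "j < dim_col (1\<^sub>m d :: complex mat)"
  then have ij: "i < d" "j < d" by simp_all
  define w where "w = (z - 1) / N"
  have "(?U * adj ?U) $$ (i, j)
      = (\<Sum>x<d. ((if i = x then 1 else 0) + w * (v i * cnj (v x)))
          * ((if j = x then 1 else 0) + cnj w * (v x * cnj (v j))))"
  proof -
    have "(?U * adj ?U) $$ (i, j) = (\<Sum>x<d. ?U $$ (i, x) * adj ?U $$ (x, j))"
      using ij by (intro index_mult_sum adj_carrier) auto
    also have "\<dots> = (\<Sum>x<d. ((if i = x then 1 else 0) + w * (v i * cnj (v x)))
          * ((if j = x then 1 else 0) + cnj w * (v x * cnj (v j))))"
      by (rule sum.cong) (use ij in \<open>auto simp: adj_def w_def mult_ac\<close>)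
    finally show ?thesis .
  qed
  also have "\<dots> = (\<Sum>x<d. (if x = i then (if i = j then 1 else 0) else 0))
      + (\<Sum>x<d. if x = i then cnj w * (v i * cnj (v j)) else 0)
      + (\<Sum>x<d. if x = j then w * (v i * cnj (v j)) else 0)
      + (\<Sum>x<d. w * cnj w * (v i * cnj (v j)) * (v x * cnj (v x)))"
    unfolding sum.distrib[symmetric] by (rule sum.cong) (auto simp: algebra_simps)
  also have "\<dots> = (if i = j then 1 else 0) + (cnj w + w + w * cnj w * N) * (v i * cnj (v j))"
  proof -
    have "(\<Sum>x<d. w * cnj w * (v i * cnj (v j)) * (v x * cnj (v x))) = w * cnj w * (v i * cnj (v j)) * N"
      unfolding N(1) by (rule sum_distrib_left[symmetric])
    then show ?thesis using ij by (simp add: algebra_simps)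
  qed
  \<comment> \<open>By |z| = 1 the squared modulus of z - 1 is 2 - z - cnj z, which cancels the
    linear terms.\<close>
  also have "cnj w + w + w * cnj w * N = 0"
    using N(2) z by (simp add: w_def cN field_simps)
  finally show "(?U * adj ?U) $$ (i, j) = 1\<^sub>m d $$ (i, j)" using ij by simp
qed (auto simp: adj_def)

text \<open>The tensor power of the identity plus w times a rank-one projection is polynomial in w. It commutes
  with B for w on a circle through 0, hence so does its linear coefficient.\<close>

lemma commutes_derivation_rank_one:
  assumes "unitary_invariant d n B"
  shows "commutes d n B (derivation d n (mat d d (\<lambda>(i, j). v i * cnj (v j))))"
proof (cases "(\<Sum>i<d. v i * cnj (v i)) = 0")
  case True
  \<comment> \<open>With squared norm 0 the vector vanishes and no reflection exists, but then the
    derivation itself is 0.\<close>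
  have "v i * cnj (v i) = 0" if "i < d" for i
    by (rule sum_nonneg_c_eq_0[OF finite_lessThan _ True]) (use that in simp_all)
  then have v: "v i = 0" if "i < d" for i using that by (metis complex_cnj_zero_iff mult_eq_0_iff)
  have "op_eq d n (derivation d n (mat d d (\<lambda>(i, j). v i * cnj (v j)))) (\<lambda>_ _. 0)"
    by (auto simp: op_eq_def derivation_def tens_update v idx_nth intro!: sum.neutral)
  moreover have "commutes d n B (\<lambda>_ _. 0)" by (simp add: commutes_def op_eq_def op_mult_def)
  ultimately show ?thesis using commutes_cong by blast
next
  case N0: False
  define N where "N = (\<Sum>i<d. v i * cnj (v i))"
  let ?P = "mat d d (\<lambda>(i, j). v i * cnj (v j))"
  \<comment> \<open>Entries of the identity plus w times the unnormalized rank-one matrix, constant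
    coefficient first; the norm is absorbed in w = (z - 1) / N.\<close>
  define e where "e i j = [: if i = j then 1 else 0, v i * cnj (v j) :]" for i j :: nat
  define q where "q I J = (\<Prod>k<n. e (I ! k) (J ! k))" for I J
  show ?thesis
    unfolding commutes_def op_eq_def
  proof (intro ballI)
    fix I J assume I: "I \<in> idx d n" and J: "J \<in> idx d n"
    define p where "p = (\<Sum>K\<in>idx d n. Polynomial.smult (B I K) (q K J) - Polynomial.smult (B K J) (q I K))"
    have "poly p ((z - 1) / N) = 0" if z: "z * cnj z = 1" for z
    proof -
      define U where "U = mat d d (\<lambda>(i, j). (if i = j then 1 else 0) + (z - 1) / N * (v i * cnj (v j)))"
      have "unitary_d d U"
        unfolding U_def using complex_reflection_unitary[OF z N_def] N0 by (simp add: N_def)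
      then have "commutes d n B (tens (replicate n U))"
        using assms by (simp add: unitary_invariant_iff_commutes)
      then have "op_mult d n B (tens (replicate n U)) I J = op_mult d n (tens (replicate n U)) B I J"
        using I J by (simp add: commutes_def op_eq_def)
      moreover have "tens (replicate n U) K L = poly (q K L) ((z - 1) / N)"
        if "K \<in> idx d n" "L \<in> idx d n" for K L
        using that by (auto simp: tens_def q_def e_def U_def poly_prod idx_nth intro!: prod.cong)
      ultimately show ?thesis
        using I J by (simp add: p_def op_mult_def poly_sum sum_subtractf mult.commute)
    qed
    then have sub: "(\<lambda>z. (z - 1) / N) ` {z. z * cnj z = 1} \<subseteq> {w. poly p w = 0}" by auto
    have "inj (\<lambda>z. (z - 1) / N)" using N0 by (auto simp: inj_def N_def)
    then have "infinite ((\<lambda>z. (z - 1) / N) ` {z. z * cnj z = 1})"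
      using infinite_unit_circle finite_imageD inj_on_subset by blast
    then have "p = 0" using sub poly_roots_finite finite_subset by blast
    then have "poly (pderiv p) 0 = 0" by simp
    \<comment> \<open>The product rule at 0 differentiates one factor at a time, and the other
      factors become Kronecker deltas.\<close>
    moreover have pd: "poly (pderiv (q K L)) 0 = derivation d n ?P K L"
      if "K \<in> idx d n" "L \<in> idx d n" for K L
    proof -
      have "poly (pderiv (q K L)) 0
          = (\<Sum>a<n. (\<Prod>k\<in>{..<n} - {a}. if K ! k = L ! k then 1 else 0) * (v (K ! a) * cnj (v (L ! a))))"
        by (simp add: q_def pderiv_prod poly_sum poly_prod e_def pderiv_pCons mult.commute)
      also have "\<dots> = derivation d n ?P K L"
        unfolding derivation_def
      proof (rule sum.cong)
        fix a assume a: "a \<in> {..<n}"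
        have "(\<Prod>k\<in>{..<n} - {a}. replicate n (1\<^sub>m d) ! k $$ (K ! k, L ! k))
            = (\<Prod>k\<in>{..<n} - {a}. if K ! k = L ! k then 1 else (0::complex))"
          by (rule prod.cong) (use that in \<open>auto simp: idx_nth\<close>)
        then show "(\<Prod>k\<in>{..<n} - {a}. if K ! k = L ! k then 1 else 0) * (v (K ! a) * cnj (v (L ! a)))
            = tens ((replicate n (1\<^sub>m d))[a := ?P]) K L"
          using a that by (simp add: tens_update idx_nth mult.commute)
      qed simp
      finally show ?thesis .
    qed
    moreover have "poly (pderiv p) 0
        = (\<Sum>K\<in>idx d n. B I K * poly (pderiv (q K J)) 0 - B K J * poly (pderiv (q I K)) 0)"
      unfolding p_def pderiv_sum by (simp add: poly_sum pderiv_diff pderiv_smult)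
    ultimately show "op_mult d n B (derivation d n ?P) I J = op_mult d n (derivation d n ?P) B I J"
      using I J by (simp add: op_mult_def sum_subtractf mult.commute)
  qed
qed

text \<open>For u = e_a + \<i>^k e_b, weight the rank-one matrix of u by \<i>^k and sum over k. The
  term at (a, b) survives four times, whence the 1/4; the others carry sums of \<i>^k or of (-1)^k
  and cancel.\<close>

lemma polarization:
  fixes Y :: "nat \<Rightarrow> nat \<Rightarrow> complex"
  assumes "i < d" "j < d"
  defines "u \<equiv> \<lambda>a b k x. (if x = a then 1 else 0) + \<i> ^ k * (if x = b then 1 else 0)"
  shows "Y i j = (\<Sum>a<d. \<Sum>b<d. \<Sum>k<(4::nat). Y a b * \<i> ^ k / 4 * (u a b k i * cnj (u a b k j)))"
proof -
  have "(\<Sum>k<(4::nat). \<i> ^ k / 4 * (u a b k i * cnj (u a b k j)))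
      = (if i = a \<and> j = b then 1 else 0)" for a b
    by (simp add: u_def eval_nat_numeral lessThan_Suc algebra_simps)
  then have "(\<Sum>k<(4::nat). Y a b * \<i> ^ k / 4 * (u a b k i * cnj (u a b k j)))
      = (if a = i then (if b = j then Y a b else 0) else 0)" for a b
    by (simp add: mult.assoc flip: sum_distrib_left times_divide_eq_right)
  then show ?thesis using assms(1,2)
    by (simp add: sum.If_cases)
qed

text \<open>\<open>derivation\<close> is linear in Y, and by \<open>polarization\<close> the
  rank-one matrices span.\<close>

lemma commutes_derivation:
  assumes B: "unitary_invariant d n B" and Y: "Y \<in> carrier_mat d d"
  shows "commutes d n B (derivation d n Y)"
proof -
  define u where "u a b k x = (if x = a then 1 else 0) + \<i> ^ k * (if x = b then 1 else 0)"
    for a b k x :: nat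
  define P where "P = (\<lambda>(a, b, k). mat d d (\<lambda>(i, j). u a b k i * cnj (u a b k j)))"
  define c where "c = (\<lambda>(a, b, k::nat). Y $$ (a, b) * \<i> ^ k / 4)"
  let ?S = "{..<d} \<times> {..<d} \<times> {..<4}"
  have "commutes d n B (derivation d n (P x))" for x
    unfolding P_def by (cases x) (simp add: commutes_derivation_rank_one[OF B])
  then have com: "commutes d n B (\<lambda>I J. \<Sum>x\<in>?S. c x * derivation d n (P x) I J)"
    by (intro commutes_sum)
  have ent: "Y $$ (i, j) = (\<Sum>x\<in>?S. c x * P x $$ (i, j))" if "i < d" "j < d" for i j
    using polarization[OF that, of "\<lambda>i j. Y $$ (i, j)"] that
    by (simp add: sum.cartesian_product c_def P_def u_def cong: sum.cong) (auto intro!: sum.cong)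
  have "derivation d n Y I J = (\<Sum>x\<in>?S. c x * derivation d n (P x) I J)"
    if I: "I \<in> idx d n" and J: "J \<in> idx d n" for I J
  proof -
    have "derivation d n Y I J = (\<Sum>a<n. \<Sum>x\<in>?S. c x * tens ((replicate n (1\<^sub>m d))[a := P x]) I J)"
      unfolding derivation_def
      by (rule sum.cong) (use I J in \<open>simp_all add: tens_update ent idx_nth sum_distrib_right mult.assoc\<close>)
    also have "\<dots> = (\<Sum>x\<in>?S. c x * derivation d n (P x) I J)"
      unfolding derivation_def sum_distrib_left by (rule sum.swap)
    finally show ?thesis .
  qed
  then have "op_eq d n (derivation d n Y) (\<lambda>I J. \<Sum>x\<in>?S. c x * derivation d n (P x) I J)"
    by (simp add: op_eq_def)
  then show ?thesis using com commutes_cong by blast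
qed

section \<open>Symmetrized tensor products\<close>

text \<open>Built by successive updates, which commute for distinct positions;
  \<open>place_nth\<close> and \<open>place_update\<close> then follow by induction.\<close>

fun place :: "nat \<Rightarrow> nat \<Rightarrow> nat list \<Rightarrow> complex mat list \<Rightarrow> complex mat list" where
  "place d n (p # ps) (Y # Ys) = (place d n ps Ys)[p := Y]"
| "place d n _ _ = replicate n (1\<^sub>m d)"

definition positions :: "nat \<Rightarrow> nat \<Rightarrow> nat list set" where
  "positions n m = {ps. length ps = m \<and> distinct ps \<and> set ps \<subseteq> {..<n}}"

text \<open>The sum runs over injective placements of the factors, without normalization. One factor
  gives \<open>derivation\<close>; n factors give a sum over all permutations.\<close>

definition sym_tens :: "nat \<Rightarrow> nat \<Rightarrow> complex mat list \<Rightarrow> op" where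
  "sym_tens d n Ys = (\<lambda>I J. \<Sum>ps\<in>positions n (length Ys). tens (place d n ps Ys) I J)"

lemma finite_positions [simp]: "finite (positions n m)"
  by (rule finite_subset[OF _ finite_lists_length_eq[of "{..<n}" m]]) (auto simp: positions_def)

lemma length_place [simp]: "length (place d n ps Ys) = n"
  by (induction d n ps Ys rule: place.induct) auto

lemma place_notin: "a < n \<Longrightarrow> a \<notin> set ps \<Longrightarrow> place d n ps Ys ! a = 1\<^sub>m d"
  by (induction d n ps Ys rule: place.induct) auto

lemma place_nth:
  "distinct ps \<Longrightarrow> set ps \<subseteq> {..<n} \<Longrightarrow> length ps = length Ys \<Longrightarrow> k < length Ys
    \<Longrightarrow> place d n ps Ys ! (ps ! k) = Ys ! k"
proof (induction d n ps Ys arbitrary: k rule: place.induct)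
  case (1 d n p ps Y Ys)
  show ?case
  proof (cases k)
    case (Suc l)
    then have "ps ! l \<noteq> p" using 1 by (auto dest: nth_mem)
    then show ?thesis using 1 Suc by simp
  qed (use 1 in simp)
qed auto

lemma place_update:
  "distinct ps \<Longrightarrow> length ps = length Ys \<Longrightarrow> k < length Ys
    \<Longrightarrow> (place d n ps Ys)[ps ! k := Z] = place d n ps (Ys[k := Z])"
proof (induction d n ps Ys arbitrary: k rule: place.induct)
  case (1 d n p ps Y Ys)
  show ?case
  proof (cases k)
    case (Suc l)
    then have "p \<noteq> ps ! l" using 1 by (auto dest: nth_mem)
    then show ?thesis using 1 Suc by (simp add: list_update_swap[of p "ps ! l"])
  qed simp
qed auto

lemma nth_list_update_if: "a < length xs \<Longrightarrow> xs[p := Y] ! a = (if a = p then Y else xs ! a)"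
  by (cases "a = p") auto

lemma place_carrier:
  "set Ys \<subseteq> carrier_mat d d \<Longrightarrow> a < n \<Longrightarrow> place d n ps Ys ! a \<in> carrier_mat d d"
  by (induction d n ps Ys rule: place.induct) (auto simp: nth_list_update_if)

lemma derivation_mult_tens:
  assumes "length Ms = n" "\<And>a. a < n \<Longrightarrow> Ms ! a \<in> carrier_mat d d" "Y \<in> carrier_mat d d"
    and "I \<in> idx d n" "J \<in> idx d n"
  shows "op_mult d n (derivation d n Y) (tens Ms) I J = (\<Sum>a<n. tens (Ms[a := Y * Ms ! a]) I J)"
proof -
  have "op_mult d n (derivation d n Y) (tens Ms) I J
      = (\<Sum>a<n. op_mult d n (tens ((replicate n (1\<^sub>m d))[a := Y])) (tens Ms) I J)"
    unfolding op_mult_def derivation_def sum_distrib_right by (rule sum.swap)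
  also have "\<dots> = (\<Sum>a<n. tens (Ms[a := Y * Ms ! a]) I J)"
  proof (rule sum.cong)
    fix a assume a: "a \<in> {..<n}"
    have "op_mult d n (tens ((replicate n (1\<^sub>m d))[a := Y])) (tens Ms) I J
        = tens (map2 (*) ((replicate n (1\<^sub>m d))[a := Y]) Ms) I J"
      by (rule tens_mult) (use assms in \<open>auto simp: nth_list_update_if\<close>)
    also have "map2 (*) ((replicate n (1\<^sub>m d))[a := Y]) Ms = Ms[a := Y * Ms ! a]"
      by (rule nth_equalityI) (use assms(1) a left_mult_one_mat[OF assms(2)] in \<open>auto simp: nth_list_update_if\<close>)
    finally show "op_mult d n (tens ((replicate n (1\<^sub>m d))[a := Y])) (tens Ms) I J = tens (Ms[a := Y * Ms ! a]) I J" .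
  qed simp
  finally show ?thesis .
qed

lemma sum_positions_Suc:
  "(\<Sum>qs\<in>positions n (Suc m). f qs) = (\<Sum>ps\<in>positions n m. \<Sum>a\<in>{..<n} - set ps. f (a # ps))"
proof -
  have "(\<Sum>ps\<in>positions n m. \<Sum>a\<in>{..<n} - set ps. f (a # ps))
      = (\<Sum>(ps, a)\<in>Sigma (positions n m) (\<lambda>ps. {..<n} - set ps). f (a # ps))"
    by (simp add: sum.Sigma)
  also have "\<dots> = (\<Sum>qs\<in>positions n (Suc m). f qs)"
    by (rule sum.reindex_bij_witness[where i = "\<lambda>qs. (tl qs, hd qs)" and j = "\<lambda>(ps, a). a # ps"])
      (auto simp: positions_def length_Suc_conv)
  finally show ?thesis by simp
qed

text \<open>A slot hit by Y is either free, where the identity becomes Y and the list of factors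
  grows by one, or occupied by factor number k, which gets multiplied by Y. The recursion isolates
  the longer symmetrized tensor.\<close>

lemma derivation_mult_sym_tens:
  assumes Ys: "set Ys \<subseteq> carrier_mat d d" and Y: "Y \<in> carrier_mat d d"
  shows "op_eq d n (op_mult d n (derivation d n Y) (sym_tens d n Ys))
    (\<lambda>I J. sym_tens d n (Y # Ys) I J + (\<Sum>k<length Ys. sym_tens d n (Ys[k := Y * Ys ! k]) I J))"
  unfolding op_eq_def
proof (intro ballI)
  fix I J assume I: "I \<in> idx d n" and J: "J \<in> idx d n"
  let ?m = "length Ys"
  let ?P = "positions n ?m"
  have split: "(\<Sum>a<n. tens ((place d n ps Ys)[a := Y * place d n ps Ys ! a]) I J)
      = (\<Sum>a\<in>{..<n} - set ps. tens (place d n (a # ps) (Y # Ys)) I J)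
        + (\<Sum>k<?m. tens (place d n ps (Ys[k := Y * Ys ! k])) I J)"
    if ps: "ps \<in> ?P" for ps
  proof -
    have d: "distinct ps" "set ps \<subseteq> {..<n}" "length ps = ?m" using ps by (auto simp: positions_def)
    let ?f = "\<lambda>a. tens ((place d n ps Ys)[a := Y * place d n ps Ys ! a]) I J"
    have "(\<Sum>a\<in>{..<n} - set ps. ?f a) = (\<Sum>a\<in>{..<n} - set ps. tens (place d n (a # ps) (Y # Ys)) I J)"
      by (rule sum.cong) (use Y in \<open>auto simp: place_notin\<close>)
    moreover have "(\<Sum>a\<in>set ps. ?f a) = (\<Sum>k<?m. ?f (ps ! k))"
      by (rule sum.reindex_bij_betw[symmetric]) (use bij_betw_nth[OF d(1) refl refl] d(3) in simp)
    moreover have "(\<Sum>k<?m. ?f (ps ! k)) = (\<Sum>k<?m. tens (place d n ps (Ys[k := Y * Ys ! k])) I J)"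
      by (rule sum.cong) (use d in \<open>simp_all add: place_nth place_update\<close>)
    moreover have "(\<Sum>a<n. ?f a) = (\<Sum>a\<in>{..<n} - set ps. ?f a) + (\<Sum>a\<in>set ps. ?f a)"
      using d(2) by (intro sum.subset_diff) auto
    ultimately show ?thesis by simp
  qed
  have "op_mult d n (derivation d n Y) (sym_tens d n Ys) I J
      = (\<Sum>ps\<in>?P. op_mult d n (derivation d n Y) (tens (place d n ps Ys)) I J)"
    unfolding op_mult_def sym_tens_def sum_distrib_left by (rule sum.swap)
  also have "\<dots> = (\<Sum>ps\<in>?P. \<Sum>a<n. tens ((place d n ps Ys)[a := Y * place d n ps Ys ! a]) I J)"
    by (intro sum.cong refl derivation_mult_tens) (use I J Y place_carrier[OF Ys] in auto)
  also have "\<dots> = (\<Sum>ps\<in>?P. \<Sum>a\<in>{..<n} - set ps. tens (place d n (a # ps) (Y # Ys)) I J)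
      + (\<Sum>ps\<in>?P. \<Sum>k<?m. tens (place d n ps (Ys[k := Y * Ys ! k])) I J)"
    by (simp add: split sum.distrib)
  also have "(\<Sum>ps\<in>?P. \<Sum>a\<in>{..<n} - set ps. tens (place d n (a # ps) (Y # Ys)) I J)
      = sym_tens d n (Y # Ys) I J"
    by (simp add: sym_tens_def sum_positions_Suc)
  also have "(\<Sum>ps\<in>?P. \<Sum>k<?m. tens (place d n ps (Ys[k := Y * Ys ! k])) I J)
      = (\<Sum>k<?m. sym_tens d n (Ys[k := Y * Ys ! k]) I J)"
    unfolding sym_tens_def by (subst sum.swap) simp
  finally show "op_mult d n (derivation d n Y) (sym_tens d n Ys) I J
    = sym_tens d n (Y # Ys) I J + (\<Sum>k<?m. sym_tens d n (Ys[k := Y * Ys ! k]) I J)" .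
qed

text \<open>The recursion is solved for its longest term. The corrections have altered factors but
  the same shorter length, so the induction generalizes over the list.\<close>

lemma commutes_sym_tens:
  assumes B: "unitary_invariant d n B" and "set Ys \<subseteq> carrier_mat d d"
  shows "commutes d n B (sym_tens d n Ys)"
  using assms(2)
proof (induction "length Ys" arbitrary: Ys)
  case 0
  then have Ys: "Ys = []" by simp
  have "positions n 0 = {[]}" by (auto simp: positions_def)
  then have "sym_tens d n Ys = tens (replicate n (1\<^sub>m d))"
    by (simp add: sym_tens_def Ys)
  \<comment> \<open>Without factors the symmetrized tensor is the identity, itself the tensor power
    of a unitary.\<close>
  moreover have "unitary_d d (1\<^sub>m d)"
  proof -
    have "adj (1\<^sub>m d) = 1\<^sub>m d" by (auto simp: adj_def)
    then show ?thesis by (simp add: unitary_d_def)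
  qed
  ultimately show ?case using B by (simp add: unitary_invariant_iff_commutes)
next
  case (Suc m)
  then obtain Y Zs where Ys: "Ys = Y # Zs" by (cases Ys) auto
  then have c: "Y \<in> carrier_mat d d" "set Zs \<subseteq> carrier_mat d d" and m: "m = length Zs"
    using Suc by auto
  let ?D = "op_mult d n (derivation d n Y) (sym_tens d n Zs)"
  let ?R = "\<lambda>I J. \<Sum>k<m. 1 * sym_tens d n (Zs[k := Y * Zs ! k]) I J"
  have "commutes d n B ?D"
    using Suc.hyps(1)[OF m c(2)] commutes_derivation[OF B c(1)] by (rule commutes_mult[rotated])
  moreover have "commutes d n B ?R"
  proof (rule commutes_sum)
    fix k assume k: "k \<in> {..<m}"
    then have "Y * Zs ! k \<in> carrier_mat d d" using c m by (intro mult_carrier_mat[of _ d d]) auto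
    then have "set (Zs[k := Y * Zs ! k]) \<subseteq> carrier_mat d d"
      using c(2) set_update_subset_insert[of Zs k "Y * Zs ! k"] by blast
    then show "commutes d n B (sym_tens d n (Zs[k := Y * Zs ! k]))"
      using Suc.hyps(1)[of "Zs[k := Y * Zs ! k]"] m by simp
  qed
  ultimately have "commutes d n B (\<lambda>I J. ?D I J - ?R I J)" by (rule commutes_diff)
  moreover have "op_eq d n (\<lambda>I J. ?D I J - ?R I J) (sym_tens d n Ys)"
    using derivation_mult_sym_tens[OF c(2,1), of n] by (simp add: op_eq_def Ys m)
  ultimately show ?case using commutes_cong by blast
qed

section \<open>Permutation operators\<close>

text \<open>A multi-index is regarded as a function on slots and precomposed with \<sigma>. This is
  a right action, hence the inverse whenever \<open>Tperm\<close> is expressed by it.\<close>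

definition permute_idx :: "nat \<Rightarrow> (nat \<Rightarrow> nat) \<Rightarrow> nat list \<Rightarrow> nat list" where
  "permute_idx n \<sigma> I = map (\<lambda>k. I ! \<sigma> k) [0..<n]"

lemma permutes_less: "\<sigma> permutes {..<n} \<Longrightarrow> k < n \<Longrightarrow> \<sigma> k < n"
  using permutes_in_image[of \<sigma> "{..<n}" k] by simp

lemma permute_idx_idx: "\<sigma> permutes {..<n} \<Longrightarrow> I \<in> idx d n \<Longrightarrow> permute_idx n \<sigma> I \<in> idx d n"
  unfolding permute_idx_def by (rule map_idx) (metis idx_nth permutes_less)

lemma permute_idx_inv:
  assumes "\<sigma> permutes {..<n}" "I \<in> idx d n"
  shows "permute_idx n (Hilbert_Choice.inv \<sigma>) (permute_idx n \<sigma> I) = I"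
    "permute_idx n \<sigma> (permute_idx n (Hilbert_Choice.inv \<sigma>) I) = I"
  using assms permutes_less[OF assms(1)] permutes_less[OF permutes_inv[OF assms(1)]]
    permutes_inverses[OF assms(1)]
  by (auto simp: permute_idx_def idx_length intro!: nth_equalityI)

lemma sum_permute_idx:
  assumes "\<sigma> permutes {..<n}"
  shows "(\<Sum>I\<in>idx d n. f (permute_idx n \<sigma> I)) = (\<Sum>I\<in>idx d n. f I)"
  by (rule sum.reindex_bij_witness[where i = "permute_idx n (Hilbert_Choice.inv \<sigma>)" and j = "permute_idx n \<sigma>"])
    (use assms in \<open>auto simp: permute_idx_inv permute_idx_idx permutes_inv\<close>)

lemma permute_idx_eq_iff:
  assumes "\<sigma> permutes {..<n}" "I \<in> idx d n" "J \<in> idx d n"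
  shows "permute_idx n \<sigma> I = J \<longleftrightarrow> I = permute_idx n (Hilbert_Choice.inv \<sigma>) J"
  using assms permute_idx_inv by metis

lemma Tperm_eq:
  assumes "I \<in> idx d n"
  shows "Tperm n \<pi> I J = (if I = permute_idx n (Hilbert_Choice.inv \<pi>) J then 1 else 0)"
proof -
  have "(\<forall>k<n. I ! k = J ! Hilbert_Choice.inv \<pi> k) \<longleftrightarrow> I = permute_idx n (Hilbert_Choice.inv \<pi>) J"
    using idx_length[OF assms] by (auto simp: permute_idx_def list_eq_iff_nth_eq)
  then show ?thesis by (simp add: Tperm_def)
qed

text \<open>Each side has one surviving summand. The remaining products agree after reindexing by
  \<pi>, since all tensor factors are the same matrix.\<close>

lemma Tperm_commutes_tens_replicate:
  assumes "\<pi> permutes {..<n}"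
  shows "commutes d n (Tperm n \<pi>) (tens (replicate n U))"
  unfolding commutes_def op_eq_def
proof (intro ballI)
  fix I J assume I: "I \<in> idx d n" and J: "J \<in> idx d n"
  let ?i = "Hilbert_Choice.inv \<pi>"
  have i: "?i permutes {..<n}" using assms by (rule permutes_inv)
  have ii: "Hilbert_Choice.inv ?i = \<pi>" using assms by (simp add: permutes_inv_inv)
  have "op_mult d n (Tperm n \<pi>) (tens (replicate n U)) I J
      = (\<Sum>K\<in>idx d n. if K = permute_idx n \<pi> I then tens (replicate n U) K J else 0)"
    unfolding op_mult_def using I
    by (intro sum.cong) (auto simp: Tperm_eq permute_idx_inv assms)
  also have "\<dots> = tens (replicate n U) (permute_idx n \<pi> I) J"
    using permute_idx_idx[OF assms I] by simp
  also have "\<dots> = (\<Prod>k<n. U $$ (I ! \<pi> k, J ! k))"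
    by (simp add: tens_def permute_idx_def)
  also have "\<dots> = (\<Prod>k<n. U $$ (I ! k, J ! ?i k))"
    using prod.permute[OF assms, of "\<lambda>k. U $$ (I ! k, J ! ?i k)"] assms
    by (simp add: permutes_inverses comp_def)
  also have "\<dots> = tens (replicate n U) I (permute_idx n ?i J)"
    by (simp add: tens_def permute_idx_def)
  also have "\<dots> = (\<Sum>K\<in>idx d n. if K = permute_idx n ?i J then tens (replicate n U) I K else 0)"
    using permute_idx_idx[OF i J] by simp
  also have "\<dots> = op_mult d n (tens (replicate n U)) (Tperm n \<pi>) I J"
    unfolding op_mult_def by (intro sum.cong) (auto simp: Tperm_eq)
  finally show "op_mult d n (Tperm n \<pi>) (tens (replicate n U)) I J
    = op_mult d n (tens (replicate n U)) (Tperm n \<pi>) I J" .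
qed

lemma That_unitary_invariant: "unitary_invariant d n (That n \<alpha>)"
  unfolding unitary_invariant_iff_commutes
proof (intro allI impI)
  fix U
  have "commutes d n (tens (replicate n U)) (\<lambda>I J. \<Sum>\<pi> | \<pi> permutes {..<n}. \<alpha> \<pi> * Tperm n \<pi> I J)"
    by (rule commutes_sum, rule commutes_sym, rule Tperm_commutes_tens_replicate) simp
  then show "commutes d n (That n \<alpha>) (tens (replicate n U))"
    unfolding That_def by (rule commutes_sym)
qed

section \<open>Schur--Weyl duality\<close>

text \<open>Gram-Schmidt on coefficients: \<open>w\<close> is the part of the new vector orthogonal
  to the old span, and the residual of b is corrected along it. Dependent families must be covered,
  as permutation operators can be dependent.\<close>

lemma orthogonal_decomposition:
  fixes f :: "'s \<Rightarrow> 'x \<Rightarrow> complex"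
  assumes "finite S" "finite X"
  shows "\<exists>a. \<forall>s\<in>S. (\<Sum>x\<in>X. (b x - (\<Sum>t\<in>S. a t * f t x)) * cnj (f s x)) = 0"
  using assms(1)
proof (induction S arbitrary: b rule: finite_induct)
  case (insert v S)
  obtain a' where a': "\<forall>s\<in>S. (\<Sum>x\<in>X. (f v x - (\<Sum>t\<in>S. a' t * f t x)) * cnj (f s x)) = 0"
    using insert.IH[of "f v"] by blast
  obtain a where a: "\<forall>s\<in>S. (\<Sum>x\<in>X. (b x - (\<Sum>t\<in>S. a t * f t x)) * cnj (f s x)) = 0"
    using insert.IH[of b] by blast
  define w where "w x = f v x - (\<Sum>t\<in>S. a' t * f t x)" for x
  define c where "c x = b x - (\<Sum>t\<in>S. a t * f t x)" for x
  \<comment> \<open>If the new vector already lies in the span, \<open>w\<close> is 0 on X and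
    division by 0 gives l = 0, which keeps the old residual.\<close>
  define l where "l = (\<Sum>x\<in>X. c x * cnj (w x)) / (\<Sum>x\<in>X. w x * cnj (w x))"
  define e where "e = (\<lambda>t. if t = v then l else a t - l * a' t)"
  have cw: "b x - (\<Sum>t\<in>insert v S. e t * f t x) = c x - l * w x" for x
  proof -
    have "(\<Sum>t\<in>S. e t * f t x) = (\<Sum>t\<in>S. a t * f t x - l * (a' t * f t x))"
      by (rule sum.cong) (use insert.hyps in \<open>auto simp: e_def algebra_simps\<close>)
    then show ?thesis
      using insert.hyps
      by (simp add: c_def w_def e_def sum_subtractf sum_distrib_left algebra_simps)
  qed
  have orth: "(\<Sum>x\<in>X. (c x - l * w x) * cnj (f s x)) = 0" if "s \<in> S" for s
  proof -
    have "(\<Sum>x\<in>X. (c x - l * w x) * cnj (f s x))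
        = (\<Sum>x\<in>X. c x * cnj (f s x)) - l * (\<Sum>x\<in>X. w x * cnj (f s x))"
      by (simp add: sum_distrib_left sum_subtractf left_diff_distrib mult.assoc)
    then show ?thesis using a a' that by (simp add: c_def w_def)
  qed
  have ww: "(\<Sum>x\<in>X. (c x - l * w x) * cnj (w x)) = 0"
  proof (cases "(\<Sum>x\<in>X. w x * cnj (w x)) = 0")
    case True
    have "w x = 0" if "x \<in> X" for x
    proof -
      have "w x * cnj (w x) = 0"
        by (rule sum_nonneg_c_eq_0[OF assms(2) _ True]) (use that in simp_all)
      then show ?thesis by (metis complex_cnj_zero_iff mult_eq_0_iff)
    qed
    then show ?thesis by simp
  next
    case False
    have "(\<Sum>x\<in>X. (c x - l * w x) * cnj (w x))
        = (\<Sum>x\<in>X. c x * cnj (w x)) - l * (\<Sum>x\<in>X. w x * cnj (w x))"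
      by (simp add: sum_distrib_left sum_subtractf left_diff_distrib mult.assoc)
    then show ?thesis using False by (simp add: l_def)
  qed
  \<comment> \<open>The new vector is \<open>w\<close> plus a combination of old ones, so
    orthogonality to it follows from \<open>ww\<close> and \<open>orth\<close>.\<close>
  have "(\<Sum>x\<in>X. (c x - l * w x) * cnj (f v x))
      = (\<Sum>x\<in>X. (c x - l * w x) * cnj (w x))
        + (\<Sum>x\<in>X. \<Sum>t\<in>S. cnj (a' t) * ((c x - l * w x) * cnj (f t x)))"
    unfolding sum.distrib[symmetric]
  proof (rule sum.cong)
    fix x
    have "f v x = w x + (\<Sum>t\<in>S. a' t * f t x)" by (simp add: w_def)
    then have "cnj (f v x) = cnj (w x) + (\<Sum>t\<in>S. cnj (a' t) * cnj (f t x))" by simp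
    then show "(c x - l * w x) * cnj (f v x) = (c x - l * w x) * cnj (w x)
        + (\<Sum>t\<in>S. cnj (a' t) * ((c x - l * w x) * cnj (f t x)))"
      by (simp add: distrib_left sum_distrib_left mult_ac)
  qed simp
  also have "(\<Sum>x\<in>X. \<Sum>t\<in>S. cnj (a' t) * ((c x - l * w x) * cnj (f t x)))
      = (\<Sum>t\<in>S. cnj (a' t) * (\<Sum>x\<in>X. (c x - l * w x) * cnj (f t x)))"
    unfolding sum_distrib_left by (rule sum.swap)
  finally have "(\<Sum>x\<in>X. (c x - l * w x) * cnj (f v x)) = 0" by (simp add: orth ww)
  then show ?case using orth unfolding cw[symmetric] by (intro exI[of _ e]) blast
qed simp

text \<open>Distinct positions filling all n slots form a permutation, extended by the identity
  beyond n to satisfy \<open>permutes\<close>.\<close>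

lemma sum_positions_permutations:
  "(\<Sum>ps\<in>positions n n. f ps) = (\<Sum>\<sigma> | \<sigma> permutes {..<n}. f (map \<sigma> [0..<n]))"
proof (rule sum.reindex_bij_witness[where i = "\<lambda>\<sigma>. map \<sigma> [0..<n]" and j = "\<lambda>ps k. if k < n then ps ! k else k"])
  fix ps assume ps: "ps \<in> positions n n"
  then have d: "distinct ps" "length ps = n" "set ps \<subseteq> {..<n}" by (auto simp: positions_def)
  let ?\<sigma> = "\<lambda>k. if k < n then ps ! k else k"
  show m: "map ?\<sigma> [0..<n] = ps" using d by (intro nth_equalityI) auto
  then show "f (map ?\<sigma> [0..<n]) = f ps" by simp
  have "set ps = {..<n}"
    using d by (intro card_subset_eq) (auto simp: distinct_card)
  then have "bij_betw ((!) ps) {..<n} {..<n}"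
    using d by (intro bij_betw_nth) auto
  then have "bij_betw ?\<sigma> {..<n} {..<n}"
    by (rule bij_betw_cong[THEN iffD1, rotated]) simp
  then show "?\<sigma> \<in> {\<sigma>. \<sigma> permutes {..<n}}"
    using bij_imp_permutes[of ?\<sigma> "{..<n}"] by simp
next
  fix \<sigma> assume "\<sigma> \<in> {\<sigma>. \<sigma> permutes {..<n}}"
  then have p: "\<sigma> permutes {..<n}" by simp
  show "(\<lambda>k. if k < n then map \<sigma> [0..<n] ! k else k) = \<sigma>"
    using permutes_not_in[OF p] by (auto simp: fun_eq_iff)
  show "map \<sigma> [0..<n] \<in> positions n n"
    using permutes_inj_on[OF p] permutes_less[OF p]
    by (auto simp: positions_def distinct_map)
qed

section \<open>Matrix units and orbit sums\<close>

definition mat_unit :: "nat \<Rightarrow> nat \<Rightarrow> nat \<Rightarrow> complex mat" where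
  "mat_unit d a b = mat d d (\<lambda>(i, j). if i = a \<and> j = b then 1 else 0)"

lemma mat_unit_carrier [simp]: "mat_unit d a b \<in> carrier_mat d d"
  by (simp add: mat_unit_def)

lemma tens_mat_units:
  assumes "I \<in> idx d n" "L \<in> idx d n" "J \<in> idx d n" "K \<in> idx d n"
  shows "(\<Prod>k<n. mat_unit d (J ! k) (K ! k) $$ (I ! k, L ! k)) = (if I = J \<and> L = K then 1 else 0)"
proof -
  have "(\<Prod>k<n. mat_unit d (J ! k) (K ! k) $$ (I ! k, L ! k))
      = (\<Prod>k<n. if I ! k = J ! k then 1 else 0) * (\<Prod>k<n. if L ! k = K ! k then 1 else (0::complex))"
    unfolding prod.distrib[symmetric]
    by (rule prod.cong) (use assms in \<open>auto simp: mat_unit_def idx_nth\<close>)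
  then show ?thesis using prod_delta_idx[OF assms(1,3)] prod_delta_idx[OF assms(2,4)] by simp
qed

text \<open>Reindexing each placement by its permutation moves \<sigma> from the factors to the
  indices I and L.\<close>

lemma sym_tens_mat_units:
  assumes I: "I \<in> idx d n" and L: "L \<in> idx d n" and J: "J \<in> idx d n" and K: "K \<in> idx d n"
  shows "sym_tens d n (map (\<lambda>k. mat_unit d (J ! k) (K ! k)) [0..<n]) I L
    = (\<Sum>\<sigma> | \<sigma> permutes {..<n}. if permute_idx n \<sigma> I = J \<and> permute_idx n \<sigma> L = K then 1 else 0)"
proof -
  let ?Ys = "map (\<lambda>k. mat_unit d (J ! k) (K ! k)) [0..<n]"
  have "tens (place d n (map \<sigma> [0..<n]) ?Ys) I L
      = (if permute_idx n \<sigma> I = J \<and> permute_idx n \<sigma> L = K then 1 else 0)"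
    if p: "\<sigma> permutes {..<n}" for \<sigma>
  proof -
    let ?M = "place d n (map \<sigma> [0..<n]) ?Ys"
    have "\<sigma> ` {0..<n} \<subseteq> {..<n}" using permutes_less[OF p] by auto
    then have M: "?M ! \<sigma> k = mat_unit d (J ! k) (K ! k)" if "k < n" for k
      using place_nth[of "map \<sigma> [0..<n]" n ?Ys k d] that permutes_inj_on[OF p] permutes_less[OF p]
      by (auto simp: distinct_map)
    have "tens ?M I L = (\<Prod>k<n. ?M ! \<sigma> k $$ (I ! \<sigma> k, L ! \<sigma> k))"
      using prod.permute[OF p, of "\<lambda>k. ?M ! k $$ (I ! k, L ! k)"] by (simp add: tens_def comp_def)
    also have "\<dots> = (\<Prod>k<n. mat_unit d (J ! k) (K ! k) $$ (permute_idx n \<sigma> I ! k, permute_idx n \<sigma> L ! k))"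
      by (rule prod.cong) (simp_all add: M permute_idx_def)
    finally show ?thesis
      using tens_mat_units[OF permute_idx_idx[OF p I] permute_idx_idx[OF p L] J K] by simp
  qed
  then show ?thesis by (simp add: sym_tens_def sum_positions_permutations)
qed

text \<open>This is the entry (I, L) of the commutator of C with the symmetrized matrix unit at (J,
  K). Each delta fixes the summation index as an inverse permutation of J or K.\<close>

lemma unitary_invariant_orbit_sums:
  assumes C: "unitary_invariant d n C"
    and I: "I \<in> idx d n" and L: "L \<in> idx d n" and J: "J \<in> idx d n" and K: "K \<in> idx d n"
  shows "(\<Sum>\<sigma> | \<sigma> permutes {..<n}. if permute_idx n \<sigma> L = K then C I (permute_idx n (Hilbert_Choice.inv \<sigma>) J) else 0)
    = (\<Sum>\<sigma> | \<sigma> permutes {..<n}. if permute_idx n \<sigma> I = J then C (permute_idx n (Hilbert_Choice.inv \<sigma>) K) L else 0)"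
    (is "?l = ?r")
proof -
  let ?S = "sym_tens d n (map (\<lambda>k. mat_unit d (J ! k) (K ! k)) [0..<n])"
  have "commutes d n C ?S"
    using C by (rule commutes_sym_tens) auto
  then have eq: "(\<Sum>H\<in>idx d n. C I H * ?S H L) = (\<Sum>H\<in>idx d n. ?S I H * C H L)"
    using I L by (simp add: commutes_def op_eq_def op_mult_def)
  have "(\<Sum>H\<in>idx d n. C I H * ?S H L)
      = (\<Sum>H\<in>idx d n. \<Sum>\<sigma> | \<sigma> permutes {..<n}.
          if H = permute_idx n (Hilbert_Choice.inv \<sigma>) J then (if permute_idx n \<sigma> L = K then C I H else 0) else 0)"
    by (rule sum.cong)
      (auto simp: sym_tens_mat_units[OF _ L J K] sum_distrib_left permute_idx_eq_iff[OF _ _ J] intro!: sum.cong)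
  also have "\<dots> = ?l"
    by (subst sum.swap, rule sum.cong) (use J in \<open>auto simp: permute_idx_idx permutes_inv\<close>)
  finally have l: "(\<Sum>H\<in>idx d n. C I H * ?S H L) = ?l" .
  have "(\<Sum>H\<in>idx d n. ?S I H * C H L)
      = (\<Sum>H\<in>idx d n. \<Sum>\<sigma> | \<sigma> permutes {..<n}.
          if H = permute_idx n (Hilbert_Choice.inv \<sigma>) K then (if permute_idx n \<sigma> I = J then C H L else 0) else 0)"
    by (rule sum.cong)
      (auto simp: sym_tens_mat_units[OF I _ J K] sum_distrib_right permute_idx_eq_iff[OF _ _ K] intro!: sum.cong)
  also have "\<dots> = ?r"
    by (subst sum.swap, rule sum.cong) (use K in \<open>auto simp: permute_idx_idx permutes_inv\<close>)
  finally show ?thesis using eq l by simp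
qed

text \<open>The double commutant argument. Summing the previous identity against the conjugate of C(K, L) kills its left-hand
  side by orthogonality and leaves the relation that the c(s)-weighted sum of the permutation operators s vanishes,
  where c(s) is the inner product of C with its translate by s. Pairing this
  with C times its adjoint gives that the sum of the squares |c(s)|^2 is 0, and c(id) is the squared norm of C.\<close>

lemma unitary_invariant_orthogonal_zero:
  assumes C: "unitary_invariant d n C"
    and orth: "\<And>\<sigma>. \<sigma> permutes {..<n} \<Longrightarrow> (\<Sum>L\<in>idx d n. C (permute_idx n \<sigma> L) L) = 0"
    and IJ: "I \<in> idx d n" "J \<in> idx d n"
  shows "C I J = 0"
proof -
  let ?X = "idx d n" and ?G = "{\<sigma>. \<sigma> permutes {..<n}}"
  let ?p = "permute_idx n"
  have fG: "finite ?G" by (rule finite_permutations) simp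
  define c where "c \<sigma> = (\<Sum>K\<in>?X. \<Sum>L\<in>?X. C K L * cnj (C (?p \<sigma> K) L))" for \<sigma>
  have rel: "(\<Sum>\<sigma>\<in>?G. if ?p \<sigma> I = J then c \<sigma> else 0) = 0" if I: "I \<in> ?X" and J: "J \<in> ?X" for I J
  proof -
    have "(\<Sum>K\<in>?X. \<Sum>L\<in>?X. \<Sum>\<sigma>\<in>?G. (if ?p \<sigma> L = K then C I (?p (Hilbert_Choice.inv \<sigma>) J) else 0) * cnj (C K L))
        = (\<Sum>K\<in>?X. \<Sum>L\<in>?X. \<Sum>\<sigma>\<in>?G. (if ?p \<sigma> I = J then C (?p (Hilbert_Choice.inv \<sigma>) K) L else 0) * cnj (C K L))"
      using unitary_invariant_orbit_sums[OF C I _ J] by (simp flip: sum_distrib_right)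
    moreover have "(\<Sum>K\<in>?X. \<Sum>L\<in>?X. \<Sum>\<sigma>\<in>?G. (if ?p \<sigma> L = K then C I (?p (Hilbert_Choice.inv \<sigma>) J) else 0) * cnj (C K L)) = 0"
    proof -
      have "(\<Sum>K\<in>?X. \<Sum>L\<in>?X. \<Sum>\<sigma>\<in>?G. (if ?p \<sigma> L = K then C I (?p (Hilbert_Choice.inv \<sigma>) J) else 0) * cnj (C K L))
          = (\<Sum>L\<in>?X. \<Sum>\<sigma>\<in>?G. \<Sum>K\<in>?X. if K = ?p \<sigma> L then C I (?p (Hilbert_Choice.inv \<sigma>) J) * cnj (C K L) else 0)"
        by (subst sum.swap, intro sum.cong refl, subst sum.swap, intro sum.cong refl) auto
      also have "\<dots> = (\<Sum>L\<in>?X. \<Sum>\<sigma>\<in>?G. C I (?p (Hilbert_Choice.inv \<sigma>) J) * cnj (C (?p \<sigma> L) L))"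
        by (intro sum.cong refl) (auto simp: permute_idx_idx)
      also have "\<dots> = (\<Sum>\<sigma>\<in>?G. C I (?p (Hilbert_Choice.inv \<sigma>) J) * cnj (\<Sum>L\<in>?X. C (?p \<sigma> L) L))"
        by (subst sum.swap) (simp add: sum_distrib_left)
      also have "\<dots> = 0" using orth by (intro sum.neutral) simp
      finally show ?thesis .
    qed
    moreover have "(\<Sum>K\<in>?X. \<Sum>L\<in>?X. \<Sum>\<sigma>\<in>?G. (if ?p \<sigma> I = J then C (?p (Hilbert_Choice.inv \<sigma>) K) L else 0) * cnj (C K L))
        = (\<Sum>\<sigma>\<in>?G. if ?p \<sigma> I = J then c \<sigma> else 0)"
    proof -
      have "(\<Sum>K\<in>?X. \<Sum>L\<in>?X. \<Sum>\<sigma>\<in>?G. (if ?p \<sigma> I = J then C (?p (Hilbert_Choice.inv \<sigma>) K) L else 0) * cnj (C K L))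
          = (\<Sum>K\<in>?X. \<Sum>\<sigma>\<in>?G. \<Sum>L\<in>?X. (if ?p \<sigma> I = J then C (?p (Hilbert_Choice.inv \<sigma>) K) L else 0) * cnj (C K L))"
        by (intro sum.cong refl sum.swap)
      also have "\<dots> = (\<Sum>\<sigma>\<in>?G. \<Sum>K\<in>?X. \<Sum>L\<in>?X. (if ?p \<sigma> I = J then C (?p (Hilbert_Choice.inv \<sigma>) K) L else 0) * cnj (C K L))"
        by (rule sum.swap)
      also have "\<dots> = (\<Sum>\<sigma>\<in>?G. if ?p \<sigma> I = J then c \<sigma> else 0)"
      proof (rule sum.cong)
        fix \<sigma> assume "\<sigma> \<in> ?G"
        then have p: "\<sigma> permutes {..<n}" by simp
        \<comment> \<open>Replacing K by its permuted index moves \<sigma> to the conjugated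
          factor.\<close>
        have "(\<Sum>K\<in>?X. \<Sum>L\<in>?X. C (?p (Hilbert_Choice.inv \<sigma>) K) L * cnj (C K L)) = c \<sigma>"
          unfolding c_def
          by (subst sum_permute_idx[OF p, symmetric]) (simp add: permute_idx_inv[OF p])
        then show "(\<Sum>K\<in>?X. \<Sum>L\<in>?X. (if ?p \<sigma> I = J then C (?p (Hilbert_Choice.inv \<sigma>) K) L else 0) * cnj (C K L))
            = (if ?p \<sigma> I = J then c \<sigma> else 0)" by simp
      qed simp
      finally show ?thesis .
    qed
    ultimately show ?thesis by simp
  qed
  \<comment> \<open>Summed over I, the values \<open>X I (?p \<sigma> I)\<close> give the conjugate
    of \<open>c \<sigma>\<close>, so the relations \<open>rel\<close> weighted by X add up to the
    sum of squared moduli.\<close>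
  define X where "X I J = (\<Sum>L\<in>?X. cnj (C I L) * C J L)" for I J
  have "(\<Sum>\<sigma>\<in>?G. c \<sigma> * cnj (c \<sigma>)) = (\<Sum>\<sigma>\<in>?G. \<Sum>I\<in>?X. c \<sigma> * X I (?p \<sigma> I))"
    by (simp add: c_def X_def sum_distrib_left)
  also have "\<dots> = (\<Sum>\<sigma>\<in>?G. \<Sum>I\<in>?X. \<Sum>J\<in>?X. if J = ?p \<sigma> I then c \<sigma> * X I J else 0)"
    by (intro sum.cong refl) (auto simp: permute_idx_idx)
  also have "\<dots> = (\<Sum>I\<in>?X. \<Sum>J\<in>?X. \<Sum>\<sigma>\<in>?G. if J = ?p \<sigma> I then c \<sigma> * X I J else 0)"
    by (subst sum.swap, intro sum.cong refl sum.swap)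
  also have "\<dots> = (\<Sum>I\<in>?X. \<Sum>J\<in>?X. (\<Sum>\<sigma>\<in>?G. if ?p \<sigma> I = J then c \<sigma> else 0) * X I J)"
    unfolding sum_distrib_right by (intro sum.cong refl) auto
  also have "\<dots> = 0" by (simp add: rel)
  finally have "(\<Sum>\<sigma>\<in>?G. c \<sigma> * cnj (c \<sigma>)) = 0" .
  then have "c id * cnj (c id) = 0"
    using sum_nonneg_c_eq_0[OF fG, of "\<lambda>\<sigma>. c \<sigma> * cnj (c \<sigma>)" id] by (simp add: permutes_id)
  then have "c id = 0" by simp
  moreover have "c id = (\<Sum>K\<in>?X. \<Sum>L\<in>?X. C K L * cnj (C K L))"
    unfolding c_def
  proof (intro sum.cong refl)
    fix K L assume "K \<in> ?X"
    then have "?p id K = K" by (auto simp: permute_idx_def idx_length intro: nth_equalityI)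
    then show "C K L * cnj (C (?p id K) L) = C K L * cnj (C K L)" by simp
  qed
  ultimately have *: "(\<Sum>K\<in>?X. \<Sum>L\<in>?X. C K L * cnj (C K L)) = 0" by simp
  have **: "(\<Sum>L\<in>?X. C I L * cnj (C I L)) = 0"
    by (rule sum_nonneg_c_eq_0[OF finite_idx _ *]) (use IJ in \<open>auto intro: nonneg_c_sum\<close>)
  have "C I J * cnj (C I J) = 0"
    by (rule sum_nonneg_c_eq_0[OF finite_idx _ **]) (use IJ in auto)
  then show ?thesis by simp
qed

text \<open>Subtracting from B its projection onto the span of the permutation operators leaves an
  invariant operator orthogonal to that span, hence 0.\<close>

theorem schur_weyl:
  assumes B: "unitary_invariant d n B"
  obtains \<alpha> where "op_eq d n B (That n \<alpha>)"
proof -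
  let ?X = "idx d n" and ?G = "{\<sigma>. \<sigma> permutes {..<n}}"
  have fG: "finite ?G" by (rule finite_permutations) simp
  obtain \<alpha> where \<alpha>: "\<forall>\<pi>\<in>?G. (\<Sum>x\<in>?X \<times> ?X. (case_prod B x - (\<Sum>\<sigma>\<in>?G. \<alpha> \<sigma> * case_prod (Tperm n \<sigma>) x))
      * cnj (case_prod (Tperm n \<pi>) x)) = 0"
    using orthogonal_decomposition[OF fG, of "?X \<times> ?X" "case_prod B" "\<lambda>\<sigma>. case_prod (Tperm n \<sigma>)"] by auto
  define C where "C = (\<lambda>I J. B I J - That n \<alpha> I J)"
  have inv: "unitary_invariant d n C"
    unfolding unitary_invariant_iff_commutes
  proof (intro allI impI)
    fix U assume "unitary_d d U"
    then have "commutes d n (tens (replicate n U)) B" "commutes d n (tens (replicate n U)) (That n \<alpha>)"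
      using B That_unitary_invariant[of d n \<alpha>]
      by (simp_all add: unitary_invariant_iff_commutes commutes_sym)
    then show "commutes d n C (tens (replicate n U))"
      unfolding C_def by (intro commutes_sym[OF commutes_diff])
  qed
  have orth: "(\<Sum>L\<in>?X. C (permute_idx n \<sigma> L) L) = 0" if p: "\<sigma> permutes {..<n}" for \<sigma>
  proof -
    \<comment> \<open>The inverse appears because column L of a permutation operator has its 1 in
      the row permuted by the inverse.\<close>
    let ?\<pi> = "Hilbert_Choice.inv \<sigma>"
    have pi: "?\<pi> permutes {..<n}" using p by (rule permutes_inv)
    have "0 = (\<Sum>x\<in>?X \<times> ?X. (case_prod B x - (\<Sum>\<sigma>\<in>?G. \<alpha> \<sigma> * case_prod (Tperm n \<sigma>) x))
      * cnj (case_prod (Tperm n ?\<pi>) x))" using \<alpha> pi by simp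
    also have "\<dots> = (\<Sum>I\<in>?X. \<Sum>L\<in>?X. C I L * cnj (Tperm n ?\<pi> I L))"
      unfolding sum.cartesian_product by (rule sum.cong) (auto simp: C_def That_def)
    also have "\<dots> = (\<Sum>L\<in>?X. \<Sum>I\<in>?X. C I L * cnj (Tperm n ?\<pi> I L))" by (rule sum.swap)
    also have "\<dots> = (\<Sum>L\<in>?X. \<Sum>I\<in>?X. if I = permute_idx n \<sigma> L then C I L else 0)"
      by (intro sum.cong refl) (simp add: Tperm_eq permutes_inv_inv[OF p])
    also have "\<dots> = (\<Sum>L\<in>?X. C (permute_idx n \<sigma> L) L)"
      using permute_idx_idx[OF p] by simp
    finally show ?thesis by simp
  qed
  have "C I J = 0" if "I \<in> ?X" "J \<in> ?X" for I J
    using unitary_invariant_orthogonal_zero[OF inv orth that] .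
  then have "op_eq d n B (That n \<alpha>)" by (simp add: op_eq_def C_def)
  then show ?thesis by (rule that)
qed

section \<open>Words and permutations\<close>

lemma word_eval_carrier:
  "(\<And>k. k \<in> set w \<Longrightarrow> Xs ! k \<in> carrier_mat d d) \<Longrightarrow> word_eval d Xs w \<in> carrier_mat d d"
  by (induction w) (auto simp: word_eval_def intro!: mult_carrier_mat[of _ d d])

lemma word_eval_Nil [simp]: "word_eval d Xs [] = 1\<^sub>m d"
  by (simp add: word_eval_def)

lemma word_eval_Cons [simp]: "word_eval d Xs (k # w) = Xs ! k * word_eval d Xs w"
  by (simp add: word_eval_def)

text \<open>\<open>word_eval\<close> unfolds from the left, while the cycle constructions attach and
  detach letters on the right.\<close>

lemma word_eval_snoc:
  "(\<And>m. m \<in> set (w @ [k]) \<Longrightarrow> Xs ! m \<in> carrier_mat d d)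
    \<Longrightarrow> word_eval d Xs (w @ [k]) = word_eval d Xs w * Xs ! k"
proof (induction w)
  case (Cons m w)
  then show ?case
    using assoc_mult_mat[of "Xs ! m" d d "word_eval d Xs w" d "Xs ! k" d] word_eval_carrier[of w Xs d]
    by simp
qed auto

lemma word_eval_snoc_entry:
  assumes "\<And>m. m \<in> set (w @ [k]) \<Longrightarrow> Xs ! m \<in> carrier_mat d d" "i < d" "j < d"
  shows "word_eval d Xs (w @ [k]) $$ (i, j) = (\<Sum>l<d. word_eval d Xs w $$ (i, l) * Xs ! k $$ (l, j))"
proof -
  have "word_eval d Xs (w @ [k]) = word_eval d Xs w * Xs ! k"
    using assms(1) by (rule word_eval_snoc)
  moreover have "word_eval d Xs w \<in> carrier_mat d d"
    by (rule word_eval_carrier) (use assms(1) in auto)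
  ultimately show ?thesis
    using assms by (simp add: index_mult_sum)
qed

text \<open>In the next definition the base point b carries the untraced tensor factor and A indexes the variables; the left-hand side is the
  (i, j) entry of the partial trace of the permutation operator of \<pi> times the variables.\<close>

definition word_rep ::
  "nat \<Rightarrow> nat \<Rightarrow> nat set \<Rightarrow> (nat \<Rightarrow> nat) \<Rightarrow> nat list \<Rightarrow> nat list list \<Rightarrow> bool" where
  "word_rep d b A \<pi> u ts \<longleftrightarrow> (\<forall>Xs. (\<forall>k\<in>A. Xs ! k \<in> carrier_mat d d) \<longrightarrow> (\<forall>i<d. \<forall>j<d.
     (\<Sum>f\<in>Pi\<^sub>E A (\<lambda>_. {..<d}). (\<Prod>k\<in>A. Xs ! k $$ ((f(b := i)) (\<pi> k), (f(b := i)) k))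
        * (if (f(b := i)) (\<pi> b) = j then 1 else 0))
     = word_eval d Xs u $$ (i, j) * prod_list (map (\<lambda>w. mtrace (word_eval d Xs w)) ts)))"

lemma word_repD:
  assumes "word_rep d b A \<pi> u ts" "\<And>k. k \<in> A \<Longrightarrow> Xs ! k \<in> carrier_mat d d" "i < d" "j < d"
  shows "(\<Sum>f\<in>Pi\<^sub>E A (\<lambda>_. {..<d}). (\<Prod>k\<in>A. Xs ! k $$ ((f(b := i)) (\<pi> k), (f(b := i)) k))
        * (if (f(b := i)) (\<pi> b) = j then 1 else 0))
     = word_eval d Xs u $$ (i, j) * prod_list (map (\<lambda>w. mtrace (word_eval d Xs w)) ts)"
  using assms unfolding word_rep_def by blast

lemma sum_PiE_insert:
  assumes "k \<notin> A"
  shows "(\<Sum>f\<in>Pi\<^sub>E (insert k A) (\<lambda>_. S). F f) = (\<Sum>x\<in>S. \<Sum>f\<in>Pi\<^sub>E A (\<lambda>_. S). F (f(k := x)))"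
proof -
  have "(\<Sum>f\<in>Pi\<^sub>E (insert k A) (\<lambda>_. S). F f) = (\<Sum>(x, f)\<in>S \<times> Pi\<^sub>E A (\<lambda>_. S). F (f(k := x)))"
    unfolding PiE_insert_eq
    by (subst sum.reindex[OF inj_combinator[OF assms]]) (simp add: case_prod_beta comp_def)
  then show ?thesis by (simp add: sum.cartesian_product)
qed

lemma word_rep_empty: "word_rep d b {} id [] []"
  by (simp add: word_rep_def)

text \<open>The delta at the open end of the chain is contracted with a function Y of the end index.
  A column of a further matrix as Y appends that letter; a column index equal to the starting index
  prepares a trace.\<close>

lemma sum_word_rep_mult:
  assumes "word_rep d b A \<pi> u ts" "finite A" "\<pi> permutes insert b A"
    and Xs: "\<And>m. m \<in> A \<Longrightarrow> Xs ! m \<in> carrier_mat d d" and "i < d"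
  shows "(\<Sum>f\<in>Pi\<^sub>E A (\<lambda>_. {..<d}). (\<Prod>m\<in>A. Xs ! m $$ ((f(b := i)) (\<pi> m), (f(b := i)) m))
        * Y ((f(b := i)) (\<pi> b)))
    = (\<Sum>l<d. word_eval d Xs u $$ (i, l) * Y l) * prod_list (map (\<lambda>w. mtrace (word_eval d Xs w)) ts)"
proof -
  let ?P = "\<lambda>f. \<Prod>m\<in>A. Xs ! m $$ ((f(b := i)) (\<pi> m), (f(b := i)) m)"
  have "(\<Sum>f\<in>Pi\<^sub>E A (\<lambda>_. {..<d}). ?P f * Y ((f(b := i)) (\<pi> b)))
      = (\<Sum>f\<in>Pi\<^sub>E A (\<lambda>_. {..<d}). \<Sum>l<d. ?P f * (if (f(b := i)) (\<pi> b) = l then 1 else 0) * Y l)"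
  proof (rule sum.cong)
    fix f assume "f \<in> Pi\<^sub>E A (\<lambda>_. {..<d})"
    moreover have "\<pi> b \<in> insert b A" using permutes_in_image[OF assms(3), of b] by simp
    ultimately have l: "(f(b := i)) (\<pi> b) < d" using \<open>i < d\<close> by auto
    have "(\<Sum>l<d. ?P f * (if (f(b := i)) (\<pi> b) = l then 1 else 0) * Y l)
        = (\<Sum>l<d. if l = (f(b := i)) (\<pi> b) then ?P f * Y l else 0)"
      by (rule sum.cong) auto
    then show "?P f * Y ((f(b := i)) (\<pi> b)) = (\<Sum>l<d. ?P f * (if (f(b := i)) (\<pi> b) = l then 1 else 0) * Y l)"
      using l by simp
  qed simp
  also have "\<dots> = (\<Sum>l<d. (\<Sum>f\<in>Pi\<^sub>E A (\<lambda>_. {..<d}). ?P f * (if (f(b := i)) (\<pi> b) = l then 1 else 0)) * Y l)"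
    unfolding sum_distrib_right by (rule sum.swap)
  also have "\<dots> = (\<Sum>l<d. word_eval d Xs u $$ (i, l) * prod_list (map (\<lambda>w. mtrace (word_eval d Xs w)) ts) * Y l)"
    by (rule sum.cong) (simp_all only: word_repD[OF assms(1) Xs \<open>i < d\<close>] lessThan_iff)
  finally show ?thesis unfolding sum_distrib_right by (simp only: mult_ac)
qed

text \<open>Composing with the transposition inserts k between b and \<pi> b. The word reads the
  cycle of b against \<pi>, from the preimage of b to its image, so k becomes the last
  letter.\<close>

lemma word_rep_snoc:
  assumes rep: "word_rep d b A \<pi> u ts" and fin: "finite A" and p: "\<pi> permutes insert b A"
    and k: "k \<notin> insert b A" and b: "b \<notin> A" and u: "set u \<subseteq> A"
  shows "word_rep d b (insert k A) (\<pi> \<circ> transpose b k) (u @ [k]) ts"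
  unfolding word_rep_def
proof (intro allI impI)
  fix Xs :: "complex mat list" and i j assume Xs: "\<forall>m\<in>insert k A. Xs ! m \<in> carrier_mat d d" and ij: "i < d" "j < d"
  let ?\<pi> = "\<pi> \<circ> transpose b k"
  have pk: "\<pi> k = k" using permutes_not_in[OF p k] .
  have piA: "\<pi> m \<noteq> k" if "m \<in> insert b A" for m
    using permutes_in_image[OF p, of m] that k by auto
  have bk: "?\<pi> b = k" "?\<pi> k = \<pi> b" using pk by simp_all
  have t: "(\<Prod>m\<in>insert k A. Xs ! m $$ (((f(k := x))(b := i)) (?\<pi> m), ((f(k := x))(b := i)) m))
      * (if ((f(k := x))(b := i)) (?\<pi> b) = j then 1 else 0)
      = (if x = j then (\<Prod>m\<in>A. Xs ! m $$ ((f(b := i)) (\<pi> m), (f(b := i)) m)) * Xs ! k $$ ((f(b := i)) (\<pi> b), j) else 0)"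
    for f x
  proof -
    have "(\<Prod>m\<in>A. Xs ! m $$ (((f(k := x))(b := i)) (?\<pi> m), ((f(k := x))(b := i)) m))
        = (\<Prod>m\<in>A. Xs ! m $$ ((f(b := i)) (\<pi> m), (f(b := i)) m))"
    proof (rule prod.cong)
      fix m assume m: "m \<in> A"
      show "Xs ! m $$ (((f(k := x))(b := i)) (?\<pi> m), ((f(k := x))(b := i)) m)
          = Xs ! m $$ ((f(b := i)) (\<pi> m), (f(b := i)) m)"
      proof -
        have "?\<pi> m = \<pi> m" "m \<noteq> k" "m \<noteq> b" using k b m by (auto simp: transpose_def)
        then show ?thesis using piA[of m] m by simp
      qed
    qed simp
    moreover have "k \<noteq> b" using k by auto
    ultimately show ?thesis
      using fin k piA[of b] by (simp add: bk mult.commute del: comp_apply)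
  qed
  have "k \<notin> A" using k by simp
  then have "(\<Sum>f\<in>Pi\<^sub>E (insert k A) (\<lambda>_. {..<d}).
        (\<Prod>m\<in>insert k A. Xs ! m $$ ((f(b := i)) (?\<pi> m), (f(b := i)) m)) * (if (f(b := i)) (?\<pi> b) = j then 1 else 0))
      = (\<Sum>x<d. if x = j then
          (\<Sum>f\<in>Pi\<^sub>E A (\<lambda>_. {..<d}). (\<Prod>m\<in>A. Xs ! m $$ ((f(b := i)) (\<pi> m), (f(b := i)) m)) * Xs ! k $$ ((f(b := i)) (\<pi> b), j)) else 0)"
    by (subst sum_PiE_insert, assumption, unfold t) (intro sum.cong refl, simp only: sum.neutral_const split: if_split, simp)
  also have "\<dots> = (\<Sum>f\<in>Pi\<^sub>E A (\<lambda>_. {..<d}). (\<Prod>m\<in>A. Xs ! m $$ ((f(b := i)) (\<pi> m), (f(b := i)) m)) * Xs ! k $$ ((f(b := i)) (\<pi> b), j))"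
    using ij by simp
  also have "\<dots> = (\<Sum>l<d. word_eval d Xs u $$ (i, l) * Xs ! k $$ (l, j)) * prod_list (map (\<lambda>w. mtrace (word_eval d Xs w)) ts)"
    by (rule sum_word_rep_mult[OF rep fin p _ ij(1)]) (use Xs in auto)
  also have "(\<Sum>l<d. word_eval d Xs u $$ (i, l) * Xs ! k $$ (l, j)) = word_eval d Xs (u @ [k]) $$ (i, j)"
    by (rule word_eval_snoc_entry[symmetric]) (use ij Xs u in auto)
  finally show "(\<Sum>f\<in>Pi\<^sub>E (insert k A) (\<lambda>_. {..<d}).
        (\<Prod>m\<in>insert k A. Xs ! m $$ ((f(b := i)) (?\<pi> m), (f(b := i)) m)) * (if (f(b := i)) (?\<pi> b) = j then 1 else 0))
      = word_eval d Xs (u @ [k]) $$ (i, j) * prod_list (map (\<lambda>w. mtrace (word_eval d Xs w)) ts)" .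
qed

text \<open>A fresh fixed point b takes over as base point and contributes the identity matrix. The
  index of the former base point k becomes a summation variable, which closes its chain into a
  trace.\<close>

lemma word_rep_close:
  assumes rep: "word_rep d k A \<pi> w ts" and fin: "finite A" and p: "\<pi> permutes insert k A"
    and k: "k \<notin> A" and b: "b \<notin> insert k A" and w: "set w \<subseteq> A"
  shows "word_rep d b (insert k A) \<pi> [] ((w @ [k]) # ts)"
  unfolding word_rep_def
proof (intro allI impI)
  fix Xs :: "complex mat list" and i j assume Xs: "\<forall>m\<in>insert k A. Xs ! m \<in> carrier_mat d d" and ij: "i < d" "j < d"
  have pb: "\<pi> b = b" using permutes_not_in[OF p b] .
  have piA: "\<pi> m \<noteq> b" if "m \<in> insert k A" for m
    using permutes_in_image[OF p, of m] that b by auto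
  have Xs': "\<And>m. m \<in> set (w @ [k]) \<Longrightarrow> Xs ! m \<in> carrier_mat d d" using Xs w by auto
  let ?T = "prod_list (map (\<lambda>w. mtrace (word_eval d Xs w)) ts)"
  have "(\<Prod>m\<in>insert k A. Xs ! m $$ (((f(k := x))(b := i)) (\<pi> m), ((f(k := x))(b := i)) m))
      * (if ((f(k := x))(b := i)) (\<pi> b) = j then 1 else 0)
      = (\<Prod>m\<in>A. Xs ! m $$ ((f(k := x)) (\<pi> m), (f(k := x)) m)) * Xs ! k $$ ((f(k := x)) (\<pi> k), x)
        * 1\<^sub>m d $$ (i, j)"
    for f x
  proof -
    have "(\<Prod>m\<in>insert k A. Xs ! m $$ (((f(k := x))(b := i)) (\<pi> m), ((f(k := x))(b := i)) m))
        = (\<Prod>m\<in>insert k A. Xs ! m $$ ((f(k := x)) (\<pi> m), (f(k := x)) m))"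
    proof (rule prod.cong)
      fix m assume m: "m \<in> insert k A"
      then have "m \<noteq> b" using b by auto
      then show "Xs ! m $$ (((f(k := x))(b := i)) (\<pi> m), ((f(k := x))(b := i)) m)
          = Xs ! m $$ ((f(k := x)) (\<pi> m), (f(k := x)) m)" using piA[OF m] by simp
    qed simp
    then show ?thesis using fin k pb ij by (simp add: mult.commute)
  qed
  then have "(\<Sum>f\<in>Pi\<^sub>E (insert k A) (\<lambda>_. {..<d}).
        (\<Prod>m\<in>insert k A. Xs ! m $$ ((f(b := i)) (\<pi> m), (f(b := i)) m)) * (if (f(b := i)) (\<pi> b) = j then 1 else 0))
      = (\<Sum>x<d. (\<Sum>f\<in>Pi\<^sub>E A (\<lambda>_. {..<d}). (\<Prod>m\<in>A. Xs ! m $$ ((f(k := x)) (\<pi> m), (f(k := x)) m))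
          * Xs ! k $$ ((f(k := x)) (\<pi> k), x))) * 1\<^sub>m d $$ (i, j)"
    using k by (subst sum_PiE_insert) (simp_all only: sum_distrib_right not_False_eq_True)
  also have "(\<Sum>x<d. (\<Sum>f\<in>Pi\<^sub>E A (\<lambda>_. {..<d}). (\<Prod>m\<in>A. Xs ! m $$ ((f(k := x)) (\<pi> m), (f(k := x)) m))
          * Xs ! k $$ ((f(k := x)) (\<pi> k), x)))
      = (\<Sum>x<d. (\<Sum>l<d. word_eval d Xs w $$ (x, l) * Xs ! k $$ (l, x)) * ?T)"
    by (intro sum.cong refl sum_word_rep_mult[OF rep fin p]) (use Xs in auto)
  also have "\<dots> = (\<Sum>x<d. word_eval d Xs (w @ [k]) $$ (x, x) * ?T)"
  proof (rule sum.cong)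
    fix x assume "x \<in> {..<d}"
    then show "(\<Sum>l<d. word_eval d Xs w $$ (x, l) * Xs ! k $$ (l, x)) * ?T = word_eval d Xs (w @ [k]) $$ (x, x) * ?T"
      using word_eval_snoc_entry[of w k Xs d x x, OF Xs'] by simp
  qed simp
  also have "\<dots> = mtrace (word_eval d Xs (w @ [k])) * ?T"
    using mtrace_carrier[OF word_eval_carrier[of "w @ [k]", OF Xs']] by (simp only: sum_distrib_right)
  finally show "(\<Sum>f\<in>Pi\<^sub>E (insert k A) (\<lambda>_. {..<d}).
        (\<Prod>m\<in>insert k A. Xs ! m $$ ((f(b := i)) (\<pi> m), (f(b := i)) m)) * (if (f(b := i)) (\<pi> b) = j then 1 else 0))
      = word_eval d Xs [] $$ (i, j) * prod_list (map (\<lambda>w. mtrace (word_eval d Xs w)) ((w @ [k]) # ts))"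
    by (simp add: mult_ac)
qed

text \<open>Letters are removed from the right of u; once u is empty, the last letter of the first
  traced word becomes the base point of a shorter problem. An empty traced word offers no such
  letter.\<close>

lemma words_to_permutation:
  assumes "distinct (u @ concat ts)" "b \<notin> set (u @ concat ts)" "[] \<notin> set ts"
  shows "\<exists>\<pi>. \<pi> permutes insert b (set (u @ concat ts)) \<and> word_rep d b (set (u @ concat ts)) \<pi> u ts"
  using assms
proof (induction "length (u @ concat ts)" arbitrary: u ts b rule: less_induct)
  case less
  show ?case
  proof (cases u rule: rev_cases)
    case (snoc u' k)
    let ?A = "set (u' @ concat ts)"
    obtain \<pi> where p: "\<pi> permutes insert b ?A" and rep: "word_rep d b ?A \<pi> u' ts"
      using less.hyps[of u' ts b] less.prems snoc by auto
    have A: "set (u @ concat ts) = insert k ?A" using snoc by auto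
    have k: "k \<notin> insert b ?A" using less.prems snoc by auto
    have "word_rep d b (insert k ?A) (\<pi> \<circ> transpose b k) (u' @ [k]) ts"
      by (rule word_rep_snoc[OF rep _ p k]) (use less.prems snoc in auto)
    moreover have "\<pi> \<circ> transpose b k permutes insert b (insert k ?A)"
      by (intro permutes_compose permutes_swap_id permutes_subset[OF p]) auto
    ultimately show ?thesis unfolding A using snoc by blast
  next
    case Nil
    show ?thesis
    proof (cases ts)
      case ts: (Cons w ts')
      then have "w \<noteq> []" using less.prems by auto
      then obtain w' k where w: "w = w' @ [k]" by (metis rev_exhaust)
      let ?A = "set (w' @ concat ts')"
      obtain \<pi> where p: "\<pi> permutes insert k ?A" and rep: "word_rep d k ?A \<pi> w' ts'"
        using less.hyps[of w' ts' k] less.prems Nil ts w by auto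
      have A: "set (u @ concat ts) = insert k ?A" using Nil ts w by auto
      have "word_rep d b (insert k ?A) \<pi> [] ((w' @ [k]) # ts')"
        by (rule word_rep_close[OF rep _ p]) (use less.prems Nil ts w in auto)
      moreover have "\<pi> permutes insert b (insert k ?A)"
        by (rule permutes_subset[OF p]) auto
      ultimately show ?thesis unfolding A using Nil ts w by blast
    qed (use Nil word_rep_empty permutes_id in auto)
  qed
qed

text \<open>The same two moves backwards. If \<pi> moves b, its image is cut out of the cycle by a
  transposition; if \<pi> fixes b, any element of A serves as base point of a smaller
  instance.\<close>

lemma permutation_to_words:
  assumes "finite A" "b \<notin> A" "\<pi> permutes insert b A"
  shows "\<exists>u ts. distinct (u @ concat ts) \<and> set (u @ concat ts) = A \<and> word_rep d b A \<pi> u ts"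
  using assms
proof (induction "card A" arbitrary: A b \<pi> rule: less_induct)
  case less
  show ?case
  proof (cases "\<pi> b = b")
    case False
    define k where "k = \<pi> b"
    define \<pi>' where "\<pi>' = \<pi> \<circ> transpose b k"
    let ?A = "A - {k}"
    have k: "k \<in> A" using permutes_in_image[OF less.prems(3), of b] False by (auto simp: k_def)
    have "\<pi>' permutes insert b A"
      unfolding \<pi>'_def using k by (intro permutes_compose permutes_swap_id less.prems) auto
    then have p: "\<pi>' permutes insert b ?A"
      by (rule permutes_superset) (auto simp: \<pi>'_def k_def)
    have "card ?A < card A" using k less.prems(1) by (rule card_Diff1_less[rotated])
    then obtain u ts where uts: "distinct (u @ concat ts)" "set (u @ concat ts) = ?A" "word_rep d b ?A \<pi>' u ts"
      using less.hyps[of ?A b \<pi>'] p less.prems by auto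
    have "word_rep d b (insert k ?A) (\<pi>' \<circ> transpose b k) (u @ [k]) ts"
      by (rule word_rep_snoc[OF uts(3) _ p]) (use uts less.prems k in auto)
    moreover have "\<pi>' \<circ> transpose b k = \<pi>" by (simp add: \<pi>'_def comp_assoc)
    moreover have "insert k ?A = A" using k by auto
    ultimately have "word_rep d b A \<pi> (u @ [k]) ts" by simp
    moreover have "distinct ((u @ [k]) @ concat ts)" "set ((u @ [k]) @ concat ts) = A"
      using uts k by auto
    ultimately show ?thesis by blast
  next
    case True
    show ?thesis
    proof (cases "A = {}")
      case A: True
      then have "\<pi> = id" using less.prems(3) by (auto simp: permutes_sing)
      then show ?thesis using A word_rep_empty by (intro exI[of _ "[]"]) auto
    next
      case False
      then obtain k where k: "k \<in> A" by auto
      let ?A = "A - {k}"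
      have Ak: "insert k ?A = A" using k by auto
      have "\<pi> permutes A"
        by (rule permutes_superset[OF less.prems(3)]) (use True in auto)
      then have p: "\<pi> permutes insert k ?A" unfolding Ak .
      have "card ?A < card A" using k less.prems(1) by (rule card_Diff1_less[rotated])
      then obtain w ts where wts: "distinct (w @ concat ts)" "set (w @ concat ts) = ?A" "word_rep d k ?A \<pi> w ts"
        using less.hyps[of ?A k \<pi>] p less.prems by auto
      have "word_rep d b (insert k ?A) \<pi> [] ((w @ [k]) # ts)"
        by (rule word_rep_close[OF wts(3) _ p]) (use wts less.prems k in auto)
      then have "word_rep d b A \<pi> [] ((w @ [k]) # ts)" by (simp only: Ak)
      moreover have "distinct ([] @ concat ((w @ [k]) # ts))" "set ([] @ concat ((w @ [k]) # ts)) = A"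
        using wts k by auto
      ultimately show ?thesis by blast
    qed
  qed
qed

section \<open>Trace polynomials and permutation operators\<close>

text \<open>For each K at most one L contributes, and the multi-indices K turn into the functions f
  of \<open>word_rep\<close>.\<close>

lemma fB_Tperm:
  assumes p: "\<pi> permutes {..<Suc r}" and rep: "word_rep d r {..<r} \<pi> u ts"
    and X: "valid_args d r Xs" and ij: "i < d" "j < d"
  shows "fB d r (Tperm (Suc r) \<pi>) Xs $$ (i, j)
    = word_eval d Xs u $$ (i, j) * prod_list (map (\<lambda>w. mtrace (word_eval d Xs w)) ts)"
proof -
  have len: "length Xs = r" and Xc: "\<And>k. k < r \<Longrightarrow> Xs ! k \<in> carrier_mat d d"
    using X by (auto simp: valid_args_def)
  have "(\<Sum>L\<in>idx d r. Tperm (Suc r) \<pi> (K @ [i]) (L @ [j]) * tens Xs L K)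
      = (\<Prod>m<r. Xs ! m $$ ((K @ [i]) ! \<pi> m, K ! m)) * (if (K @ [i]) ! \<pi> r = j then 1 else 0)"
    if K: "K \<in> idx d r" for K
  proof -
    let ?I = "K @ [i]"
    have I: "?I \<in> idx d (Suc r)" using K ij by (intro idx_append1)
    define P where "P = map (\<lambda>m. ?I ! \<pi> m) [0..<r]"
    have Pi: "?I ! \<pi> m < d" if "m < Suc r" for m
      using idx_nth[OF I permutes_less[OF p that]] .
    then have P: "P \<in> idx d r" unfolding P_def by (intro map_idx) simp
    have "Tperm (Suc r) \<pi> ?I (L @ [j]) = (if L = P then (if ?I ! \<pi> r = j then 1 else 0) else 0)"
      if L: "L \<in> idx d r" for L
    proof -
      have "?I = permute_idx (Suc r) (Hilbert_Choice.inv \<pi>) (L @ [j]) \<longleftrightarrow> permute_idx (Suc r) \<pi> ?I = L @ [j]"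
        using permute_idx_eq_iff[OF p I, of "L @ [j]"] L ij by (simp add: idx_append1)
      also have "permute_idx (Suc r) \<pi> ?I = P @ [?I ! \<pi> r]"
        by (simp add: permute_idx_def P_def)
      finally show ?thesis using Tperm_eq[OF I] by auto
    qed
    then have "(\<Sum>L\<in>idx d r. Tperm (Suc r) \<pi> ?I (L @ [j]) * tens Xs L K)
        = (\<Sum>L\<in>idx d r. if L = P then (if ?I ! \<pi> r = j then 1 else 0) * tens Xs L K else 0)"
      by (intro sum.cong) auto
    also have "\<dots> = (if ?I ! \<pi> r = j then 1 else 0) * tens Xs P K" using P by simp
    finally show ?thesis by (simp add: tens_def len P_def)
  qed
  then have "fB d r (Tperm (Suc r) \<pi>) Xs $$ (i, j)
      = (\<Sum>K\<in>idx d r. (\<Prod>m<r. Xs ! m $$ ((K @ [i]) ! \<pi> m, K ! m)) * (if (K @ [i]) ! \<pi> r = j then 1 else 0))"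
    by (simp add: fB_entry[OF X ij])
  also have "\<dots> = (\<Sum>f\<in>Pi\<^sub>E {..<r} (\<lambda>_. {..<d}). (\<Prod>m<r. Xs ! m $$ ((f(r := i)) (\<pi> m), (f(r := i)) m))
        * (if (f(r := i)) (\<pi> r) = j then 1 else 0))"
  proof (rule sum.reindex_bij_witness[where i = "\<lambda>f. map f [0..<r]" and j = "\<lambda>K. restrict ((!) K) {..<r}"])
    fix K assume K: "K \<in> idx d r"
    then have lK: "length K = r" by (rule idx_length)
    show "map (restrict ((!) K) {..<r}) [0..<r] = K" using lK by (intro nth_equalityI) auto
    show "restrict ((!) K) {..<r} \<in> Pi\<^sub>E {..<r} (\<lambda>_. {..<d})" using idx_nth[OF K] by auto
    \<comment> \<open>Overwriting the value at r by i matches appending i to K, so the open index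
      behaves as the value at the base point.\<close>
    have ext: "((restrict ((!) K) {..<r})(r := i)) m = (K @ [i]) ! m" if "m < Suc r" for m
      using that lK by (auto simp: nth_append less_Suc_eq)
    have "(\<Prod>m<r. Xs ! m $$ (((restrict ((!) K) {..<r})(r := i)) (\<pi> m), ((restrict ((!) K) {..<r})(r := i)) m))
        = (\<Prod>m<r. Xs ! m $$ ((K @ [i]) ! \<pi> m, K ! m))"
    proof (rule prod.cong)
      fix m assume "m \<in> {..<r}"
      then have m: "m < Suc r" "m < r" by simp_all
      show "Xs ! m $$ (((restrict ((!) K) {..<r})(r := i)) (\<pi> m), ((restrict ((!) K) {..<r})(r := i)) m)
          = Xs ! m $$ ((K @ [i]) ! \<pi> m, K ! m)"
        unfolding ext[OF m(1)] ext[OF permutes_less[OF p m(1)]] using m lK by (simp add: nth_append)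
    qed simp
    then show "(\<Prod>m<r. Xs ! m $$ (((restrict ((!) K) {..<r})(r := i)) (\<pi> m), ((restrict ((!) K) {..<r})(r := i)) m))
        * (if ((restrict ((!) K) {..<r})(r := i)) (\<pi> r) = j then 1 else 0)
        = (\<Prod>m<r. Xs ! m $$ ((K @ [i]) ! \<pi> m, K ! m)) * (if (K @ [i]) ! \<pi> r = j then 1 else 0)"
      using ext[OF permutes_less[OF p, of r]] by (simp only: lessI)
  next
    fix f assume f: "f \<in> Pi\<^sub>E {..<r} (\<lambda>_. {..<d})"
    show "restrict ((!) (map f [0..<r])) {..<r} = f"
      using f by (auto simp: fun_eq_iff restrict_def PiE_def extensional_def)
    show "map f [0..<r] \<in> idx d r" using f by (intro map_idx) auto
  qed
  also have "\<dots> = word_eval d Xs u $$ (i, j) * prod_list (map (\<lambda>w. mtrace (word_eval d Xs w)) ts)"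
    by (rule word_repD[OF rep _ ij]) (use Xc in auto)
  finally show ?thesis .
qed

lemma fB_That:
  assumes "valid_args d r Xs" "i < d" "j < d"
  shows "fB d r (That (Suc r) \<alpha>) Xs $$ (i, j)
    = (\<Sum>\<pi> | \<pi> permutes {..<Suc r}. \<alpha> \<pi> * fB d r (Tperm (Suc r) \<pi>) Xs $$ (i, j))"
proof -
  let ?G = "{\<pi>. \<pi> permutes {..<Suc r}}"
  have "fB d r (That (Suc r) \<alpha>) Xs $$ (i, j)
      = (\<Sum>K\<in>idx d r. \<Sum>L\<in>idx d r. \<Sum>\<pi>\<in>?G. \<alpha> \<pi> * (Tperm (Suc r) \<pi> (K @ [i]) (L @ [j]) * tens Xs L K))"
    by (simp add: fB_entry[OF assms] That_def sum_distrib_right mult.assoc)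
  also have "\<dots> = (\<Sum>K\<in>idx d r. \<Sum>\<pi>\<in>?G. \<Sum>L\<in>idx d r. \<alpha> \<pi> * (Tperm (Suc r) \<pi> (K @ [i]) (L @ [j]) * tens Xs L K))"
    by (intro sum.cong refl sum.swap)
  also have "\<dots> = (\<Sum>\<pi>\<in>?G. \<Sum>K\<in>idx d r. \<Sum>L\<in>idx d r. \<alpha> \<pi> * (Tperm (Suc r) \<pi> (K @ [i]) (L @ [j]) * tens Xs L K))"
    by (rule sum.swap)
  finally show ?thesis by (simp add: fB_entry[OF assms] sum_distrib_left)
qed

section \<open>Evaluation of trace polynomials term by term\<close>

lemma tp_eval_Nil [simp]: "tp_eval d Xs [] = 0\<^sub>m d d"
  by (simp add: tp_eval_def)

lemma tp_eval_Cons [simp]: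
  "tp_eval d Xs ((c, u, ts) # p)
    = (c * prod_list (map (\<lambda>w. mtrace (word_eval d Xs w)) ts)) \<cdot>\<^sub>m word_eval d Xs u + tp_eval d Xs p"
  by (simp add: tp_eval_def)

lemma tp_multilinear_Cons:
  "tp_multilinear r ((c, u, ts) # p) \<longleftrightarrow> mset (u @ concat ts) = mset [0..<r] \<and> tp_multilinear r p"
  by (auto simp: tp_multilinear_def)

lemma multilinear_term:
  assumes "mset (u @ concat ts) = mset [0..<r]"
  shows "distinct (u @ concat ts)" "set (u @ concat ts) = {..<r}"
  using mset_eq_imp_distinct_iff[OF assms] mset_eq_setD[OF assms] by (auto simp: atLeast0LessThan)

lemma valid_word_eval_carrier:
  assumes "valid_args d r Xs" "set w \<subseteq> {..<r}"
  shows "word_eval d Xs w \<in> carrier_mat d d"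
  by (rule word_eval_carrier) (use assms in \<open>auto simp: valid_args_def\<close>)

lemma tp_eval_carrier: "valid_args d r Xs \<Longrightarrow> tp_eval d Xs p \<in> carrier_mat d d" if "tp_multilinear r p"
  using that
proof (induction p)
  case (Cons t p)
  obtain c u ts where t: "t = (c, u, ts)" by (cases t)
  have "set u \<subseteq> {..<r}" using Cons.prems multilinear_term[of u ts r] by (auto simp: t tp_multilinear_Cons)
  then show ?case using Cons valid_word_eval_carrier by (simp add: t tp_multilinear_Cons)
qed simp

lemma tp_eval_entry:
  assumes "valid_args d r Xs" "tp_multilinear r p" "i < d" "j < d"
  shows "tp_eval d Xs p $$ (i, j)
    = (\<Sum>(c, u, ts)\<leftarrow>p. c * (word_eval d Xs u $$ (i, j) * prod_list (map (\<lambda>w. mtrace (word_eval d Xs w)) ts)))"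
  using assms(2)
proof (induction p)
  case (Cons t p)
  obtain c u ts where t: "t = (c, u, ts)" by (cases t)
  have "set u \<subseteq> {..<r}" using Cons.prems multilinear_term[of u ts r] by (auto simp: t tp_multilinear_Cons)
  then have "word_eval d Xs u \<in> carrier_mat d d" by (rule valid_word_eval_carrier[OF assms(1)])
  moreover have "tp_multilinear r p" using Cons.prems by (simp add: t tp_multilinear_Cons)
  ultimately show ?case
    using Cons.IH tp_eval_carrier[OF _ assms(1), of p] assms(3,4) by (simp add: t mult_ac)
qed (use assms in simp)

lemma mtrace_one: "mtrace (1\<^sub>m d) = of_nat d"
  by (simp add: mtrace_def)

lemma prod_list_filter_Nil:
  "prod_list (map (\<lambda>w. mtrace (word_eval d Xs w)) ts)
    = of_nat d ^ length (filter (\<lambda>w. w = []) ts)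
      * prod_list (map (\<lambda>w. mtrace (word_eval d Xs w)) (filter (\<lambda>w. w \<noteq> []) ts))"
  by (induction ts) (simp_all add: mtrace_one mult_ac)

text \<open>An empty traced word stands for the scalar d and is moved into the coefficient before the cycles are read off.\<close>

lemma term_to_permutation:
  assumes "mset (u @ concat ts) = mset [0..<r]"
  obtains \<pi> m where "\<pi> permutes {..<Suc r}"
    "\<And>Xs i j. valid_args d r Xs \<Longrightarrow> i < d \<Longrightarrow> j < d \<Longrightarrow>
      word_eval d Xs u $$ (i, j) * prod_list (map (\<lambda>w. mtrace (word_eval d Xs w)) ts)
      = of_nat d ^ m * fB d r (Tperm (Suc r) \<pi>) Xs $$ (i, j)"
proof -
  let ?ts = "filter (\<lambda>w. w \<noteq> []) ts"
  have c: "concat ?ts = concat ts" by (induction ts) auto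
  have dist: "distinct (u @ concat ?ts)" and s: "set (u @ concat ?ts) = {..<r}"
    using multilinear_term[OF assms] by (simp_all only: c)
  obtain \<pi> where "\<pi> permutes insert r {..<r}" and rep: "word_rep d r {..<r} \<pi> u ?ts"
    using words_to_permutation[of u ?ts r d] dist unfolding s by auto
  then have p: "\<pi> permutes {..<Suc r}" by (simp add: lessThan_Suc)
  show ?thesis
    by (rule that[OF p, of "length (filter (\<lambda>w. w = []) ts)"])
      (simp add: fB_Tperm[OF p rep] prod_list_filter_Nil[of d _ ts])
qed

lemma trace_polynomial_eq_That:
  assumes "tp_multilinear r p"
  obtains \<alpha> where "\<And>Xs. valid_args d r Xs \<Longrightarrow> tp_eval d Xs p = fB d r (That (Suc r) \<alpha>) Xs"
proof -
  let ?G = "{\<pi>. \<pi> permutes {..<Suc r}}"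
  have fG: "finite ?G" by (rule finite_permutations) simp
  have "\<exists>\<alpha>. \<forall>Xs i j. valid_args d r Xs \<and> i < d \<and> j < d \<longrightarrow>
      tp_eval d Xs p $$ (i, j) = (\<Sum>\<pi>\<in>?G. \<alpha> \<pi> * fB d r (Tperm (Suc r) \<pi>) Xs $$ (i, j))"
    using assms
  proof (induction p)
    case Nil
    show ?case by (rule exI[of _ "\<lambda>_. 0"]) simp
  next
    case (Cons t p)
    obtain c u ts where t: "t = (c, u, ts)" by (cases t)
    have m: "mset (u @ concat ts) = mset [0..<r]" and mp: "tp_multilinear r p"
      using Cons.prems by (simp_all add: t tp_multilinear_Cons)
    obtain \<alpha> where \<alpha>: "\<And>Xs i j. valid_args d r Xs \<Longrightarrow> i < d \<Longrightarrow> j < d \<Longrightarrow>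
        tp_eval d Xs p $$ (i, j) = (\<Sum>\<pi>\<in>?G. \<alpha> \<pi> * fB d r (Tperm (Suc r) \<pi>) Xs $$ (i, j))"
      using Cons.IH[OF mp] by blast
    obtain \<rho> e where \<rho>: "\<rho> permutes {..<Suc r}"
      "\<And>Xs i j. valid_args d r Xs \<Longrightarrow> i < d \<Longrightarrow> j < d \<Longrightarrow>
        word_eval d Xs u $$ (i, j) * prod_list (map (\<lambda>w. mtrace (word_eval d Xs w)) ts)
        = of_nat d ^ e * fB d r (Tperm (Suc r) \<rho>) Xs $$ (i, j)"
      using term_to_permutation[OF m] by blast
    \<comment> \<open>Different terms may yield the same permutation, so the contribution is added
      to the coefficient already present.\<close>
    define \<beta> where "\<beta> \<pi> = \<alpha> \<pi> + (if \<pi> = \<rho> then c * of_nat d ^ e else 0)" for \<pi>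
    have "tp_eval d Xs (t # p) $$ (i, j) = (\<Sum>\<pi>\<in>?G. \<beta> \<pi> * fB d r (Tperm (Suc r) \<pi>) Xs $$ (i, j))"
      if X: "valid_args d r Xs" and ij: "i < d" "j < d" for Xs i j
    proof -
      have "tp_eval d Xs (t # p) $$ (i, j)
          = c * (of_nat d ^ e * fB d r (Tperm (Suc r) \<rho>) Xs $$ (i, j)) + tp_eval d Xs p $$ (i, j)"
        using tp_eval_entry[OF X Cons.prems ij] tp_eval_entry[OF X mp ij] \<rho>(2)[OF X ij] by (simp add: t)
      also have "c * (of_nat d ^ e * fB d r (Tperm (Suc r) \<rho>) Xs $$ (i, j))
          = (\<Sum>\<pi>\<in>?G. (if \<pi> = \<rho> then c * of_nat d ^ e else 0) * fB d r (Tperm (Suc r) \<pi>) Xs $$ (i, j))"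
      proof -
        have "(\<Sum>\<pi>\<in>?G. (if \<pi> = \<rho> then c * of_nat d ^ e else 0) * fB d r (Tperm (Suc r) \<pi>) Xs $$ (i, j))
            = (\<Sum>\<pi>\<in>?G. if \<pi> = \<rho> then c * of_nat d ^ e * fB d r (Tperm (Suc r) \<pi>) Xs $$ (i, j) else 0)"
          by (rule sum.cong) auto
        then show ?thesis using fG \<rho>(1) by (simp add: mult.assoc)
      qed
      finally show ?thesis
        by (simp add: \<alpha>[OF X ij] \<beta>_def distrib_right sum.distrib add.commute)
    qed
    then show ?case by blast
  qed
  then obtain \<alpha> where \<alpha>: "\<And>Xs i j. valid_args d r Xs \<Longrightarrow> i < d \<Longrightarrow> j < d \<Longrightarrow>
      tp_eval d Xs p $$ (i, j) = (\<Sum>\<pi>\<in>?G. \<alpha> \<pi> * fB d r (Tperm (Suc r) \<pi>) Xs $$ (i, j))"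
    by blast
  show ?thesis
  proof (rule that)
    fix Xs assume X: "valid_args d r Xs"
    show "tp_eval d Xs p = fB d r (That (Suc r) \<alpha>) Xs"
      by (rule eq_matI) (use tp_eval_carrier[OF assms X] fB_carrier[of d r "That (Suc r) \<alpha>" Xs]
        in \<open>simp_all add: \<alpha>[OF X] fB_That[OF X] del: fB_carrier\<close>)
  qed
qed

text \<open>Every permutation contributes one term with coefficient \<alpha> \<pi>; enumerating the
  finite group turns the sum into a list of terms.\<close>

lemma That_multilinear_trace_polynomial: "is_multilinear_tp d r (fB d r (That (Suc r) \<alpha>))"
proof -
  let ?G = "{\<pi>. \<pi> permutes {..<Suc r}}"
  have "\<exists>u ts. mset (u @ concat ts) = mset [0..<r] \<and> word_rep d r {..<r} \<pi> u ts"
    if "\<pi> permutes {..<Suc r}" for \<pi>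
  proof -
    have "\<pi> permutes insert r {..<r}" using that by (simp add: lessThan_Suc)
    then obtain u ts where "distinct (u @ concat ts)" "set (u @ concat ts) = {..<r}" "word_rep d r {..<r} \<pi> u ts"
      using permutation_to_words[of "{..<r}" r \<pi> d] by auto
    moreover from this have "mset (u @ concat ts) = mset [0..<r]"
      by (subst set_eq_iff_mset_eq_distinct[symmetric]) (auto simp: atLeast0LessThan)
    ultimately show ?thesis by blast
  qed
  then obtain u ts where uts: "\<And>\<pi>. \<pi> permutes {..<Suc r} \<Longrightarrow> mset (u \<pi> @ concat (ts \<pi>)) = mset [0..<r]"
    "\<And>\<pi>. \<pi> permutes {..<Suc r} \<Longrightarrow> word_rep d r {..<r} \<pi> (u \<pi>) (ts \<pi>)"
    by metis
  have "finite ?G" by (rule finite_permutations) simp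
  then obtain \<pi>s where \<pi>s: "set \<pi>s = ?G" "distinct \<pi>s"
    using finite_distinct_list by blast
  define p where "p = map (\<lambda>\<pi>. (\<alpha> \<pi>, u \<pi>, ts \<pi>)) \<pi>s"
  have mp: "tp_multilinear r p" using uts(1) \<pi>s(1) by (auto simp: tp_multilinear_def p_def)
  have "fB d r (That (Suc r) \<alpha>) Xs = tp_eval d Xs p" if X: "valid_args d r Xs" for Xs
  proof (rule eq_matI)
    fix i j assume "i < dim_row (tp_eval d Xs p)" "j < dim_col (tp_eval d Xs p)"
    then have ij: "i < d" "j < d" using tp_eval_carrier[OF mp X] by auto
    have "tp_eval d Xs p $$ (i, j) = (\<Sum>\<pi>\<leftarrow>\<pi>s. \<alpha> \<pi> * (word_eval d Xs (u \<pi>) $$ (i, j)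
        * prod_list (map (\<lambda>w. mtrace (word_eval d Xs w)) (ts \<pi>))))"
      by (subst tp_eval_entry[OF X mp ij]) (simp add: p_def comp_def)
    also have "\<dots> = (\<Sum>\<pi>\<in>?G. \<alpha> \<pi> * (word_eval d Xs (u \<pi>) $$ (i, j)
        * prod_list (map (\<lambda>w. mtrace (word_eval d Xs w)) (ts \<pi>))))"
      using \<pi>s by (simp add: sum_list_distinct_conv_sum_set)
    also have "\<dots> = (\<Sum>\<pi>\<in>?G. \<alpha> \<pi> * fB d r (Tperm (Suc r) \<pi>) Xs $$ (i, j))"
      using fB_Tperm[OF _ uts(2) X ij] by (intro sum.cong) auto
    finally show "fB d r (That (Suc r) \<alpha>) Xs $$ (i, j) = tp_eval d Xs p $$ (i, j)"
      by (simp add: fB_That[OF X ij])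
  qed (use tp_eval_carrier[OF mp X] fB_carrier[of d r "That (Suc r) \<alpha>" Xs] in \<open>simp_all del: fB_carrier\<close>)
  then show ?thesis using mp unfolding is_multilinear_tp_def by blast
qed

section \<open>Block-positive operators are hermitian\<close>

lemma pairing_linear:
  assumes "length Xs = n" "m < n"
    and Y: "\<And>i j. i < d \<Longrightarrow> j < d \<Longrightarrow> Y $$ (i, j) = (\<Sum>x\<in>S. c x * P x $$ (i, j))"
  shows "pairing d n D (Xs[m := Y]) = (\<Sum>x\<in>S. c x * pairing d n D (Xs[m := P x]))"
proof -
  have t: "tens (Xs[m := Y]) K I = (\<Sum>x\<in>S. c x * tens (Xs[m := P x]) K I)"
    if "K \<in> idx d n" "I \<in> idx d n" for K I
    using assms that by (simp add: tens_update idx_nth sum_distrib_right mult.assoc)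
  have "pairing d n D (Xs[m := Y])
      = (\<Sum>I\<in>idx d n. \<Sum>K\<in>idx d n. \<Sum>x\<in>S. c x * (D I K * tens (Xs[m := P x]) K I))"
    by (simp add: op_trace_def op_mult_def t sum_distrib_left mult_ac)
  also have "\<dots> = (\<Sum>I\<in>idx d n. \<Sum>x\<in>S. \<Sum>K\<in>idx d n. c x * (D I K * tens (Xs[m := P x]) K I))"
    by (intro sum.cong refl sum.swap)
  also have "\<dots> = (\<Sum>x\<in>S. \<Sum>I\<in>idx d n. \<Sum>K\<in>idx d n. c x * (D I K * tens (Xs[m := P x]) K I))"
    by (rule sum.swap)
  finally show ?thesis by (simp add: op_trace_def op_mult_def sum_distrib_left)
qed

text \<open>Slots are freed one at a time: the first m arguments are arbitrary, and polarization
  writes a newly freed one as a combination of rank-one positive matrices. The case m = n covers all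
  arguments.\<close>

lemma pairing_zero_of_psd:
  assumes zero: "\<And>Xs. length Xs = n \<Longrightarrow> \<forall>X\<in>set Xs. psd d X \<Longrightarrow> pairing d n D Xs = 0"
    and "m \<le> n" "length Xs = n" "\<And>k. m \<le> k \<Longrightarrow> k < n \<Longrightarrow> psd d (Xs ! k)"
  shows "pairing d n D Xs = 0"
  using assms(2-)
proof (induction m arbitrary: Xs)
  case 0
  then show ?case by (intro zero) (auto simp: in_set_conv_nth)
next
  case (Suc m)
  define u where "u a b k x = (if x = a then 1 else 0) + \<i> ^ k * (if x = b then 1 else 0)"
    for a b k x :: nat
  define P where "P = (\<lambda>(a, b, k). mat d d (\<lambda>(i, j). u a b k i * cnj (u a b k j)))"
  define c where "c = (\<lambda>(a, b, k::nat). (Xs ! m) $$ (a, b) * \<i> ^ k / 4)"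
  let ?S = "{..<d} \<times> {..<d} \<times> {..<4}"
  have ent: "(Xs ! m) $$ (i, j) = (\<Sum>x\<in>?S. c x * P x $$ (i, j))" if "i < d" "j < d" for i j
    using polarization[OF that, of "\<lambda>i j. (Xs ! m) $$ (i, j)"] that
    by (simp add: sum.cartesian_product c_def P_def u_def cong: sum.cong) (auto intro!: sum.cong)
  have z: "pairing d n D (Xs[m := P x]) = 0" for x
  proof (rule Suc.IH)
    fix k assume k: "m \<le> k" "k < n"
    have "psd d (P x)" unfolding P_def by (cases x) (simp add: rank_one_psd)
    then show "psd d (Xs[m := P x] ! k)"
      using k Suc.prems by (cases "k = m") auto
  qed (use Suc.prems in auto)
  have "pairing d n D (Xs[m := Xs ! m]) = (\<Sum>x\<in>?S. c x * pairing d n D (Xs[m := P x]))"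
    using Suc.prems ent by (intro pairing_linear) auto
  then show ?case by (simp add: z)
qed

text \<open>Positive semidefinite factors are hermitian, hence so is their tensor product; taking
  the adjoint of B then conjugates the trace.\<close>

lemma pairing_adjoint:
  assumes "length Xs = n" "\<forall>X\<in>set Xs. psd d X"
  shows "pairing d n (\<lambda>I J. cnj (B J I)) Xs = cnj (pairing d n B Xs)"
proof -
  have h: "tens Xs K I = cnj (tens Xs I K)" if "I \<in> idx d n" "K \<in> idx d n" for I K
    unfolding tens_def cnj_prod assms(1)
  proof (rule prod.cong)
    fix k assume "k \<in> {..<n}"
    then have k: "k < n" by simp
    then have "psd d (Xs ! k)" using assms by auto
    then show "Xs ! k $$ (K ! k, I ! k) = cnj (Xs ! k $$ (I ! k, K ! k))"
      using idx_nth[OF that(1) k] idx_nth[OF that(2) k]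
      by (intro qform_hermitian[of "{..<d}"]) (auto simp: psd_qform)
  qed simp
  have "pairing d n (\<lambda>I J. cnj (B J I)) Xs = (\<Sum>I\<in>idx d n. \<Sum>K\<in>idx d n. cnj (B K I * tens Xs I K))"
    unfolding op_trace_def op_mult_def
  proof (intro sum.cong refl)
    fix I K assume "I \<in> idx d n" "K \<in> idx d n"
    then show "cnj (B K I) * tens Xs K I = cnj (B K I * tens Xs I K)" using h[of I K] by simp
  qed
  also have "\<dots> = cnj (pairing d n B Xs)"
    unfolding op_trace_def op_mult_def cnj_sum by (rule sum.swap)
  finally show ?thesis .
qed

text \<open>All pairings with positive factors are real, so B minus its adjoint pairs to 0 with them
  and, after polarization, with all elementary tensors.\<close>

lemma block_positive_hermitian:
  assumes "1 \<le> d" "block_positive d n B"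
  shows "op_hermitian d n B"
  unfolding op_hermitian_def
proof (intro ballI)
  fix I J assume I: "I \<in> idx d n" and J: "J \<in> idx d n"
  define D where "D = (\<lambda>I J. B I J - cnj (B J I))"
  have zero: "pairing d n D Xs = 0" if "length Xs = n" "\<forall>X\<in>set Xs. psd d X" for Xs
  proof -
    have "pairing d n D Xs = pairing d n B Xs - pairing d n (\<lambda>I J. cnj (B J I)) Xs"
      by (simp add: D_def op_trace_def op_mult_def left_diff_distrib sum_subtractf)
    then show ?thesis
      using block_positive_psd[OF assms that] pairing_adjoint[OF that, of B]
      by (simp add: nonneg_c_def complex_eq_iff)
  qed
  \<comment> \<open>The trace multiplies the entry (I, J) of D by the entry (J, I) of the tensor,
    hence rows from J and columns from I.\<close>
  let ?Xs = "map (\<lambda>k. mat_unit d (J ! k) (I ! k)) [0..<n]"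
  have "pairing d n D ?Xs = 0" by (rule pairing_zero_of_psd[OF zero, of n]) auto
  moreover have "tens ?Xs K L = (if K = J \<and> L = I then 1 else 0)"
    if "K \<in> idx d n" "L \<in> idx d n" for K L
    using tens_mat_units[OF that J I] by (simp add: tens_def)
  then have "pairing d n D ?Xs = (\<Sum>L\<in>idx d n. \<Sum>K\<in>idx d n. if K = J then (if L = I then D L K else 0) else 0)"
    unfolding op_trace_def op_mult_def by (intro sum.cong refl) auto
  then have "pairing d n D ?Xs = D I J" using I J by simp
  ultimately show "B I J = cnj (B J I)" by (simp add: D_def)
qed

section \<open>Positivity and optimality\<close>

lemma pairing_snoc_rank_one:
  assumes "valid_args d r Xs"
  shows "pairing d (Suc r) B (Xs @ [mat d d (\<lambda>(i, j). v i * cnj (v j))])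
    = qform {..<d} (\<lambda>i j. fB d r B Xs $$ (i, j)) v"
  by (simp add: op_trace_tens_snoc[OF assms] qform_def mult_ac)

lemma psd_valid_args: "length Xs = r \<Longrightarrow> \<forall>X\<in>set Xs. psd d X \<Longrightarrow> valid_args d r Xs"
  by (auto simp: valid_args_def psd_def)

lemma block_positive_positive_on_cone:
  assumes "1 \<le> d" "block_positive d (Suc r) B"
  shows "positive_on_cone d r (fB d r B)"
  unfolding positive_on_cone_def
proof (intro allI impI)
  fix Xs assume X: "length Xs = r \<and> (\<forall>X\<in>set Xs. psd d X)"
  then have v: "valid_args d r Xs" by (intro psd_valid_args) auto
  have "nonneg_c (qform {..<d} (\<lambda>i j. fB d r B Xs $$ (i, j)) v)" for v
    unfolding pairing_snoc_rank_one[OF v, symmetric]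
    by (rule block_positive_psd[OF assms]) (use X rank_one_psd in auto)
  then show "psd d (fB d r B Xs)" by (simp add: psd_qform)
qed

lemma positive_on_cone_block_positive:
  assumes "positive_on_cone d r (fB d r B)"
  shows "block_positive d (Suc r) B"
  unfolding block_positive_iff_states
proof (intro allI impI)
  fix \<rho>s assume \<rho>: "length \<rho>s = Suc r \<and> (\<forall>M\<in>set \<rho>s. state_mat d M)"
  then obtain Xs Y where XY: "\<rho>s = Xs @ [Y]" by (metis length_Suc_conv_rev)
  then have X: "length Xs = r" "\<forall>X\<in>set Xs. psd d X" and Y: "psd d Y"
    using \<rho> by (auto simp: state_mat_def)
  have "psd d (fB d r B Xs)" using assms X by (simp add: positive_on_cone_def)
  then show "nonneg_c (pairing d (Suc r) B \<rho>s)"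
    unfolding XY op_trace_tens_snoc[OF psd_valid_args[OF X]] using Y by (rule psd_trace_mult_nonneg)
qed

section \<open>Zero eigenvalues and zero product states\<close>

lemma eigenvalue_zero_iff:
  assumes "A \<in> carrier_mat d d"
  shows "eigenvalue A 0 \<longleftrightarrow> (\<exists>v. (\<exists>i<d. v i \<noteq> 0) \<and> (\<forall>i<d. (\<Sum>j<d. A $$ (i, j) * v j) = 0))"
proof
  assume "eigenvalue A 0"
  then obtain w where w: "w \<in> carrier_vec d" "w \<noteq> 0\<^sub>v d" "A *\<^sub>v w = 0 \<cdot>\<^sub>v w"
    using assms by (auto simp: eigenvalue_def eigenvector_def)
  have "\<exists>i<d. w $ i \<noteq> 0" using w(1,2) by (metis carrier_vecD eq_vecI index_zero_vec)
  moreover have "(\<Sum>j<d. A $$ (i, j) * w $ j) = 0" if "i < d" for i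
  proof -
    have "(A *\<^sub>v w) $ i = 0" using w that by simp
    then show ?thesis using assms w(1) that by (simp add: scalar_prod_def lessThan_atLeast0)
  qed
  ultimately show "\<exists>v. (\<exists>i<d. v i \<noteq> 0) \<and> (\<forall>i<d. (\<Sum>j<d. A $$ (i, j) * v j) = 0)" by blast
next
  assume "\<exists>v. (\<exists>i<d. v i \<noteq> 0) \<and> (\<forall>i<d. (\<Sum>j<d. A $$ (i, j) * v j) = 0)"
  then obtain v i where v: "i < d" "v i \<noteq> 0" "\<forall>i<d. (\<Sum>j<d. A $$ (i, j) * v j) = 0" by blast
  have "A *\<^sub>v vec d v = 0 \<cdot>\<^sub>v vec d v"
    by (rule eq_vecI) (use assms v(3) in \<open>auto simp: scalar_prod_def lessThan_atLeast0\<close>)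
  moreover have "vec d v \<noteq> 0\<^sub>v d" using v(1,2) by (metis index_vec index_zero_vec(1))
  ultimately show "eigenvalue A 0"
    using assms by (auto simp: eigenvalue_def eigenvector_def intro!: exI[of _ "vec d v"])
qed

text \<open>At an eigenvector the form equals k times the squared norm, which is positive.\<close>

lemma psd_eigenvalue_nonneg:
  assumes "psd d A" "eigenvalue A k"
  shows "Im k = 0 \<and> 0 \<le> Re k"
proof -
  have A: "A \<in> carrier_mat d d" using assms by (simp add: psd_def)
  obtain w where w: "w \<in> carrier_vec d" "w \<noteq> 0\<^sub>v d" "A *\<^sub>v w = k \<cdot>\<^sub>v w"
    using assms(2) A by (auto simp: eigenvalue_def eigenvector_def)
  have Aw: "(\<Sum>j<d. A $$ (i, j) * w $ j) = k * w $ i" if "i < d" for i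
  proof -
    have "(A *\<^sub>v w) $ i = k * w $ i" using w that by simp
    then show ?thesis using A w(1) that by (simp add: scalar_prod_def lessThan_atLeast0)
  qed
  define N where "N = (\<Sum>i<d. (cmod (w $ i))\<^sup>2)"
  have "qform {..<d} (\<lambda>i j. A $$ (i, j)) (\<lambda>i. w $ i) = (\<Sum>i<d. cnj (w $ i) * (\<Sum>j<d. A $$ (i, j) * w $ j))"
    by (simp add: qform_def sum_distrib_left mult.assoc)
  also have "\<dots> = (\<Sum>i<d. k * complex_of_real ((cmod (w $ i))\<^sup>2))"
  proof (rule sum.cong)
    fix i assume "i \<in> {..<d}"
    then have "(\<Sum>j<d. A $$ (i, j) * w $ j) = k * w $ i" using Aw by simp
    then show "cnj (w $ i) * (\<Sum>j<d. A $$ (i, j) * w $ j) = k * complex_of_real ((cmod (w $ i))\<^sup>2)"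
      by (simp only: complex_norm_square) (simp add: mult_ac)
  qed simp
  also have "\<dots> = k * complex_of_real N"
    by (simp add: N_def sum_distrib_left)
  finally have "nonneg_c (k * complex_of_real N)"
    using assms(1) unfolding psd_qform by metis
  moreover have "0 < N"
  proof -
    obtain i where "i < d" "w $ i \<noteq> 0" using w(1,2) by (metis carrier_vecD eq_vecI index_zero_vec)
    then show ?thesis unfolding N_def by (intro sum_pos2[of _ i]) auto
  qed
  ultimately show ?thesis by (auto simp: nonneg_c_def zero_le_mult_iff)
qed

text \<open>The kernel of a positive semidefinite matrix is the zero set of its form, and no
  eigenvalue can be negative.\<close>

lemma smallest_eig_zero_psd_iff:
  assumes "psd d A"
  shows "smallest_eig_zero A \<longleftrightarrow> (\<exists>v. (\<exists>i<d. v i \<noteq> 0) \<and> qform {..<d} (\<lambda>i j. A $$ (i, j)) v = 0)"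
proof -
  have A: "A \<in> carrier_mat d d" using assms by (simp add: psd_def)
  have "(\<forall>i<d. (\<Sum>j<d. A $$ (i, j) * v j) = 0) \<longleftrightarrow> qform {..<d} (\<lambda>i j. A $$ (i, j)) v = 0" for v
  proof
    assume "\<forall>i<d. (\<Sum>j<d. A $$ (i, j) * v j) = 0"
    moreover have "qform {..<d} (\<lambda>i j. A $$ (i, j)) v = (\<Sum>i<d. cnj (v i) * (\<Sum>j<d. A $$ (i, j) * v j))"
      by (simp add: qform_def sum_distrib_left mult.assoc)
    ultimately show "qform {..<d} (\<lambda>i j. A $$ (i, j)) v = 0" by simp
  qed (use psd_qform_zero[OF assms] in blast)
  then show ?thesis
    using psd_eigenvalue_nonneg[OF assms] by (auto simp: smallest_eig_zero_def eigenvalue_zero_iff[OF A])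
qed

lemma state_mat_nonzero: "state_mat d \<rho> \<Longrightarrow> \<rho> \<noteq> 0\<^sub>m d d"
  by (auto simp: state_mat_def mtrace_def)

text \<open>A null vector v supplies the last factor as its rank-one matrix. Conversely, a last
  factor of any rank splits into Gram vectors, at each of which the form must vanish.\<close>

lemma optimal_tp_ineq_iff_zero_product_state:
  assumes "1 \<le> d" and bp: "block_positive d (Suc r) W"
  shows "optimal_tp_ineq d r (fB d r W) \<longleftrightarrow>
    (\<exists>\<rho>s. length \<rho>s = Suc r \<and> (\<forall>M\<in>set \<rho>s. state_mat d M) \<and> pairing d (Suc r) W \<rho>s = 0)"
proof
  assume "optimal_tp_ineq d r (fB d r W)"
  then obtain Xs where X: "length Xs = r" "\<forall>X\<in>set Xs. psd d X" "\<forall>X\<in>set Xs. X \<noteq> 0\<^sub>m d d"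
    and sm: "smallest_eig_zero (fB d r W Xs)" by (auto simp: optimal_tp_ineq_def)
  have pf: "psd d (fB d r W Xs)"
    using block_positive_positive_on_cone[OF assms] X by (simp add: positive_on_cone_def)
  obtain v i where v: "i < d" "v i \<noteq> 0" "qform {..<d} (\<lambda>i j. fB d r W Xs $$ (i, j)) v = 0"
    using sm unfolding smallest_eig_zero_psd_iff[OF pf] by blast
  let ?Y = "mat d d (\<lambda>(i, j). v i * cnj (v j))"
  have Y: "psd d ?Y" by (rule rank_one_psd)
  have "?Y $$ (i, i) \<noteq> 0" using v by simp
  then have Y0: "?Y \<noteq> 0\<^sub>m d d" using v(1) by (metis index_zero_mat(1))
  let ?Z = "Xs @ [?Y]"
  have Z: "length ?Z = Suc r" "\<forall>X\<in>set ?Z. psd d X" using X Y by auto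
  obtain t \<rho>s where t: "length \<rho>s = Suc r" "\<forall>M\<in>set \<rho>s. state_mat d M"
    "\<And>k. k < Suc r \<Longrightarrow> ?Z ! k \<noteq> 0\<^sub>m d d \<Longrightarrow> 0 < t k"
    "\<And>B. pairing d (Suc r) B ?Z = complex_of_real (\<Prod>k<Suc r. t k) * pairing d (Suc r) B \<rho>s"
    using psd_list_scaled_states[OF assms(1) Z] by metis
  \<comment> \<open>All factors are nonzero, so normalization divides by a positive number and
    preserves the zero.\<close>
  have "?Z ! k \<noteq> 0\<^sub>m d d" if "k < Suc r" for k
    using that X Y0 nth_mem[of k ?Z] by auto
  then have "(\<Prod>k<Suc r. t k) > 0" using t(3) by (intro prod_pos) auto
  then have "complex_of_real (\<Prod>k<Suc r. t k) \<noteq> 0" by (metis less_irrefl of_real_eq_0_iff)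
  moreover have "pairing d (Suc r) W ?Z = 0"
    using v(3) pairing_snoc_rank_one[OF psd_valid_args[OF X(1,2)]] by simp
  ultimately have "pairing d (Suc r) W \<rho>s = 0" using t(4)[of W] by (metis mult_eq_0_iff)
  then show "\<exists>\<rho>s. length \<rho>s = Suc r \<and> (\<forall>M\<in>set \<rho>s. state_mat d M) \<and> pairing d (Suc r) W \<rho>s = 0"
    using t(1,2) by blast
next
  assume "\<exists>\<rho>s. length \<rho>s = Suc r \<and> (\<forall>M\<in>set \<rho>s. state_mat d M) \<and> pairing d (Suc r) W \<rho>s = 0"
  then obtain \<rho>s where \<rho>: "length \<rho>s = Suc r" "\<forall>M\<in>set \<rho>s. state_mat d M" "pairing d (Suc r) W \<rho>s = 0"
    by blast
  then obtain Xs Y where XY: "\<rho>s = Xs @ [Y]" by (metis length_Suc_conv_rev)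
  then have X: "length Xs = r" "\<forall>X\<in>set Xs. psd d X" and X0: "\<forall>X\<in>set Xs. X \<noteq> 0\<^sub>m d d"
    and Y: "psd d Y" "Y \<noteq> 0\<^sub>m d d"
    using \<rho> state_mat_nonzero by (auto simp: state_mat_def)
  have pos: "positive_on_cone d r (fB d r W)" by (rule block_positive_positive_on_cone[OF assms])
  then have pf: "psd d (fB d r W Xs)" using X by (simp add: positive_on_cone_def)
  obtain u and m :: nat where "\<forall>i<d. \<forall>j<d. Y $$ (i, j) = (\<Sum>k<m. u k i * cnj (u k j))"
    using psd_rank_one_sum[OF Y(1)] by (elim exE)
  then have u: "\<And>i j. i < d \<Longrightarrow> j < d \<Longrightarrow> Y $$ (i, j) = (\<Sum>k<m. u k i * cnj (u k j))" by blast
  have "(\<Sum>i<d. \<Sum>j<d. fB d r W Xs $$ (i, j) * Y $$ (j, i))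
      = (\<Sum>k<m. qform {..<d} (\<lambda>i j. fB d r W Xs $$ (i, j)) (u k))"
    by (rule sum_mult_rank_one) (rule u)
  then have z: "(\<Sum>k<m. qform {..<d} (\<lambda>i j. fB d r W Xs $$ (i, j)) (u k)) = 0"
    using \<rho>(3) unfolding XY op_trace_tens_snoc[OF psd_valid_args[OF X]] by simp
  have qz: "qform {..<d} (\<lambda>i j. fB d r W Xs $$ (i, j)) (u k) = 0" if "k < m" for k
    by (rule sum_nonneg_c_eq_0[OF finite_lessThan _ z]) (use that pf in \<open>auto simp: psd_qform\<close>)
  \<comment> \<open>A nonzero Y has a nonzero Gram vector; this is the null vector required for the
    eigenvalue 0.\<close>
  have "\<exists>k<m. \<exists>i<d. u k i \<noteq> 0"
  proof (rule ccontr)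
    assume "\<not> ?thesis"
    then have "Y $$ (i, j) = 0" if "i < d" "j < d" for i j using that by (simp add: u)
    then have "Y = 0\<^sub>m d d" using Y(1) by (intro eq_matI) (auto simp: psd_def)
    then show False using Y(2) by simp
  qed
  then have "smallest_eig_zero (fB d r W Xs)"
    unfolding smallest_eig_zero_psd_iff[OF pf] using qz by blast
  then show "optimal_tp_ineq d r (fB d r W)"
    using pos X X0 by (auto simp: optimal_tp_ineq_def)
qed

text \<open>The pairing with a separable state is a sum of nonnegative terms, so each of them
  vanishes, and weights summing to 1 cannot all be 0.\<close>

lemma zero_separable_iff_zero_product_state:
  assumes "block_positive d n W"
  shows "(\<exists>\<rho>. separable d n \<rho> \<and> op_trace d n (op_mult d n W \<rho>) = 0) \<longleftrightarrow>
    (\<exists>\<rho>s. length \<rho>s = n \<and> (\<forall>M\<in>set \<rho>s. state_mat d M) \<and> pairing d n W \<rho>s = 0)"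
proof
  assume "\<exists>\<rho>. separable d n \<rho> \<and> op_trace d n (op_mult d n W \<rho>) = 0"
  then obtain \<rho> m c \<rho>s where c: "\<forall>k<m. 0 \<le> c k" "(\<Sum>k<m. c k) = (1::real)"
    and s: "\<forall>k<m. length (\<rho>s k) = n \<and> (\<forall>M\<in>set (\<rho>s k). state_mat d M)"
    and eq: "op_eq d n \<rho> (\<lambda>I J. \<Sum>k<(m::nat). complex_of_real (c k) * tens (\<rho>s k) I J)"
    and z: "op_trace d n (op_mult d n W \<rho>) = 0"
    unfolding separable_def by blast
  have *: "(\<Sum>k<m. complex_of_real (c k) * pairing d n W (\<rho>s k)) = 0"
    using z unfolding op_trace_mult_cong[OF op_eq_refl eq] op_trace_mult_sum .
  have "\<exists>k<m. c k \<noteq> 0" using c(2) by (metis lessThan_iff sum.neutral zero_neq_one)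
  then obtain k where k: "k < m" "c k \<noteq> 0" by blast
  have "complex_of_real (c k) * pairing d n W (\<rho>s k) = 0"
    by (rule sum_nonneg_c_eq_0[OF finite_lessThan _ *])
      (use k c s assms in \<open>auto simp: block_positive_iff_states intro!: nonneg_c_scale\<close>)
  then show "\<exists>\<rho>s. length \<rho>s = n \<and> (\<forall>M\<in>set \<rho>s. state_mat d M) \<and> pairing d n W \<rho>s = 0"
    using k s by (intro exI[of _ "\<rho>s k"]) simp
next
  assume "\<exists>\<rho>s. length \<rho>s = n \<and> (\<forall>M\<in>set \<rho>s. state_mat d M) \<and> pairing d n W \<rho>s = 0"
  then show "\<exists>\<rho>. separable d n \<rho> \<and> op_trace d n (op_mult d n W \<rho>) = 0"
    using separable_tens by blast
qed

theorem theorem5: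
  fixes d r :: nat
  assumes "1 \<le> d" and "1 \<le> r"
  shows
    "(\<forall>p. tp_multilinear r p \<and> positive_on_cone d r (\<lambda>Xs. tp_eval d Xs p) \<longrightarrow>
        (\<exists>\<alpha>. (\<forall>Xs. valid_args d r Xs \<longrightarrow> tp_eval d Xs p = fB d r (That (Suc r) \<alpha>) Xs) \<and>
             op_hermitian d (Suc r) (That (Suc r) \<alpha>) \<and>
             block_positive d (Suc r) (That (Suc r) \<alpha>) \<and>
             unitary_invariant d (Suc r) (That (Suc r) \<alpha>)))
     \<and> (\<forall>B. block_positive d (Suc r) B \<and> unitary_invariant d (Suc r) B \<longrightarrow>
           is_multilinear_tp d r (fB d r B) \<and> positive_on_cone d r (fB d r B))
     \<and> (\<forall>W. block_positive d (Suc r) W \<and> unitary_invariant d (Suc r) W \<and>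
            entanglement_witness d (Suc r) W \<longrightarrow>
           (optimal_tp_ineq d r (fB d r W) \<longleftrightarrow> optimal_witness d (Suc r) W))"
proof (intro conjI allI impI)
  fix p assume p: "tp_multilinear r p \<and> positive_on_cone d r (\<lambda>Xs. tp_eval d Xs p)"
  then obtain \<alpha> where \<alpha>: "\<And>Xs. valid_args d r Xs \<Longrightarrow> tp_eval d Xs p = fB d r (That (Suc r) \<alpha>) Xs"
    using trace_polynomial_eq_That[of r p d] by blast
  then have "positive_on_cone d r (fB d r (That (Suc r) \<alpha>))"
    using p psd_valid_args by (simp add: positive_on_cone_def)
  then have "block_positive d (Suc r) (That (Suc r) \<alpha>)" by (rule positive_on_cone_block_positive)
  then show "\<exists>\<alpha>. (\<forall>Xs. valid_args d r Xs \<longrightarrow> tp_eval d Xs p = fB d r (That (Suc r) \<alpha>) Xs) \<and>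
             op_hermitian d (Suc r) (That (Suc r) \<alpha>) \<and>
             block_positive d (Suc r) (That (Suc r) \<alpha>) \<and>
             unitary_invariant d (Suc r) (That (Suc r) \<alpha>)"
    using \<alpha> block_positive_hermitian[OF assms(1)] That_unitary_invariant by blast
next
  fix B assume B: "block_positive d (Suc r) B \<and> unitary_invariant d (Suc r) B"
  then obtain \<alpha> where "op_eq d (Suc r) B (That (Suc r) \<alpha>)" using schur_weyl by blast
  then have "fB d r B Xs = fB d r (That (Suc r) \<alpha>) Xs" if "valid_args d r Xs" for Xs
    using that by (intro fB_cong)
  then show "is_multilinear_tp d r (fB d r B)"
    using That_multilinear_trace_polynomial[of d r \<alpha>] by (simp add: is_multilinear_tp_def)
  show "positive_on_cone d r (fB d r B)"
    using B by (intro block_positive_positive_on_cone[OF assms(1)]) simp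
next
  fix W assume W: "block_positive d (Suc r) W \<and> unitary_invariant d (Suc r) W \<and> entanglement_witness d (Suc r) W"
  \<comment> \<open>With W an entanglement witness by assumption, both sides amount to a product
    state with vanishing pairing.\<close>
  then show "optimal_tp_ineq d r (fB d r W) \<longleftrightarrow> optimal_witness d (Suc r) W"
    using optimal_tp_ineq_iff_zero_product_state[OF assms(1), of r W]
      zero_separable_iff_zero_product_state[of d "Suc r" W]
    by (simp add: optimal_witness_def)
qed

end
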